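(* Let $p\ge1$, $d\geq 1$, $T>0$, and let $X:[0,T]\to G_d^{[p]}$ be a branched $p$-rough path; put $\omega(s,t):=\|X\|^p_{p-var,[s,t]}$. Suppose $\beta_i$, $i=1,2$, are slowly-varying one-forms along $X$ taking values in $\mathbb{R}$, and suppose that for some $\theta\in\left(1,\frac{[p]+1}{p}\right]$, $\|\beta_i\|_\theta<\infty$ for $i=1,2$. For $t\in[0,T]$ and $a\in G_d^{[p]}$, define $$\beta(X_t)(a):=\int_0^t\beta_1(X_r)dX_r\ \beta_2(X_t)(a)+\beta_1(X_t)(a)\int_0^t\beta_2(X_r)dX_r+\left(\beta_1(X_t)\beta_2(X_t)\right)(a).$$ Then $\beta$ is a slowly-varying one-form along $X$ taking values in $\mathbb{R}$, and there exists a constant $C$ depending only on $p,d,\theta,\omega(0,T)$ such that $$\|\beta\|_\theta\le C\,\|\beta_1\|_\theta\|\beta_2\|_\theta.$$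
   Context: **Trees and forests.** Trees are finite rooted non-planar trees with vertices labelled by $\{1,\dots,d\}$; a forest is a commutative monomial of trees, including the empty forest $\epsilon$; $|\rho|$ is the number of vertices ($|\epsilon|=0$). $F_d$ is the set of labelled forests, $F_d^n$ the subset of forests of degree $1,\dots,n$. $[\rho]_j$ is the tree obtained by grafting the roots of all trees of $\rho$ to a new root labelled $j$. **The group $G_d^n$.** $\bigtriangleup$ is the labelled Connes–Kreimer coproduct (admissible cuts), multiplicative on forests, with $\bigtriangleup[\rho]_j=[\rho]_j\otimes1+\sum_{\bigtriangleup\rho}\rho_{(1)}\otimes[\rho_{(2)}]_j$, where $\bigtriangleup\rho=\sum_{\bigtriangleup\rho}\rho_{(1)}\otimes\rho_{(2)}$. $G_d^n$ is the step-$n$ truncated group of characters: maps $a:F_d\to\mathbb{R}$ with $(a,\epsilon)=1$, $(a,\rho_1\rho_2)=(a,\rho_1)(a,\rho_2)$ if $|\rho_1|+|\rho_2|\le n$, $(a,\rho)=0$ if $|\rho|>n$; product $(ab,\rho)=\sum_{\bigtriangleup\rho}(a,\rho_{(1)})(b,\rho_{(2)})$ for $|\rho|\le n$; norm $\|a\|:=\max_{1\le|\rho|\le n}|(a,\rho)|^{1/|\rho|}$. **Rough paths.** $[p]$ is the largest integer $\le p$. $X_{s,t}:=X_s^{-1}X_t$; $\|X\|_{p-var,[s,t]}:=\sup_D(\sum_k\|X_{t_k,t_{k+1}}\|^p)^{1/p}$ over finite partitions $D=\{t_k\}$ of $[s,t]$. $X:[0,T]\to G_d^{[p]}$ is a branched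 $p$-rough path if it is continuous and $\|X\|_{p-var,[0,T]}<\infty$. **Slowly-varying one-forms.** For $a\in G_d^{[p]}$ let $E_a^{\mathbb{R}}$ be the vector space of functions $\phi:G_d^{[p]}\to\mathbb{R}$ of the form $\phi(c)=\sum_{\rho\in F_d^{[p]}}\phi^\rho(c,\rho)$ with $\phi^\rho\in\mathbb{R}$; $\|\phi\|_\rho:=|\phi^\rho|$ and $\|\phi\|:=\max_{\rho\in F_d^{[p]}}\|\phi\|_\rho$. For $\phi\in E_a^{\mathbb{R}}$ and $b\in G_d^{[p]}$, the parallel translate $\phi_b\in E_{ab}^{\mathbb{R}}$ is $\phi_b(c):=\phi(bc)-\phi(b)$. A map $\beta:X_t\mapsto\beta(X_t)\in E_{X_t}^{\mathbb{R}}$, $t\in[0,T]$, is a slowly-varying one-form along $X$ taking values in $\mathbb{R}$ if there is $\theta>1$ with $$\|\beta\|_\theta:=\sup_{t\in[0,T]}\|\beta(X_t)\|+\max_{\rho\in F_d^{[p]}}\sup_{0\le s<t\le T}\frac{\|\beta(X_t)-\beta(X_s)_{X_{s,t}}\|_\rho}{\omega(s,t)^{\theta-\frac{|\rho|}{p}}}<\infty.$$ Its integral is $\int_0^t\beta(X_r)dX_r:=\lim_{|D|\to0}\sum_k\beta(X_{t_k})(X_{t_k,t_{k+1}})$ over finite partitions $D=\{t_k\}$ of $[0,t]$ as the mesh tends to zero (the limit exists for slowly-varying $\beta$). **Product of linear maps.** For $\phi_i=\sum_{\rho_i\in F_d^{[p]}}\phi_i^{\rho_i}(\cdot,\rho_i)$,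 $i=1,2$, $(\phi_1\phi_2)(a):=\sum_{\rho_1,\rho_2\in F_d^{[p]},\,|\rho_1|+|\rho_2|\le[p]}\phi_1^{\rho_1}\phi_2^{\rho_2}(a,\rho_1\rho_2)$ for $a\in G_d^{[p]}$. *)

theory Defs
  imports
    "HOL-Analysis.Analysis"
    "HOL-Algebra.Group"
    "HOL-Library.Multiset"
begin

section \<open>Labelled trees and forests\<close>

text \<open>Children form a multiset: trees are non-planar, and a forest is a commutative
  monomial of trees (product \<open>+\<close>, unit \<open>{#}\<close>).\<close>

datatype 'l tree = Node 'l "'l tree multiset"

type_synonym forest = "nat tree multiset"

primrec tree_degree :: "'l tree \<Rightarrow> nat" where
  "tree_degree (Node j \<rho>) = Suc (\<Sum>\<tau>\<in>#\<rho>. tree_degree \<tau>)"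

definition forest_degree :: "'l tree multiset \<Rightarrow> nat" where
  "forest_degree \<rho> = (\<Sum>\<tau>\<in>#\<rho>. tree_degree \<tau>)"

definition forests :: "nat \<Rightarrow> forest set" where
  "forests d = {\<rho>. \<forall>\<tau>\<in>#\<rho>. set_tree \<tau> \<subseteq> {1..d}}"

definition forests_upto :: "nat \<Rightarrow> nat \<Rightarrow> forest set" where
  "forests_upto d n = {\<rho> \<in> forests d. 1 \<le> forest_degree \<rho> \<and> forest_degree \<rho> \<le> n}"


section \<open>The Connes--Kreimer coproduct\<close>

text \<open>An element \<open>\<Sum> \<rho>\<^sub>1 \<otimes> \<rho>\<^sub>2\<close> of the tensor square with natural-number coefficients is
  represented by the multiset of the pairs \<open>(\<rho>\<^sub>1, \<rho>\<^sub>2)\<close>.\<close>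

type_synonym 'l tensor = "('l tree multiset \<times> 'l tree multiset) multiset"

definition tensor_mult :: "'l tensor \<Rightarrow> 'l tensor \<Rightarrow> 'l tensor" where
  "tensor_mult A B =
     (\<Sum>(\<rho>\<^sub>1, \<rho>\<^sub>2)\<in>#A. image_mset (\<lambda>(\<sigma>\<^sub>1, \<sigma>\<^sub>2). (\<rho>\<^sub>1 + \<sigma>\<^sub>1, \<rho>\<^sub>2 + \<sigma>\<^sub>2)) B)"

definition tensor_prod :: "'l tensor multiset \<Rightarrow> 'l tensor" where
  "tensor_prod = fold_mset tensor_mult {#({#}, {#})#}"

primrec tree_coproduct :: "'l tree \<Rightarrow> 'l tensor" where
  "tree_coproduct (Node j \<rho>) =
     add_mset ({#Node j \<rho>#}, {#})
       (image_mset (\<lambda>(\<rho>\<^sub>1, \<rho>\<^sub>2). (\<rho>\<^sub>1, {#Node j \<rho>\<^sub>2#}))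
         (tensor_prod (image_mset tree_coproduct \<rho>)))"

definition coproduct :: "'l tree multiset \<Rightarrow> 'l tensor" where
  "coproduct \<rho> = tensor_prod (image_mset tree_coproduct \<rho>)"

lemma tensor_mult_empty_left [simp]: "tensor_mult {#} B = {#}"
  by (simp add: tensor_mult_def)

lemma tensor_mult_add_mset:
  "tensor_mult (add_mset (\<rho>\<^sub>1, \<rho>\<^sub>2) A) B =
     image_mset (\<lambda>(\<sigma>\<^sub>1, \<sigma>\<^sub>2). (\<rho>\<^sub>1 + \<sigma>\<^sub>1, \<rho>\<^sub>2 + \<sigma>\<^sub>2)) B + tensor_mult A B"
  by (simp add: tensor_mult_def)

lemma tensor_mult_plus_left:
  "tensor_mult (A + A') B = tensor_mult A B + tensor_mult A' B"
  by (induction A) (auto simp: tensor_mult_add_mset)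

lemma tensor_mult_image:
  "tensor_mult (image_mset (\<lambda>(\<sigma>\<^sub>1, \<sigma>\<^sub>2). (\<rho>\<^sub>1 + \<sigma>\<^sub>1, \<rho>\<^sub>2 + \<sigma>\<^sub>2)) B) C =
     image_mset (\<lambda>(\<sigma>\<^sub>1, \<sigma>\<^sub>2). (\<rho>\<^sub>1 + \<sigma>\<^sub>1, \<rho>\<^sub>2 + \<sigma>\<^sub>2)) (tensor_mult B C)"
  by (induction B)
    (auto simp: tensor_mult_add_mset image_mset.compositionality comp_def case_prod_unfold add.assoc)

lemma tensor_mult_assoc:
  "tensor_mult (tensor_mult A B) C = tensor_mult A (tensor_mult B C)"
  by (induction A) (auto simp: tensor_mult_add_mset tensor_mult_plus_left tensor_mult_image)

lemma tensor_mult_empty_right [simp]: "tensor_mult A {#} = {#}"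
  by (induction A) (auto simp: tensor_mult_add_mset)

lemma tensor_mult_add_mset_right:
  "tensor_mult A (add_mset (\<rho>\<^sub>1, \<rho>\<^sub>2) B) =
     image_mset (\<lambda>(\<sigma>\<^sub>1, \<sigma>\<^sub>2). (\<rho>\<^sub>1 + \<sigma>\<^sub>1, \<rho>\<^sub>2 + \<sigma>\<^sub>2)) A + tensor_mult A B"
  by (induction A) (auto simp: tensor_mult_add_mset add.commute)

lemma tensor_mult_commute: "tensor_mult A B = tensor_mult B A"
  by (induction A) (auto simp: tensor_mult_add_mset tensor_mult_add_mset_right)

lemma tensor_mult_one [simp]: "tensor_mult {#({#}, {#})#} A = A"
  by (simp add: tensor_mult_add_mset)

lemma tensor_mult_one_right [simp]: "tensor_mult A {#({#}, {#})#} = A"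
  by (metis tensor_mult_commute tensor_mult_one)

lemma tensor_mult_left_commute:
  "tensor_mult A (tensor_mult B C) = tensor_mult B (tensor_mult A C)"
  using tensor_mult_assoc[of A B C] tensor_mult_assoc[of B A C] tensor_mult_commute[of A B]
  by simp

interpretation tensor_mult: comp_fun_commute tensor_mult
  by standard (rule ext, simp only: comp_apply, rule tensor_mult_left_commute)

lemma tensor_prod_empty [simp]: "tensor_prod {#} = {#({#}, {#})#}"
  by (simp add: tensor_prod_def)

lemma tensor_prod_add_mset [simp]:
  "tensor_prod (add_mset A M) = tensor_mult A (tensor_prod M)"
  by (simp add: tensor_prod_def)

lemma coproduct_empty: "coproduct {#} = {#({#}, {#})#}"
  by (simp add: coproduct_def)

lemma coproduct_plus: "coproduct (\<rho> + \<sigma>) = tensor_mult (coproduct \<rho>) (coproduct \<sigma>)"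
  by (induction \<rho>) (auto simp: coproduct_def tensor_mult_assoc)

lemma coproduct_graft:
  "coproduct {#Node j \<rho>#} =
     add_mset ({#Node j \<rho>#}, {#})
       (image_mset (\<lambda>(\<rho>\<^sub>1, \<rho>\<^sub>2). (\<rho>\<^sub>1, {#Node j \<rho>\<^sub>2#})) (coproduct \<rho>))"
  by (simp add: coproduct_def)


section \<open>The truncated character group\<close>

text \<open>Characters are extended by \<open>0\<close> to forests with labels outside \<open>{1..d}\<close>, so that equality
  of characters is equality on \<open>forests d\<close>, and the product topology on \<open>forest \<Rightarrow> real\<close>
  induces the usual finite-dimensional topology on the group.\<close>

definition character_group :: "nat \<Rightarrow> nat \<Rightarrow> (forest \<Rightarrow> real) monoid" where
  "character_group d n =
     \<lparr>carrier = {a. a {#} = 1 \<and>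
         (\<forall>\<rho>\<in>forests d. \<forall>\<sigma>\<in>forests d. forest_degree \<rho> + forest_degree \<sigma> \<le> n \<longrightarrow> a (\<rho> + \<sigma>) = a \<rho> * a \<sigma>) \<and>
         (\<forall>\<rho>\<in>forests d. forest_degree \<rho> > n \<longrightarrow> a \<rho> = 0) \<and>
         (\<forall>\<rho>. \<rho> \<notin> forests d \<longrightarrow> a \<rho> = 0)},
      monoid.mult = (\<lambda>a b \<rho>. if \<rho> \<in> forests d \<and> forest_degree \<rho> \<le> n
         then \<Sum>(\<rho>\<^sub>1, \<rho>\<^sub>2)\<in>#coproduct \<rho>. a \<rho>\<^sub>1 * b \<rho>\<^sub>2 else 0),
      one = (\<lambda>\<rho>. if \<rho> = {#} then 1 else 0)\<rparr>"

definition character_norm :: "nat \<Rightarrow> nat \<Rightarrow> (forest \<Rightarrow> real) \<Rightarrow> real" where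
  "character_norm d n a = (MAX \<rho>\<in>forests_upto d n. \<bar>a \<rho>\<bar> powr (1 / forest_degree \<rho>))"


section \<open>Branched rough paths\<close>

abbreviation trunc :: "real \<Rightarrow> nat" where
  "trunc p \<equiv> nat \<lfloor>p\<rfloor>"

definition increment ::
  "nat \<Rightarrow> nat \<Rightarrow> (real \<Rightarrow> forest \<Rightarrow> real) \<Rightarrow> real \<Rightarrow> real \<Rightarrow> forest \<Rightarrow> real" where
  "increment d n X s t =
     inv\<^bsub>character_group d n\<^esub> (X s) \<otimes>\<^bsub>character_group d n\<^esub> X t"

definition partitions :: "real \<Rightarrow> real \<Rightarrow> real list set" where
  "partitions s t = {D. D \<noteq> [] \<and> hd D = s \<and> last D = t \<and> sorted_wrt (<) D}"

definition p_variation ::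
  "nat \<Rightarrow> real \<Rightarrow> (real \<Rightarrow> forest \<Rightarrow> real) \<Rightarrow> real \<Rightarrow> real \<Rightarrow> ennreal" where
  "p_variation d p X s t =
     (SUP D\<in>partitions s t. ennreal
       ((\<Sum>k<length D - 1.
           character_norm d (trunc p) (increment d (trunc p) X (D ! k) (D ! Suc k)) powr p)
         powr (1 / p)))"

text \<open>Real-valued; used only for paths of finite \<open>p\<close>-variation.\<close>

definition control ::
  "nat \<Rightarrow> real \<Rightarrow> (real \<Rightarrow> forest \<Rightarrow> real) \<Rightarrow> real \<Rightarrow> real \<Rightarrow> real" where
  "control d p X s t = enn2real (p_variation d p X s t) powr p"

definition branched_rough_path ::
  "nat \<Rightarrow> real \<Rightarrow> real \<Rightarrow> (real \<Rightarrow> forest \<Rightarrow> real) \<Rightarrow> bool" where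
  "branched_rough_path d p T X \<longleftrightarrow>
     X ` {0..T} \<subseteq> carrier (character_group d (trunc p)) \<and>
     continuous_on {0..T} X \<and>
     p_variation d p X 0 T < \<infinity>"


section \<open>Slowly-varying one-forms\<close>

text \<open>The fibre over \<open>a\<close> is the same function space for every \<open>a\<close>. Its elements are
  functions on the group; values off the carrier are irrelevant.\<close>

definition represents ::
  "nat \<Rightarrow> nat \<Rightarrow> (forest \<Rightarrow> real) \<Rightarrow> ((forest \<Rightarrow> real) \<Rightarrow> real) \<Rightarrow> bool" where
  "represents d n w \<phi> \<longleftrightarrow>
     (\<forall>\<rho>. \<rho> \<notin> forests_upto d n \<longrightarrow> w \<rho> = 0) \<and>
     (\<forall>c\<in>carrier (character_group d n). \<phi> c = (\<Sum>\<rho>\<in>forests_upto d n. w \<rho> * c \<rho>))"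

definition one_forms :: "nat \<Rightarrow> nat \<Rightarrow> ((forest \<Rightarrow> real) \<Rightarrow> real) set" where
  "one_forms d n = {\<phi>. \<exists>w. represents d n w \<phi>}"

text \<open>Well defined on \<open>one_forms d n\<close>: on the group, distinct forests of degree at most \<open>n\<close> are
  distinct monomials in the freely varying values on trees, hence linearly independent.\<close>

definition coefficient :: "nat \<Rightarrow> nat \<Rightarrow> ((forest \<Rightarrow> real) \<Rightarrow> real) \<Rightarrow> forest \<Rightarrow> real" where
  "coefficient d n \<phi> = (THE w. represents d n w \<phi>)"

definition one_form_norm :: "nat \<Rightarrow> nat \<Rightarrow> ((forest \<Rightarrow> real) \<Rightarrow> real) \<Rightarrow> real" where
  "one_form_norm d n \<phi> = (MAX \<rho>\<in>forests_upto d n. \<bar>coefficient d n \<phi> \<rho>\<bar>)"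

definition translate ::
  "nat \<Rightarrow> nat \<Rightarrow> ((forest \<Rightarrow> real) \<Rightarrow> real) \<Rightarrow> (forest \<Rightarrow> real) \<Rightarrow> (forest \<Rightarrow> real) \<Rightarrow> real" where
  "translate d n \<phi> b c = \<phi> (b \<otimes>\<^bsub>character_group d n\<^esub> c) - \<phi> b"

definition one_form_mult ::
  "nat \<Rightarrow> nat \<Rightarrow> ((forest \<Rightarrow> real) \<Rightarrow> real) \<Rightarrow> ((forest \<Rightarrow> real) \<Rightarrow> real) \<Rightarrow>
    (forest \<Rightarrow> real) \<Rightarrow> real" where
  "one_form_mult d n \<phi>\<^sub>1 \<phi>\<^sub>2 a =
     (\<Sum>(\<rho>\<^sub>1, \<rho>\<^sub>2) | \<rho>\<^sub>1 \<in> forests_upto d n \<and> \<rho>\<^sub>2 \<in> forests_upto d n \<and> forest_degree \<rho>\<^sub>1 + forest_degree \<rho>\<^sub>2 \<le> n.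
        coefficient d n \<phi>\<^sub>1 \<rho>\<^sub>1 * coefficient d n \<phi>\<^sub>2 \<rho>\<^sub>2 * a (\<rho>\<^sub>1 + \<rho>\<^sub>2))"

text \<open>A one-form along \<open>X\<close> is given as \<open>\<beta> t\<close>, standing for \<open>\<beta>(X\<^sub>t)\<close>: it may depend on the time
  \<open>t\<close> and not only on the point \<open>X t\<close>. Quotients are taken in \<open>ennreal\<close>, where \<open>0 / 0 = 0\<close> and
  \<open>x / 0 = \<infinity>\<close> for \<open>x > 0\<close>; so finiteness forces the numerator to vanish where the control
  does.\<close>

definition slow_norm ::
  "nat \<Rightarrow> real \<Rightarrow> real \<Rightarrow> (real \<Rightarrow> forest \<Rightarrow> real) \<Rightarrow> real \<Rightarrow>
    (real \<Rightarrow> (forest \<Rightarrow> real) \<Rightarrow> real) \<Rightarrow> ennreal" where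
  "slow_norm d p T X \<theta> \<beta> =
     (SUP t\<in>{0..T}. ennreal (one_form_norm d (trunc p) (\<beta> t))) +
     (MAX \<rho>\<in>forests_upto d (trunc p).
        SUP (s, t)\<in>{(s, t). 0 \<le> s \<and> s < t \<and> t \<le> T}.
          ennreal \<bar>coefficient d (trunc p)
             (\<lambda>c. \<beta> t c - translate d (trunc p) (\<beta> s) (increment d (trunc p) X s t) c) \<rho>\<bar>
          / ennreal (control d p X s t powr (\<theta> - forest_degree \<rho> / p)))"

definition slowly_varying ::
  "nat \<Rightarrow> real \<Rightarrow> real \<Rightarrow> (real \<Rightarrow> forest \<Rightarrow> real) \<Rightarrow>
    (real \<Rightarrow> (forest \<Rightarrow> real) \<Rightarrow> real) \<Rightarrow> bool" where
  "slowly_varying d p T X \<beta> \<longleftrightarrow>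
     (\<forall>t\<in>{0..T}. \<beta> t \<in> one_forms d (trunc p)) \<and>
     (\<exists>\<theta>>1. slow_norm d p T X \<theta> \<beta> < \<infinity>)"

definition mesh_filter :: "real \<Rightarrow> real \<Rightarrow> real list filter" where
  "mesh_filter s t =
     (INF \<delta>\<in>{0<..}. principal
        {D \<in> partitions s t. \<forall>k<length D - 1. D ! Suc k - D ! k < \<delta>})"

definition rough_integral ::
  "nat \<Rightarrow> real \<Rightarrow> (real \<Rightarrow> forest \<Rightarrow> real) \<Rightarrow> (real \<Rightarrow> (forest \<Rightarrow> real) \<Rightarrow> real) \<Rightarrow> real \<Rightarrow> real"
  where
  "rough_integral d p X \<beta> t =
     Lim (mesh_filter 0 t)
       (\<lambda>D. \<Sum>k<length D - 1. \<beta> (D ! k) (increment d (trunc p) X (D ! k) (D ! Suc k)))"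

end

theory Submission
  imports
    Defs
    "HOL-Computational_Algebra.Primes"
    "HOL-Computational_Algebra.Polynomial"
begin

text \<open>In coordinates, parallel translation by \<open>x = X\<^sub>s\<^sub>,\<^sub>t\<close> contracts the left factors of the coproduct
  with \<open>x\<close>. Multiplicativity of \<open>x\<close> gives, for \<open>\<phi>\<^sub>1 = \<beta>\<^sub>1(X\<^sub>s)\<close> and \<open>\<phi>\<^sub>2 = \<beta>\<^sub>2(X\<^sub>s)\<close>, the Leibniz-type identity
  \<open>(\<phi>\<^sub>1 \<phi>\<^sub>2)\<^sub>x = \<phi>\<^sub>1(x) (\<phi>\<^sub>2)\<^sub>x + \<phi>\<^sub>2(x) (\<phi>\<^sub>1)\<^sub>x + (\<phi>\<^sub>1)\<^sub>x (\<phi>\<^sub>2)\<^sub>x - R\<close>, where \<open>R\<close> collects the pairs of forests of total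
  degree larger than \<open>[p]\<close> and is therefore of order \<open>([p] + 1) / p - \<bar>\<sigma>\<bar> / p\<close> in \<open>\<omega>(s, t)\<close>. The terms
  \<open>\<phi>\<^sub>i(x)\<close> are the first-order approximations of the increments of the integrals, with an error of order
  \<open>\<theta>\<close> by the sewing estimate; all remaining differences are controlled by the slow variation of the \<open>\<beta>\<^sub>i\<close>.\<close>

section \<open>Forests and the coproduct\<close>

text \<open>Much of the work goes into making the ingredients meaningful. \<open>coefficient\<close>
  and \<open>Lim\<close> are definite descriptions, so linear independence of forests as functions
  on the group and convergence of the Riemann sums must be available before any inequality can be
  read off. Increments contain inverses, so the truncated characters must be shown to form a group.
  Sewing needs more than superadditivity of \<omega>: it must become small uniformly near the
  diagonal. This is where continuity of X enters, since finite p-variation alone would allow jumps.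
  The bound \<theta> \<le> ([p] + 1) / p is what makes R admissible, because the first discarded
  total degree is [p] + 1. The other errors have orders that differ from term to term but never fall
  below \<theta> - |\<sigma>| / p; their surplus exponents are traded for powers of 1 + \<omega>(0,
  T), so the path enters the final constant only through \<omega>(0, T).\<close>

lemma forest_degree_empty [simp]: "forest_degree {#} = 0"
  by (simp add: forest_degree_def)

lemma forest_degree_add_mset [simp]:
  "forest_degree (add_mset \<tau> \<sigma>) = tree_degree \<tau> + forest_degree \<sigma>"
  by (simp add: forest_degree_def)

lemma forest_degree_plus [simp]: "forest_degree (\<rho> + \<sigma>) = forest_degree \<rho> + forest_degree \<sigma>"
  by (simp add: forest_degree_def)

lemma tree_degree_Node [simp]: "tree_degree (Node j \<rho>) = Suc (forest_degree \<rho>)"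
  by (simp add: forest_degree_def)

declare tree_degree.simps [simp del]

lemma forest_degree_eq_0_iff [simp]: "forest_degree \<rho> = 0 \<longleftrightarrow> \<rho> = {#}"
proof (cases \<rho>)
  case (add \<tau> \<sigma>)
  then show ?thesis by (cases \<tau>) simp
qed simp

text \<open>Peeling one tree off a forest leaves two forests of smaller degree, the children of that
  tree and the remaining trees. They correspond to the two rules that compute the coproduct,
  grafting and multiplication.\<close>

lemma forest_induct [case_names empty graft]:
  fixes \<rho> :: "'l tree multiset"
  assumes "P {#}" and "\<And>j \<rho> \<sigma>. P \<rho> \<Longrightarrow> P \<sigma> \<Longrightarrow> P (add_mset (Node j \<rho>) \<sigma>)"
  shows "P \<rho>"
proof (induction \<rho> rule: measure_induct_rule[of forest_degree])
  case (less \<rho>)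
  show ?case
  proof (cases \<rho>)
    case empty
    then show ?thesis using assms(1) by simp
  next
    case (add \<tau> \<sigma>)
    then show ?thesis using less assms(2) by (cases \<tau>) simp
  qed
qed

lemma forests_empty [simp]: "{#} \<in> forests d"
  by (simp add: forests_def)

lemma forests_plus [simp]: "\<rho> + \<sigma> \<in> forests d \<longleftrightarrow> \<rho> \<in> forests d \<and> \<sigma> \<in> forests d"
  by (auto simp: forests_def)

lemma forests_add_Node [simp]:
  "add_mset (Node j \<rho>) \<sigma> \<in> forests d \<longleftrightarrow> j \<in> {1..d} \<and> \<rho> \<in> forests d \<and> \<sigma> \<in> forests d"
  by (auto simp: forests_def)

text \<open>A nonempty forest is determined by the root label and the children of one of its trees
  together with the other trees, and both of these forests have smaller degree.\<close>

lemma finite_forests_degree_le: "finite {\<rho> \<in> forests d. forest_degree \<rho> \<le> n}"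
proof (induction n)
  case 0
  have "{\<rho> \<in> forests d. forest_degree \<rho> \<le> 0} \<subseteq> {{#}}" by auto
  then show ?case using finite_subset by blast
next
  case (Suc n)
  let ?S = "{\<rho> \<in> forests d. forest_degree \<rho> \<le> n}"
  have "\<rho> \<in> insert {#} ((\<lambda>(j, a, b). add_mset (Node j a) b) ` ({1..d} \<times> ?S \<times> ?S))"
    if "\<rho> \<in> forests d" "forest_degree \<rho> \<le> Suc n" for \<rho>
  proof (cases \<rho>)
    case (add \<tau> b)
    obtain j a where \<tau>: "\<tau> = Node j a" by (cases \<tau>)
    have "(j, a, b) \<in> {1..d} \<times> ?S \<times> ?S" using that add \<tau> by simp
    then show ?thesis using add \<tau> by (intro insertI2) (rule image_eqI[of _ _ "(j, a, b)"], auto)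
  qed simp
  then have "{\<rho> \<in> forests d. forest_degree \<rho> \<le> Suc n}
    \<subseteq> insert {#} ((\<lambda>(j, a, b). add_mset (Node j a) b) ` ({1..d} \<times> ?S \<times> ?S))" by blast
  then show ?case using Suc by (meson finite_SigmaI finite_atLeastAtMost finite_imageI finite_insert finite_subset)
qed

lemma forests_degree_le_eq:
  "{\<rho> \<in> forests d. forest_degree \<rho> \<le> n} = insert {#} (forests_upto d n)"
  by (auto simp: forests_upto_def Suc_le_eq simp flip: neq0_conv)

lemma in_forests_upto_iff:
  "\<rho> \<in> forests_upto d n \<longleftrightarrow> \<rho> \<in> forests d \<and> 1 \<le> forest_degree \<rho> \<and> forest_degree \<rho> \<le> n"
  by (simp add: forests_upto_def)

lemma finite_forests_upto [simp]: "finite (forests_upto d n)"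
  using finite_forests_degree_le[of d n] by (simp add: forests_degree_le_eq)

lemma empty_not_in_forests_upto [simp]: "{#} \<notin> forests_upto d n"
  by (simp add: forests_upto_def)

lemma forests_upto_nonempty:
  assumes "d \<ge> 1" "n \<ge> 1"
  shows "forests_upto d n \<noteq> {}"
proof -
  have "{#Node 1 {#}#} \<in> forests_upto d n" using assms by (simp add: forests_upto_def)
  then show ?thesis by blast
qed

section \<open>Coproduct: grading, counits and coassociativity\<close>

lemma sum_tensor_mult:
  "(\<Sum>(x, y)\<in>#tensor_mult A B. f x y)
     = (\<Sum>(x\<^sub>1, y\<^sub>1)\<in>#A. \<Sum>(x\<^sub>2, y\<^sub>2)\<in>#B. f (x\<^sub>1 + x\<^sub>2) (y\<^sub>1 + y\<^sub>2))"
  by (induction A)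
    (auto simp: tensor_mult_add_mset image_mset.compositionality comp_def case_prod_unfold)

lemma in_tensor_mult_iff:
  "(x, y) \<in># tensor_mult A B \<longleftrightarrow>
     (\<exists>x\<^sub>1 y\<^sub>1 x\<^sub>2 y\<^sub>2. (x\<^sub>1, y\<^sub>1) \<in># A \<and> (x\<^sub>2, y\<^sub>2) \<in># B \<and> x = x\<^sub>1 + x\<^sub>2 \<and> y = y\<^sub>1 + y\<^sub>2)"
  by (force simp: tensor_mult_def)

lemma coproduct_add_mset:
  "coproduct (add_mset \<tau> \<sigma>) = tensor_mult (coproduct {#\<tau>#}) (coproduct \<sigma>)"
  using coproduct_plus[of "{#\<tau>#}" \<sigma>] by simp

lemma coproduct_degree:
  "(x, y) \<in># coproduct \<rho> \<Longrightarrow> forest_degree x + forest_degree y = forest_degree \<rho>"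
proof (induction \<rho> arbitrary: x y rule: forest_induct)
  case empty
  then show ?case by (simp add: coproduct_empty)
next
  case (graft j \<rho> \<sigma>)
  then show ?case
    by (fastforce simp: coproduct_add_mset[of _ \<sigma>] in_tensor_mult_iff coproduct_graft)
qed

lemma coproduct_forests:
  "(x, y) \<in># coproduct \<rho> \<Longrightarrow> \<rho> \<in> forests d \<Longrightarrow> x \<in> forests d \<and> y \<in> forests d"
proof (induction \<rho> arbitrary: x y rule: forest_induct)
  case empty
  then show ?case by (simp add: coproduct_empty)
next
  case (graft j \<rho> \<sigma>)
  then show ?case
    by (fastforce simp: coproduct_add_mset[of _ \<sigma>] in_tensor_mult_iff coproduct_graft)
qed

text \<open>Isolating the single term with empty left factor lets an equation
  \<open>a * b = 1\<close> be solved for the value of \<open>b\<close> at \<rho> in terms of values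
  of \<open>b\<close> at forests of lower degree.\<close>

lemma coproduct_counit_left:
  "\<exists>M. coproduct \<rho> = add_mset ({#}, \<rho>) M \<and> (\<forall>(x, y)\<in>#M. x \<noteq> {#})"
proof (induction \<rho> rule: forest_induct)
  case empty
  then show ?case by (simp add: coproduct_empty)
next
  case (graft j \<rho> \<sigma>)
  then obtain M N where
    M: "coproduct \<rho> = add_mset ({#}, \<rho>) M" "\<forall>(x, y)\<in>#M. x \<noteq> {#}" and
    N: "coproduct \<sigma> = add_mset ({#}, \<sigma>) N" "\<forall>(x, y)\<in>#N. x \<noteq> {#}" by blast
  let ?M' = "add_mset ({#Node j \<rho>#}, {#}) (image_mset (\<lambda>(x, y). (x, {#Node j y#})) M)"
  have M': "coproduct {#Node j \<rho>#} = add_mset ({#}, {#Node j \<rho>#}) ?M'"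
    using M by (simp add: coproduct_graft)
  let ?N' = "image_mset (\<lambda>(x, y). (x, add_mset (Node j \<rho>) y)) N
    + tensor_mult ?M' (coproduct \<sigma>)"
  have "coproduct (add_mset (Node j \<rho>) \<sigma>) = add_mset ({#}, add_mset (Node j \<rho>) \<sigma>) ?N'"
    unfolding coproduct_add_mset[of _ \<sigma>] M' tensor_mult_add_mset[of "{#}"] by (simp add: N)
  moreover have "\<forall>(x, y)\<in>#?N'. x \<noteq> {#}"
    using M(2) N(2) by (fastforce simp: in_tensor_mult_iff)
  ultimately show ?case by blast
qed

text \<open>Grafting makes every right factor nonempty, so on a tree only the cut that removes the
  whole tree has right factor \<open>{#}\<close>.\<close>

lemma coproduct_counit_right:
  "\<exists>M. coproduct \<rho> = add_mset (\<rho>, {#}) M \<and> (\<forall>(x, y)\<in>#M. y \<noteq> {#})"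
proof (induction \<rho> rule: forest_induct)
  case empty
  then show ?case by (simp add: coproduct_empty)
next
  case (graft j \<rho> \<sigma>)
  then obtain N where
    N: "coproduct \<sigma> = add_mset (\<sigma>, {#}) N" "\<forall>(x, y)\<in>#N. y \<noteq> {#}" by blast
  let ?M' = "image_mset (\<lambda>(x, y). (x, {#Node j y#})) (coproduct \<rho>)"
  have M': "coproduct {#Node j \<rho>#} = add_mset ({#Node j \<rho>#}, {#}) ?M'"
    by (simp add: coproduct_graft)
  let ?N' = "image_mset (\<lambda>(x, y). (add_mset (Node j \<rho>) x, y)) N
    + tensor_mult ?M' (coproduct \<sigma>)"
  have "coproduct (add_mset (Node j \<rho>) \<sigma>) = add_mset (add_mset (Node j \<rho>) \<sigma>, {#}) ?N'"
    unfolding coproduct_add_mset[of _ \<sigma>] M' tensor_mult_add_mset[of "{#Node j \<rho>#}"] by (simp add: N)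
  moreover have "\<forall>(x, y)\<in>#?N'. y \<noteq> {#}"
    using N(2) by (fastforce simp: in_tensor_mult_iff)
  ultimately show ?case by blast
qed

lemma coproduct_sum_counit_left:
  fixes f :: "'l tree multiset \<Rightarrow> 'a::comm_monoid_add"
  shows "(\<Sum>(x, y)\<in>#coproduct \<rho>. if x = {#} then f y else 0) = f \<rho>"
proof -
  obtain M where M: "coproduct \<rho> = add_mset ({#}, \<rho>) M" "\<forall>(x, y)\<in>#M. x \<noteq> {#}"
    using coproduct_counit_left by blast
  have "(\<Sum>(x, y)\<in>#M. if x = {#} then f y else 0) = 0"
    using M(2) by (intro sum_mset.neutral) auto
  then show ?thesis by (simp add: M(1))
qed

lemma coproduct_sum_counit_right:
  fixes f :: "'l tree multiset \<Rightarrow> 'a::comm_monoid_add"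
  shows "(\<Sum>(x, y)\<in>#coproduct \<rho>. if y = {#} then f x else 0) = f \<rho>"
proof -
  obtain M where M: "coproduct \<rho> = add_mset (\<rho>, {#}) M" "\<forall>(x, y)\<in>#M. y \<noteq> {#}"
    using coproduct_counit_right by blast
  have "(\<Sum>(x, y)\<in>#M. if y = {#} then f x else 0) = 0"
    using M(2) by (intro sum_mset.neutral) auto
  then show ?thesis by (simp add: M(1))
qed

text \<open>Testing against an arbitrary \<open>f\<close> with values in a commutative monoid
  replaces the triple tensor product. \<open>f\<close> must vary in the induction, because the
  hypotheses are applied to shifted and grafted versions of it.\<close>

lemma coproduct_coassoc:
  fixes f :: "'l tree multiset \<Rightarrow> 'l tree multiset \<Rightarrow> 'l tree multiset \<Rightarrow> 'a::comm_monoid_add"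
  shows "(\<Sum>(x, y)\<in>#coproduct \<rho>. \<Sum>(u, v)\<in>#coproduct x. f u v y)
     = (\<Sum>(x, y)\<in>#coproduct \<rho>. \<Sum>(u, v)\<in>#coproduct y. f x u v)"
proof (induction \<rho> arbitrary: f rule: forest_induct)
  case empty
  then show ?case by (simp add: coproduct_empty)
next
  case (graft j \<rho> \<sigma>)
  \<comment> \<open>Terms whose third factor is empty agree directly. In all others the third factor
    carries the root \<open>j\<close>, and the hypothesis for the children applies with that factor
    grafted.\<close>
  have tree: "(\<Sum>(x, y)\<in>#coproduct {#Node j \<rho>#}. \<Sum>(u, v)\<in>#coproduct x. g u v y)
     = (\<Sum>(x, y)\<in>#coproduct {#Node j \<rho>#}. \<Sum>(u, v)\<in>#coproduct y. g x u v)"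
    for g :: "'l tree multiset \<Rightarrow> 'l tree multiset \<Rightarrow> 'l tree multiset \<Rightarrow> 'a"
    using graft(1)[of "\<lambda>x y z. g x y {#Node j z#}"]
    by (simp add: coproduct_graft coproduct_empty image_mset.compositionality comp_def
        case_prod_unfold sum_mset.distrib add.assoc)
  let ?T = "coproduct {#Node j \<rho>#}" and ?S = "coproduct \<sigma>"
  have "(\<Sum>(x, y)\<in>#coproduct (add_mset (Node j \<rho>) \<sigma>). \<Sum>(u, v)\<in>#coproduct x. f u v y)
    = (\<Sum>(x, y)\<in>#?T. \<Sum>(x', y')\<in>#?S. \<Sum>(u, v)\<in>#coproduct x. \<Sum>(u', v')\<in>#coproduct x'.
         f (u + u') (v + v') (y + y'))"
    by (simp add: coproduct_add_mset[of _ \<sigma>] sum_tensor_mult coproduct_plus)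
  also have "\<dots> = (\<Sum>(x, y)\<in>#?T. \<Sum>(u, v)\<in>#coproduct x. \<Sum>(x', y')\<in>#?S. \<Sum>(u', v')\<in>#coproduct x'.
         f (u + u') (v + v') (y + y'))"
    by (simp add: case_prod_unfold) (subst sum_mset.swap, simp)
  also have "\<dots> = (\<Sum>(x, y)\<in>#?T. \<Sum>(u, v)\<in>#coproduct x. \<Sum>(x', y')\<in>#?S. \<Sum>(u', v')\<in>#coproduct y'.
         f (u + x') (v + u') (y + v'))"
    by (simp add: graft(2))
  also have "\<dots> = (\<Sum>(x, y)\<in>#?T. \<Sum>(u, v)\<in>#coproduct y. \<Sum>(x', y')\<in>#?S. \<Sum>(u', v')\<in>#coproduct y'.
         f (x + x') (u + u') (v + v'))"
    by (rule tree)
  also have "\<dots> = (\<Sum>(x, y)\<in>#?T. \<Sum>(x', y')\<in>#?S. \<Sum>(u, v)\<in>#coproduct y. \<Sum>(u', v')\<in>#coproduct y'.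
         f (x + x') (u + u') (v + v'))"
    by (simp add: case_prod_unfold) (subst sum_mset.swap, simp)
  also have "\<dots> = (\<Sum>(x, y)\<in>#coproduct (add_mset (Node j \<rho>) \<sigma>). \<Sum>(u, v)\<in>#coproduct y. f x u v)"
    by (simp add: coproduct_add_mset[of _ \<sigma>] sum_tensor_mult coproduct_plus)
  finally show ?case .
qed


section \<open>The truncated character group\<close>

lemma in_character_group_iff:
  "a \<in> carrier (character_group d n) \<longleftrightarrow> a {#} = 1 \<and>
     (\<forall>\<rho>\<in>forests d. \<forall>\<sigma>\<in>forests d. forest_degree \<rho> + forest_degree \<sigma> \<le> n \<longrightarrow> a (\<rho> + \<sigma>) = a \<rho> * a \<sigma>) \<and>
     (\<forall>\<rho>\<in>forests d. forest_degree \<rho> > n \<longrightarrow> a \<rho> = 0) \<and>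
     (\<forall>\<rho>. \<rho> \<notin> forests d \<longrightarrow> a \<rho> = 0)"
  by (simp add: character_group_def)

lemma character_mult_eq:
  "(a \<otimes>\<^bsub>character_group d n\<^esub> b) \<rho> = (if \<rho> \<in> forests d \<and> forest_degree \<rho> \<le> n
     then \<Sum>(x, y)\<in>#coproduct \<rho>. a x * b y else 0)"
  by (simp add: character_group_def)

lemma character_one_eq: "\<one>\<^bsub>character_group d n\<^esub> \<rho> = (if \<rho> = {#} then 1 else 0)"
  by (simp add: character_group_def)

lemma character_empty: "a \<in> carrier (character_group d n) \<Longrightarrow> a {#} = 1"
  by (simp add: in_character_group_iff)

lemma character_plus:
  "a \<in> carrier (character_group d n) \<Longrightarrow> \<rho> \<in> forests d \<Longrightarrow> \<sigma> \<in> forests d \<Longrightarrow>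
   forest_degree \<rho> + forest_degree \<sigma> \<le> n \<Longrightarrow> a (\<rho> + \<sigma>) = a \<rho> * a \<sigma>"
  by (simp add: in_character_group_iff)

lemma character_eq_0:
  "a \<in> carrier (character_group d n) \<Longrightarrow> \<not> (\<rho> \<in> forests d \<and> forest_degree \<rho> \<le> n) \<Longrightarrow> a \<rho> = 0"
  by (cases "\<rho> \<in> forests d") (auto simp: in_character_group_iff not_le)

lemma sum_mset_times_sum_mset:
  fixes f :: "'i \<Rightarrow> 'a::semiring_0"
  shows "(\<Sum>i\<in>#A. f i) * (\<Sum>j\<in>#B. g j) = (\<Sum>i\<in>#A. \<Sum>j\<in>#B. f i * g j)"
  by (induction A) (simp_all add: distrib_right flip: sum_mset_distrib_left)

text \<open>The coproduct is multiplicative and preserves degree. Each side of a cut of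
  \<open>\<rho> + \<sigma>\<close> is thus a product of two forests of total degree at most
  \<open>n\<close>, where \<open>a\<close> and \<open>b\<close> are multiplicative.\<close>

lemma character_mult_closed:
  assumes a: "a \<in> carrier (character_group d n)" and b: "b \<in> carrier (character_group d n)"
  shows "a \<otimes>\<^bsub>character_group d n\<^esub> b \<in> carrier (character_group d n)"
  unfolding in_character_group_iff
proof (intro conjI ballI impI allI)
  fix \<rho> \<sigma> assume *: "\<rho> \<in> forests d" "\<sigma> \<in> forests d" "forest_degree \<rho> + forest_degree \<sigma> \<le> n"
  have "(\<Sum>(x, y)\<in>#coproduct (\<rho> + \<sigma>). a x * b y)
    = (\<Sum>(x, y)\<in>#coproduct \<rho>. \<Sum>(u, v)\<in>#coproduct \<sigma>. a (x + u) * b (y + v))"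
    by (simp add: coproduct_plus sum_tensor_mult)
  also have "\<dots> = (\<Sum>(x, y)\<in>#coproduct \<rho>. \<Sum>(u, v)\<in>#coproduct \<sigma>. (a x * b y) * (a u * b v))"
  proof (intro arg_cong[of _ _ sum_mset] image_mset_cong, clarify)
    fix x y assume xy: "(x, y) \<in># coproduct \<rho>"
    show "(\<Sum>(u, v)\<in>#coproduct \<sigma>. a (x + u) * b (y + v))
      = (\<Sum>(u, v)\<in>#coproduct \<sigma>. (a x * b y) * (a u * b v))"
    proof (intro arg_cong[of _ _ sum_mset] image_mset_cong, clarify)
      fix u v assume uv: "(u, v) \<in># coproduct \<sigma>"
      have "a (x + u) = a x * a u"
        using coproduct_forests[OF xy *(1)] coproduct_forests[OF uv *(2)]
          coproduct_degree[OF xy] coproduct_degree[OF uv] *(3)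
        by (intro character_plus[OF a]) auto
      moreover have "b (y + v) = b y * b v"
        using coproduct_forests[OF xy *(1)] coproduct_forests[OF uv *(2)]
          coproduct_degree[OF xy] coproduct_degree[OF uv] *(3)
        by (intro character_plus[OF b]) auto
      ultimately show "a (x + u) * b (y + v) = (a x * b y) * (a u * b v)" by simp
    qed
  qed
  also have "\<dots> = (\<Sum>(x, y)\<in>#coproduct \<rho>. a x * b y) * (\<Sum>(u, v)\<in>#coproduct \<sigma>. a u * b v)"
    by (simp add: case_prod_unfold sum_mset_times_sum_mset)
  finally show "(a \<otimes>\<^bsub>character_group d n\<^esub> b) (\<rho> + \<sigma>)
    = (a \<otimes>\<^bsub>character_group d n\<^esub> b) \<rho> * (a \<otimes>\<^bsub>character_group d n\<^esub> b) \<sigma>"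
    using * by (simp add: character_mult_eq)
qed (use a b in \<open>auto simp: character_mult_eq coproduct_empty character_empty\<close>)

text \<open>Coassociativity. Truncation does not interfere, because both factors of a term of the
  coproduct have degree at most that of the forest.\<close>

lemma character_mult_assoc:
  "(a \<otimes>\<^bsub>character_group d n\<^esub> b) \<otimes>\<^bsub>character_group d n\<^esub> c
     = a \<otimes>\<^bsub>character_group d n\<^esub> (b \<otimes>\<^bsub>character_group d n\<^esub> c)"
proof
  fix \<rho>
  show "((a \<otimes>\<^bsub>character_group d n\<^esub> b) \<otimes>\<^bsub>character_group d n\<^esub> c) \<rho>
     = (a \<otimes>\<^bsub>character_group d n\<^esub> (b \<otimes>\<^bsub>character_group d n\<^esub> c)) \<rho>"
  proof (cases "\<rho> \<in> forests d \<and> forest_degree \<rho> \<le> n")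
    case True
    have "(\<Sum>(x, y)\<in>#coproduct \<rho>. (a \<otimes>\<^bsub>character_group d n\<^esub> b) x * c y)
      = (\<Sum>(x, y)\<in>#coproduct \<rho>. \<Sum>(u, v)\<in>#coproduct x. a u * b v * c y)"
    proof (intro arg_cong[of _ _ sum_mset] image_mset_cong, clarify)
      fix x y assume "(x, y) \<in># coproduct \<rho>"
      then have "x \<in> forests d \<and> forest_degree x \<le> n"
        using True coproduct_forests coproduct_degree by (metis add_leE)
      then show "(a \<otimes>\<^bsub>character_group d n\<^esub> b) x * c y = (\<Sum>(u, v)\<in>#coproduct x. a u * b v * c y)"
        by (simp add: character_mult_eq case_prod_unfold sum_mset_distrib_right)
    qed
    also have "\<dots> = (\<Sum>(x, y)\<in>#coproduct \<rho>. \<Sum>(u, v)\<in>#coproduct y. a x * b u * c v)"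
      by (rule coproduct_coassoc)
    also have "\<dots> = (\<Sum>(x, y)\<in>#coproduct \<rho>. a x * (b \<otimes>\<^bsub>character_group d n\<^esub> c) y)"
    proof (intro arg_cong[of _ _ sum_mset] image_mset_cong, clarify)
      fix x y assume "(x, y) \<in># coproduct \<rho>"
      then have "y \<in> forests d \<and> forest_degree y \<le> n"
        using True coproduct_forests coproduct_degree by (metis add_leE)
      then show "(\<Sum>(u, v)\<in>#coproduct y. a x * b u * c v) = a x * (b \<otimes>\<^bsub>character_group d n\<^esub> c) y"
        by (simp add: character_mult_eq case_prod_unfold sum_mset_distrib_left mult.assoc)
    qed
    finally show ?thesis using True
      unfolding character_mult_eq[where a = "a \<otimes>\<^bsub>character_group d n\<^esub> b"]
        character_mult_eq[where b = "b \<otimes>\<^bsub>character_group d n\<^esub> c"]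
      by simp
  next
    case False
    then show ?thesis by (simp only: character_mult_eq if_False)
  qed
qed

lemma character_one_closed: "\<one>\<^bsub>character_group d n\<^esub> \<in> carrier (character_group d n)"
  by (auto simp: in_character_group_iff character_one_eq)

lemma character_one_mult:
  assumes "a \<in> carrier (character_group d n)"
  shows "\<one>\<^bsub>character_group d n\<^esub> \<otimes>\<^bsub>character_group d n\<^esub> a = a"
proof
  fix \<rho>
  have "(\<Sum>(x, y)\<in>#coproduct \<rho>. \<one>\<^bsub>character_group d n\<^esub> x * a y)
      = (\<Sum>(x, y)\<in>#coproduct \<rho>. if x = {#} then a y else 0)"
    by (intro arg_cong[of _ _ sum_mset] image_mset_cong) (auto simp: character_one_eq)
  then show "(\<one>\<^bsub>character_group d n\<^esub> \<otimes>\<^bsub>character_group d n\<^esub> a) \<rho> = a \<rho>"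
    using character_eq_0[OF assms] by (auto simp: character_mult_eq coproduct_sum_counit_left)
qed

lemma character_mult_one:
  assumes "a \<in> carrier (character_group d n)"
  shows "a \<otimes>\<^bsub>character_group d n\<^esub> \<one>\<^bsub>character_group d n\<^esub> = a"
proof
  fix \<rho>
  have "(\<Sum>(x, y)\<in>#coproduct \<rho>. a x * \<one>\<^bsub>character_group d n\<^esub> y)
      = (\<Sum>(x, y)\<in>#coproduct \<rho>. if y = {#} then a x else 0)"
    by (intro arg_cong[of _ _ sum_mset] image_mset_cong) (auto simp: character_one_eq)
  then show "(a \<otimes>\<^bsub>character_group d n\<^esub> \<one>\<^bsub>character_group d n\<^esub>) \<rho> = a \<rho>"
    using character_eq_0[OF assms] by (auto simp: character_mult_eq coproduct_sum_counit_right)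
qed

text \<open>The grafting recursion of the coproduct involves the right inverse of a character on trees
  only, so the inverse is computed there and then extended multiplicatively.\<close>

function right_inverse_tree :: "(nat tree multiset \<Rightarrow> real) \<Rightarrow> nat tree \<Rightarrow> real" where
  "right_inverse_tree a (Node j \<rho>) = - a {#Node j \<rho>#} -
     (\<Sum>(x, y)\<in>#filter_mset (\<lambda>(x, y). x \<noteq> {#}) (coproduct \<rho>). a x * right_inverse_tree a (Node j y))"
  by pat_completeness auto
termination
proof (relation "Wellfounded.measure (tree_degree \<circ> snd)", goal_cases)
  \<comment> \<open>The filter drops the term with empty left factor, where the recursion would call
    itself; a nonempty left factor takes degree away from the right one.\<close>
  case (2 a j \<rho> xy x y)
  then have "forest_degree x + forest_degree y = forest_degree \<rho>" "x \<noteq> {#}"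
    using coproduct_degree[of x y \<rho>] by auto
  moreover from this have "forest_degree x > 0" by (metis forest_degree_eq_0_iff gr0I)
  ultimately show ?case by simp
qed simp

declare right_inverse_tree.simps [simp del]

text \<open>With the dropped term restored, the recursion says that the convolution of
  \<open>a\<close> with its inverse vanishes on a tree.\<close>

lemma right_inverse_tree_eq:
  assumes "a {#} = 1"
  shows "a {#Node j \<rho>#} + (\<Sum>(x, y)\<in>#coproduct \<rho>. a x * right_inverse_tree a (Node j y)) = 0"
proof -
  obtain M where M: "coproduct \<rho> = add_mset ({#}, \<rho>) M" "\<forall>(x, y)\<in>#M. x \<noteq> {#}"
    using coproduct_counit_left by blast
  have "filter_mset (\<lambda>(x, y). x \<noteq> {#}) (coproduct \<rho>) = M"
    using M(2) by (simp add: M(1) filter_mset_eq_conv case_prod_unfold)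
  then have "right_inverse_tree a (Node j \<rho>)
      = - a {#Node j \<rho>#} - (\<Sum>(x, y)\<in>#M. a x * right_inverse_tree a (Node j y))"
    by (subst right_inverse_tree.simps) simp
  then show ?thesis by (simp add: M(1) assms)
qed

text \<open>Forests are the free commutative monoid on trees, so values on trees can be prescribed
  at will. This supplies the inverses and also the test points that separate coefficients.\<close>

definition multiplicative_extension :: "nat \<Rightarrow> nat \<Rightarrow> (nat tree \<Rightarrow> real) \<Rightarrow> forest \<Rightarrow> real" where
  "multiplicative_extension d n f \<rho> =
     (if \<rho> \<in> forests d \<and> forest_degree \<rho> \<le> n then \<Prod>\<tau>\<in>#\<rho>. f \<tau> else 0)"

lemma multiplicative_extension_in_group:
  "multiplicative_extension d n f \<in> carrier (character_group d n)"
  by (auto simp: in_character_group_iff multiplicative_extension_def)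

text \<open>Both sides are characters, so it suffices to compare them on single trees; there the
  grafting formula reduces the claim to \<open>right_inverse_tree_eq\<close>.\<close>

lemma character_right_inverse:
  assumes a: "a \<in> carrier (character_group d n)"
  shows "a \<otimes>\<^bsub>character_group d n\<^esub> multiplicative_extension d n (right_inverse_tree a)
           = \<one>\<^bsub>character_group d n\<^esub>" (is "?ab = _")
proof
  let ?b = "multiplicative_extension d n (right_inverse_tree a)"
  have ab: "?ab \<in> carrier (character_group d n)"
    by (intro character_mult_closed a multiplicative_extension_in_group)
  fix \<rho>
  show "?ab \<rho> = \<one>\<^bsub>character_group d n\<^esub> \<rho>"
  proof (cases "\<rho> = {#} \<or> \<not> (\<rho> \<in> forests d \<and> forest_degree \<rho> \<le> n)")
    case True
    then show ?thesis
      using character_eq_0[OF ab] character_empty[OF ab]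
        character_eq_0[OF character_one_closed] character_empty[OF character_one_closed] by metis
  next
    case False
    then obtain \<tau> \<sigma> where 1: "\<rho> = add_mset \<tau> \<sigma>" by (cases \<rho>) auto
    obtain j \<upsilon> where \<tau>: "\<tau> = Node j \<upsilon>" by (cases \<tau>)
    have "(\<Sum>(x, y)\<in>#coproduct \<upsilon>. a x * ?b {#Node j y#})
        = (\<Sum>(x, y)\<in>#coproduct \<upsilon>. a x * right_inverse_tree a (Node j y))"
    proof (intro arg_cong[of _ _ sum_mset] image_mset_cong, clarify)
      fix x y assume xy: "(x, y) \<in># coproduct \<upsilon>"
      then have "?b {#Node j y#} = right_inverse_tree a (Node j y)"
        using coproduct_degree[OF xy] coproduct_forests[OF xy, of d] False 1 \<tau>
        by (simp add: multiplicative_extension_def)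
      then show "a x * ?b {#Node j y#} = a x * right_inverse_tree a (Node j y)" by simp
    qed
    then have "?ab {#\<tau>#} = 0"
      using right_inverse_tree_eq[of a j \<upsilon>] False 1 \<tau> character_empty[OF a]
        character_empty[OF multiplicative_extension_in_group, of d n "right_inverse_tree a"]
      by (simp add: character_mult_eq coproduct_graft image_mset.compositionality comp_def
          case_prod_unfold)
    moreover have "?ab ({#\<tau>#} + \<sigma>) = ?ab {#\<tau>#} * ?ab \<sigma>"
      using False 1 \<tau> by (intro character_plus[OF ab]) auto
    ultimately show ?thesis using False 1 by (simp add: character_one_eq)
  qed
qed

lemma group_character_group: "group (character_group d n)"
proof (rule groupI)
  fix a assume a: "a \<in> carrier (character_group d n)"
  define r where "r = (\<lambda>a. multiplicative_extension d n (right_inverse_tree a))"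
  have r: "r c \<in> carrier (character_group d n)" for c
    unfolding r_def by (rule multiplicative_extension_in_group)
  have rr: "c \<otimes>\<^bsub>character_group d n\<^esub> r c = \<one>\<^bsub>character_group d n\<^esub>"
    if "c \<in> carrier (character_group d n)" for c
    unfolding r_def using character_right_inverse[OF that] .
  \<comment> \<open>\<open>groupI\<close> asks for left inverses, but only right ones are known.
    Since \<open>r a\<close> is a right inverse of \<open>a\<close> and \<open>r (r a)\<close> one
    of \<open>r a\<close>, it follows that \<open>a = r (r a)\<close>, so \<open>r a\<close> is
    two-sided.\<close>
  have "a = a \<otimes>\<^bsub>character_group d n\<^esub> (r a \<otimes>\<^bsub>character_group d n\<^esub> r (r a))"
    using a by (simp add: rr r character_mult_one)
  also have "\<dots> = r (r a)"
    by (simp only: rr[OF a] character_one_mult[OF r] flip: character_mult_assoc)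
  finally have "r a \<otimes>\<^bsub>character_group d n\<^esub> a = \<one>\<^bsub>character_group d n\<^esub>"
    using rr[OF r] by metis
  then show "\<exists>b\<in>carrier (character_group d n). b \<otimes>\<^bsub>character_group d n\<^esub> a = \<one>\<^bsub>character_group d n\<^esub>"
    using r by blast
qed (simp_all add: character_mult_closed character_one_closed character_mult_assoc character_one_mult)

lemma continuous_on_sum_mset [continuous_intros]:
  fixes f :: "'i \<Rightarrow> 'a::topological_space \<Rightarrow> 'b::topological_comm_monoid_add"
  assumes "\<And>i. i \<in># M \<Longrightarrow> continuous_on S (f i)"
  shows "continuous_on S (\<lambda>s. \<Sum>i\<in>#M. f i s)"
  using assms by (induction M) (auto intro!: continuous_intros)

text \<open>Solving \<open>X * inv X = 1\<close> for the term with empty left factor writes each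
  coordinate of the inverse as a polynomial in coordinates of \<open>X\<close> and in coordinates of
  the inverse of lower degree.\<close>

lemma continuous_on_character_inverse:
  fixes X :: "'a::topological_space \<Rightarrow> forest \<Rightarrow> real"
  assumes G: "X ` S \<subseteq> carrier (character_group d n)"
    and X: "\<And>\<rho>. continuous_on S (\<lambda>s. X s \<rho>)"
  shows "continuous_on S (\<lambda>s. (inv\<^bsub>character_group d n\<^esub> X s) \<rho>)"
proof (induction \<rho> rule: measure_induct_rule[of forest_degree])
  case (less \<rho>)
  interpret group "character_group d n" by (rule group_character_group)
  show ?case
  proof (cases "\<rho> = {#} \<or> \<not> (\<rho> \<in> forests d \<and> forest_degree \<rho> \<le> n)")
    case True
    then have "(inv\<^bsub>character_group d n\<^esub> X s) \<rho> = (if \<rho> = {#} then 1 else 0)" if "s \<in> S" for s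
      using character_eq_0[of "inv\<^bsub>character_group d n\<^esub> X s" d n \<rho>]
        character_empty[of "inv\<^bsub>character_group d n\<^esub> X s" d n] G that by auto
    then show ?thesis by (subst continuous_on_cong[OF refl]) (auto simp: continuous_on_const)
  next
    case False
    obtain M where M: "coproduct \<rho> = add_mset ({#}, \<rho>) M" "\<forall>(x, y)\<in>#M. x \<noteq> {#}"
      using coproduct_counit_left by blast
    have eq: "(inv\<^bsub>character_group d n\<^esub> X s) \<rho>
        = - (\<Sum>xy\<in>#M. X s (fst xy) * (inv\<^bsub>character_group d n\<^esub> X s) (snd xy))" if "s \<in> S" for s
    proof -
      have "X s \<in> carrier (character_group d n)" using G that by auto
      then have "(X s \<otimes>\<^bsub>character_group d n\<^esub> inv\<^bsub>character_group d n\<^esub> X s) \<rho> = 0"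
          "X s {#} = 1"
        using False by (simp_all add: character_one_eq character_empty)
      then show ?thesis using False by (simp add: character_mult_eq M case_prod_unfold)
    qed
    have "continuous_on S (\<lambda>s. - (\<Sum>xy\<in>#M. X s (fst xy) * (inv\<^bsub>character_group d n\<^esub> X s) (snd xy)))"
    proof (intro continuous_intros X less.IH)
      fix xy assume xy: "xy \<in># M"
      then have "forest_degree (fst xy) + forest_degree (snd xy) = forest_degree \<rho>" "fst xy \<noteq> {#}"
        using coproduct_degree[of "fst xy" "snd xy" \<rho>] M by (auto simp: case_prod_unfold)
      moreover from this have "forest_degree (fst xy) > 0" by (metis forest_degree_eq_0_iff gr0I)
      ultimately show "forest_degree (snd xy) < forest_degree \<rho>" by linarith
    qed
    then show ?thesis using eq by (subst continuous_on_cong[OF refl]) auto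
  qed
qed

section \<open>Coefficients of one-forms\<close>

text \<open>Distinct primes are assigned to the finitely many trees involved; unique factorisation
  recovers a forest from the product of its weights.\<close>

lemma ex_forest_separating_weights:
  assumes "finite F"
  shows "\<exists>f :: 'l tree \<Rightarrow> nat. inj_on (\<lambda>\<rho>. \<Prod>\<tau>\<in>#\<rho>. f \<tau>) (F :: 'l tree multiset set)"
proof -
  let ?S = "\<Union>\<rho>\<in>F. set_mset \<rho>"
  have "finite ?S" using assms by auto
  moreover have "infinite {p::nat. prime p}"
    by (rule primes_infinite)
  then obtain B where B: "finite B" "card B = card ?S" "B \<subseteq> {p::nat. prime p}"
    using infinite_arbitrarily_large by blast
  ultimately obtain f where "bij_betw f ?S B"
    using finite_same_card_bij by metis
  then have f: "inj_on f ?S" "f ` ?S \<subseteq> {p. prime p}"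
    using B(3) by (auto simp: bij_betw_def)
  have "\<rho> = \<sigma>" if "\<rho> \<in> F" "\<sigma> \<in> F" "(\<Prod>\<tau>\<in>#\<rho>. f \<tau>) = (\<Prod>\<tau>\<in>#\<sigma>. f \<tau>)" for \<rho> \<sigma>
  proof -
    have pf: "prime_factorization (\<Prod>\<tau>\<in>#\<upsilon>. f \<tau>) = image_mset f \<upsilon>" if "\<upsilon> \<in> F" for \<upsilon>
      using f(2) that by (intro prime_factorization_prod_mset_primes) auto
    have "image_mset f \<rho> = image_mset f \<sigma>" using pf that by metis
    then show ?thesis using f(1) that
      by (intro multiset.inj_map_strong[of \<rho> \<sigma> f f]) (auto dest: inj_onD)
  qed
  then show ?thesis by (intro exI[of _ f] inj_onI)
qed

text \<open>A Vandermonde argument. At the character sending each tree to the \<open>k\<close>-th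
  power of its weight, a forest takes the value \<open>m ^ k\<close> with \<open>m\<close> its own
  weight, and these weights are distinct.\<close>

lemma represents_unique:
  assumes "represents d n w \<phi>" "represents d n v \<phi>"
  shows "w = v"
proof
  fix \<rho>
  let ?F = "forests_upto d n"
  show "w \<rho> = v \<rho>"
  proof (cases "\<rho> \<in> ?F")
    case False
    then show ?thesis using assms by (simp add: represents_def)
  next
    case True
    obtain f :: "nat tree \<Rightarrow> nat" where f: "inj_on (\<lambda>\<rho>. \<Prod>\<tau>\<in>#\<rho>. f \<tau>) ?F"
      using ex_forest_separating_weights finite_forests_upto by blast
    define m where "m = (\<lambda>\<rho>. real (\<Prod>\<tau>\<in>#\<rho>. f \<tau>))"
    have pow: "(\<Sum>\<sigma>\<in>?F. (w \<sigma> - v \<sigma>) * m \<sigma> ^ k) = 0" for k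
    proof -
      let ?c = "multiplicative_extension d n (\<lambda>\<tau>. real (f \<tau>) ^ k)"
      have prod: "(\<Prod>\<tau>\<in>#\<sigma>. real (f \<tau>) ^ k) = m \<sigma> ^ k" for \<sigma>
        by (induction \<sigma>) (simp_all add: m_def power_mult_distrib)
      have "?c \<sigma> = m \<sigma> ^ k" if "\<sigma> \<in> ?F" for \<sigma>
        using that by (simp add: multiplicative_extension_def forests_upto_def prod)
      moreover have "(\<Sum>\<sigma>\<in>?F. w \<sigma> * ?c \<sigma>) = (\<Sum>\<sigma>\<in>?F. v \<sigma> * ?c \<sigma>)"
        using assms multiplicative_extension_in_group[of d n "\<lambda>\<tau>. real (f \<tau>) ^ k"]
        by (auto simp: represents_def)
      ultimately show ?thesis by (simp add: left_diff_distrib sum_subtractf)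
    qed
    have poly: "(\<Sum>\<sigma>\<in>?F. (w \<sigma> - v \<sigma>) * poly P (m \<sigma>)) = 0" for P
    proof -
      have "(\<Sum>\<sigma>\<in>?F. (w \<sigma> - v \<sigma>) * poly P (m \<sigma>))
          = (\<Sum>\<sigma>\<in>?F. \<Sum>k\<le>degree P. coeff P k * ((w \<sigma> - v \<sigma>) * m \<sigma> ^ k))"
        by (simp add: poly_altdef sum_distrib_left mult_ac)
      also have "\<dots> = (\<Sum>k\<le>degree P. coeff P k * (\<Sum>\<sigma>\<in>?F. (w \<sigma> - v \<sigma>) * m \<sigma> ^ k))"
        by (subst sum.swap) (simp add: sum_distrib_left)
      finally show ?thesis by (simp add: pow)
    qed
    \<comment> \<open>An unnormalised Lagrange polynomial: it vanishes at the weights of all forests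
      except \<rho>.\<close>
    define P where "P = (\<Prod>\<sigma>\<in>?F - {\<rho>}. [:- m \<sigma>, 1:])"
    have "poly P (m \<sigma>) = 0" if "\<sigma> \<in> ?F - {\<rho>}" for \<sigma>
      using that unfolding P_def poly_prod by (intro prod_zero) auto
    then have "(\<Sum>\<sigma>\<in>?F. (w \<sigma> - v \<sigma>) * poly P (m \<sigma>)) = (w \<rho> - v \<rho>) * poly P (m \<rho>)"
      using True by (subst sum.remove[of _ \<rho>]) auto
    moreover have "poly P (m \<rho>) \<noteq> 0"
      unfolding P_def poly_prod using f True by (auto simp: m_def inj_on_def)
    ultimately show ?thesis using poly[of P] by simp
  qed
qed

lemma coefficient_eqI: "represents d n w \<phi> \<Longrightarrow> coefficient d n \<phi> = w"
  unfolding coefficient_def using represents_unique by blast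

lemma one_form_norm_eq:
  "represents d n w \<phi> \<Longrightarrow> one_form_norm d n \<phi> = (MAX \<rho>\<in>forests_upto d n. \<bar>w \<rho>\<bar>)"
  by (simp add: one_form_norm_def coefficient_eqI)

lemma represents_coefficient: "\<phi> \<in> one_forms d n \<Longrightarrow> represents d n (coefficient d n \<phi>) \<phi>"
  using coefficient_eqI by (fastforce simp: one_forms_def)


section \<open>Partitions and sewing\<close>

text \<open>Recursion over the list of points, in place of the indexed sums of the definitions,
  allows splitting at a shared point and list induction.\<close>

fun partition_sum :: "('b \<Rightarrow> 'b \<Rightarrow> 'a::comm_monoid_add) \<Rightarrow> 'b list \<Rightarrow> 'a" where
  "partition_sum \<Xi> (x # y # zs) = \<Xi> x y + partition_sum \<Xi> (y # zs)"
| "partition_sum \<Xi> [x] = 0"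
| "partition_sum \<Xi> [] = 0"

lemma sum_consecutive_eq_partition_sum:
  "(\<Sum>k<length D - 1. \<Xi> (D ! k) (D ! Suc k)) = partition_sum \<Xi> D"
  by (induction \<Xi> D rule: partition_sum.induct) (simp_all add: sum.lessThan_Suc_shift del: sum.lessThan_Suc)

lemma all_consecutive_iff_successively:
  "(\<forall>k<length D - 1. P (D ! k) (D ! Suc k)) \<longleftrightarrow> successively P D"
  by (induction P D rule: successively.induct) (auto simp: All_less_Suc2)

lemma partition_sum_append:
  "partition_sum \<Xi> (xs @ u # ys) = partition_sum \<Xi> (xs @ [u]) + partition_sum \<Xi> (u # ys)"
proof (induction xs)
  case (Cons x xs)
  then show ?case by (cases xs) (simp_all add: add.assoc)
qed simp

lemma partition_sum_nonneg:
  fixes \<Xi> :: "'b \<Rightarrow> 'b \<Rightarrow> real"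
  shows "(\<And>x y. 0 \<le> \<Xi> x y) \<Longrightarrow> 0 \<le> partition_sum \<Xi> D"
  by (induction \<Xi> D rule: partition_sum.induct) auto

lemma partitions_singleton_iff [simp]: "[x] \<in> partitions s t \<longleftrightarrow> x = s \<and> x = t"
  by (auto simp: partitions_def)

lemma partitions_nonempty: "D \<in> partitions s t \<Longrightarrow> D \<noteq> []"
  by (simp add: partitions_def)

lemma partitions_append_iff:
  "xs @ u # ys \<in> partitions s t \<longleftrightarrow> xs @ [u] \<in> partitions s u \<and> u # ys \<in> partitions u t"
  by (cases xs) (fastforce simp: partitions_def sorted_wrt_append)+

lemma partitions_Cons_Cons_iff:
  "x # y # zs \<in> partitions s t \<longleftrightarrow> x = s \<and> s < y \<and> y # zs \<in> partitions y t"
  by (auto simp: partitions_def)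

lemma partitions_bounds:
  assumes "D \<in> partitions s t" "x \<in> set D"
  shows "s \<le> x" "x \<le> t"
proof -
  obtain ys zs where D: "D = ys @ x # zs" using assms(2) by (meson split_list)
  show "s \<le> x" using assms(1) unfolding D by (cases ys) (auto simp: partitions_def)
  have "x # zs \<in> partitions x t" using assms(1) D partitions_append_iff by blast
  then show "x \<le> t"
    by (cases zs rule: rev_cases) (auto simp: partitions_def sorted_wrt_append)
qed

lemma partitions_le: "D \<in> partitions s t \<Longrightarrow> s \<le> t"
  using partitions_bounds[of D s t "last D"] by (auto simp: partitions_def)

lemma partitions_same_iff: "D \<in> partitions s s \<longleftrightarrow> D = [s]"
proof
  assume D: "D \<in> partitions s s"
  show "D = [s]"
  proof (cases D)
    case (Cons x xs)
    then show ?thesis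
    proof (cases xs)
      case (Cons y ys)
      then show ?thesis using D \<open>D = x # xs\<close> partitions_bounds[OF D, of y]
        by (auto simp: partitions_Cons_Cons_iff)
    qed (use D \<open>D = x # xs\<close> in auto)
  qed (use D partitions_nonempty in blast)
qed simp

lemma partitions_endpoints: "D \<in> partitions s t \<Longrightarrow> s \<in> set D" "D \<in> partitions s t \<Longrightarrow> t \<in> set D"
  by (auto simp: partitions_def)

lemma partitionsI:
  assumes "sorted_wrt (<) D" "s \<in> set D" "t \<in> set D" "\<And>x. x \<in> set D \<Longrightarrow> s \<le> x \<and> x \<le> t"
  shows "D \<in> partitions s t"
proof -
  obtain x xs where D: "D = x # xs" using assms(2) by (cases D) auto
  have "hd D = s" using assms D by force
  moreover obtain ys y where D': "D = ys @ [y]" using assms(2) by (cases D rule: rev_cases) auto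
  have "last D = t" using assms D' by (force simp: sorted_wrt_append)
  ultimately show ?thesis using assms(1) D by (simp add: partitions_def)
qed

lemma partitions_common_refinement:
  assumes "D \<in> partitions s t" "E \<in> partitions s t"
  obtains R where "R \<in> partitions s t" "set D \<subseteq> set R" "set E \<subseteq> set R"
proof
  let ?R = "sorted_list_of_set (set D \<union> set E)"
  show "?R \<in> partitions s t"
    using partitions_bounds[OF assms(1)] partitions_bounds[OF assms(2)] partitions_endpoints[OF assms(1)]
    by (intro partitionsI) auto
qed auto

lemma partitions_concat:
  assumes "D \<in> partitions s u" "E \<in> partitions u t"
  obtains xs ys where "D = xs @ [u]" "E = u # ys" "xs @ u # ys \<in> partitions s t"
proof -
  obtain xs where "D = xs @ [u]" using assms(1)
    by (cases D rule: rev_cases) (auto simp: partitions_def)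
  moreover obtain ys where "E = u # ys" using assms(2) by (cases E) (auto simp: partitions_def)
  ultimately show ?thesis using that assms partitions_append_iff by metis
qed

lemma ex_partition_small_mesh:
  assumes "s \<le> t" "\<delta> > 0"
  shows "\<exists>D\<in>partitions s t. successively (\<lambda>x y. y - x < \<delta>) D"
proof -
  \<comment> \<open>Points are split off at the right end at distance \<open>\<delta> / 2\<close>,
    which keeps the mesh strictly below \<delta>; \<open>n\<close> bounds the number of such
    steps.\<close>
  have "\<exists>D\<in>partitions s t. successively (\<lambda>x y. y - x < \<delta>) D"
    if "s \<le> t" "t - s \<le> real n * (\<delta> / 2)" for n t
    using that
  proof (induction n arbitrary: t)
    case 0
    then show ?case by (intro bexI[of _ "[s]"]) auto
  next
    case (Suc n)
    show ?case
    proof (cases "t - \<delta> / 2 \<le> s")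
      case True
      show ?thesis
      proof (cases "s = t")
        case True
        then show ?thesis by (intro bexI[of _ "[s]"]) auto
      next
        case False
        then show ?thesis using True Suc.prems assms(2)
          by (intro bexI[of _ "[s, t]"]) (auto simp: partitions_Cons_Cons_iff field_simps)
      qed
    next
      case False
      then obtain D where D: "D \<in> partitions s (t - \<delta> / 2)" "successively (\<lambda>x y. y - x < \<delta>) D"
        using Suc.IH[of "t - \<delta> / 2"] Suc.prems by (auto simp: field_simps)
      have "[t - \<delta> / 2, t] \<in> partitions (t - \<delta> / 2) t"
        using assms(2) by (simp add: partitions_Cons_Cons_iff)
      from partitions_concat[OF D(1) this] obtain xs where
        "D = xs @ [t - \<delta> / 2]" "xs @ [t - \<delta> / 2, t] \<in> partitions s t" by auto
      then show ?thesis using D(2) assms(2)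
        by (intro bexI[of _ "xs @ [t - \<delta> / 2, t]"]) (auto simp: successively_append_iff)
    qed
  qed
  moreover obtain n where "(t - s) / (\<delta> / 2) \<le> real n" using real_arch_simple by blast
  then have "t - s \<le> real n * (\<delta> / 2)" using assms(2) by (simp add: field_simps)
  ultimately show ?thesis using assms(1) by blast
qed

lemma eventually_mesh_filter:
  "eventually P (mesh_filter s t) \<longleftrightarrow>
     (\<exists>\<delta>>0. \<forall>D\<in>partitions s t. successively (\<lambda>x y. y - x < \<delta>) D \<longrightarrow> P D)"
proof -
  have mono: "successively (\<lambda>x y. y - x < \<delta>') D"
    if "successively (\<lambda>x y. y - x < \<delta>) D" "\<delta> \<le> \<delta>'" for D and \<delta> \<delta>' :: real
    using that by (auto elim!: successively_mono)
  show ?thesis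
    unfolding mesh_filter_def all_consecutive_iff_successively[of _ "\<lambda>x y. y - x < _"]
  proof (subst eventually_INF_base)
    show "\<exists>x\<in>{0<..}. principal {D \<in> partitions s t. successively (\<lambda>xa y. y - xa < x) D}
        \<le> inf (principal {D \<in> partitions s t. successively (\<lambda>x y. y - x < a) D})
              (principal {D \<in> partitions s t. successively (\<lambda>x y. y - x < b) D})"
      if "a \<in> {0<..}" "b \<in> {0<..}" for a b
      using that by (intro bexI[of _ "min a b"]) (auto simp del: min_less_iff_conj intro: mono[of "min a b"])
  qed (auto simp: eventually_principal)
qed

text \<open>Makes limits along this filter unique, so that \<open>Lim\<close> is the limit once
  convergence is known.\<close>

lemma mesh_filter_neq_bot: "s \<le> t \<Longrightarrow> mesh_filter s t \<noteq> bot"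
  using ex_partition_small_mesh[of s t]
  by (fastforce simp: trivial_limit_def eventually_mesh_filter)

text \<open>The setting of the sewing lemma: a germ \<open>\<Xi>\<close> whose additivity defect has
  order \<theta> > 1 in a control. The assumption \<open>small\<close> makes the summed defects
  vanish with the mesh.\<close>

locale sewing =
  fixes \<omega> \<Xi> :: "real \<Rightarrow> real \<Rightarrow> real" and T \<theta> c :: real
  assumes exponent: "\<theta> > 1"
    and const_nonneg: "c \<ge> 0"
    and superadditive: "0 \<le> s \<Longrightarrow> s \<le> u \<Longrightarrow> u \<le> t \<Longrightarrow> t \<le> T \<Longrightarrow> \<omega> s u + \<omega> u t \<le> \<omega> s t"
    and nonneg: "0 \<le> s \<Longrightarrow> s \<le> t \<Longrightarrow> t \<le> T \<Longrightarrow> 0 \<le> \<omega> s t"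
    and small: "\<epsilon> > 0 \<Longrightarrow> \<exists>\<delta>>0. \<forall>s t. 0 \<le> s \<and> s \<le> t \<and> t \<le> T \<and> t - s < \<delta> \<longrightarrow> \<omega> s t < \<epsilon>"
    and germ: "0 \<le> s \<Longrightarrow> s \<le> u \<Longrightarrow> u \<le> t \<Longrightarrow> t \<le> T \<Longrightarrow>
      \<bar>\<Xi> s t - \<Xi> s u - \<Xi> u t\<bar> \<le> c * \<omega> s t powr \<theta>"
begin

lemma control_diag: "0 \<le> s \<Longrightarrow> s \<le> T \<Longrightarrow> \<omega> s s = 0"
  using superadditive[of s s s] nonneg[of s s] by simp

lemma germ_diag: "0 \<le> s \<Longrightarrow> s \<le> T \<Longrightarrow> \<Xi> s s = 0"
  using germ[of s s s] control_diag[of s] by simp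

lemma control_mono:
  assumes "0 \<le> s" "s \<le> u" "u \<le> v" "v \<le> t" "t \<le> T"
  shows "\<omega> u v \<le> \<omega> s t"
  using superadditive[of s u t] superadditive[of u v t] nonneg[of s u] nonneg[of v t] assms by linarith

text \<open>The solution \<open>K\<close> of \<open>K = 2 * K * 2 powr (- \<theta>) + 2 * c\<close>:
  two parts with at most half the control each, and two germ defects.\<close>

definition sewing_const :: real where
  "sewing_const = 2 * c / (1 - 2 powr (1 - \<theta>))"

lemma two_powr_less: "2 powr (1 - \<theta>) < 1"
  using exponent powr_less_mono[of "1 - \<theta>" 0 2] by simp

lemma sewing_const_nonneg: "sewing_const \<ge> 0"
  using const_nonneg two_powr_less by (simp add: sewing_const_def)

lemma sewing_const_eq: "2 * (sewing_const * (1 / 2) powr \<theta>) + 2 * c = sewing_const"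
proof -
  have "2 * (1 / 2) powr \<theta> = (2::real) powr (1 - \<theta>)"
    by (simp add: powr_diff powr_divide)
  moreover have "sewing_const * (1 - 2 powr (1 - \<theta>)) = 2 * c"
    using two_powr_less exponent by (simp add: sewing_const_def)
  ultimately have "sewing_const * (1 - 2 * (1 / 2) powr \<theta>) = 2 * c" by simp
  then show ?thesis by (simp add: right_diff_distrib)
qed

text \<open>The partition is cut at the interval in which the control crosses half of its total
  value, so that both remaining parts carry at most half of it.\<close>

lemma partition_sum_minus_germ:
  assumes "D \<in> partitions s t" "0 \<le> s" "t \<le> T"
  shows "\<bar>partition_sum \<Xi> D - \<Xi> s t\<bar> \<le> sewing_const * \<omega> s t powr \<theta>"
  using assms
proof (induction D arbitrary: s t rule: measure_induct_rule[of length])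
  case (less D)
  show ?case
  proof (cases "s = t")
    case True
    then show ?thesis using less.prems germ_diag sewing_const_nonneg by (simp add: partitions_same_iff)
  next
    case False
    with partitions_le[OF less.prems(1)] have "s < t" by simp
    define P where "P = (\<lambda>u. u < t \<and> \<omega> s u \<le> \<omega> s t / 2)"
    have "P s" using \<open>s < t\<close> less.prems nonneg[of s t] by (simp add: P_def control_diag)
    moreover have "s \<in> set D" using partitions_endpoints less.prems by blast
    \<comment> \<open>\<open>a\<close> is the last partition point satisfying \<open>P\<close>; the
      conjunct \<open>u < t\<close> in \<open>P\<close> guarantees that it has a successor
      \<open>b\<close>.\<close>
    ultimately obtain ys a zs where D: "D = ys @ a # zs" "P a" "\<forall>z\<in>set zs. \<not> P z"
      using split_list_last_prop[of D P] by blast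
    have "zs \<noteq> []" using less.prems(1) D(1,2) by (auto simp: partitions_def P_def)
    then obtain b B where zs: "zs = b # B" by (cases zs) auto
    have L: "ys @ [a] \<in> partitions s a" and R: "a # b # B \<in> partitions a t"
      using less.prems(1) D(1) zs partitions_append_iff by blast+
    then have R': "b # B \<in> partitions b t" and "a < b" by (auto simp: partitions_Cons_Cons_iff)
    have *: "s \<le> a" "a \<le> b" "b \<le> t" "a < b"
      using partitions_le[OF L] partitions_le[OF R'] \<open>a < b\<close> by auto
    have wa: "\<omega> s a \<le> \<omega> s t / 2" using D(2) by (simp add: P_def)
    have wb: "\<omega> b t \<le> \<omega> s t / 2"
    \<comment> \<open>\<open>b\<close> may violate \<open>P\<close> merely because it equals
      \<open>t\<close>; the right part is then trivial.\<close>
    proof (cases "b = t")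
      case True
      then show ?thesis using less.prems * nonneg[of s t] control_diag[of t] by simp
    next
      case False
      then have "\<omega> s b > \<omega> s t / 2" using D(3) zs * by (auto simp: P_def)
      then show ?thesis using superadditive[of s b t] * less.prems by simp
    qed
    have half: "sewing_const * w powr \<theta> \<le> sewing_const * (1 / 2) powr \<theta> * \<omega> s t powr \<theta>"
      if "0 \<le> w" "w \<le> \<omega> s t / 2" for w
    proof -
      have "w powr \<theta> \<le> (1 / 2 * \<omega> s t) powr \<theta>" using that exponent by (intro powr_mono2) auto
      also have "\<dots> = (1 / 2) powr \<theta> * \<omega> s t powr \<theta>"
        by (subst powr_mult) simp_all
      finally show ?thesis using sewing_const_nonneg by (simp add: mult_left_mono mult.assoc)
    qed
    have 1: "\<bar>partition_sum \<Xi> (ys @ [a]) - \<Xi> s a\<bar>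
        \<le> sewing_const * (1 / 2) powr \<theta> * \<omega> s t powr \<theta>"
      using less.IH[of "ys @ [a]" s a] L D(1) zs less.prems * half[OF nonneg wa]
      by (force intro: order_trans)
    have 2: "\<bar>partition_sum \<Xi> (b # B) - \<Xi> b t\<bar>
        \<le> sewing_const * (1 / 2) powr \<theta> * \<omega> s t powr \<theta>"
      using less.IH[of "b # B" b t] R' D(1) zs less.prems * half[OF nonneg wb]
      by (force intro: order_trans)
    \<comment> \<open>The interval from \<open>a\<close> to \<open>b\<close> is kept as it is.
      Comparing \<open>\<Xi> s t\<close> with \<open>\<Xi> s a + \<Xi> a b + \<Xi> b t\<close> costs
      two defects, hence the summand \<open>2 * c\<close>.\<close>
    have 3: "\<bar>\<Xi> s t - \<Xi> s a - \<Xi> a t\<bar> \<le> c * \<omega> s t powr \<theta>"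
      using germ[of s a t] * less.prems by simp
    have "c * \<omega> a t powr \<theta> \<le> c * \<omega> s t powr \<theta>"
      using control_mono[of s a t t] nonneg[of a t] * less.prems const_nonneg exponent
      by (intro mult_left_mono powr_mono2) auto
    then have 4: "\<bar>\<Xi> a t - \<Xi> a b - \<Xi> b t\<bar> \<le> c * \<omega> s t powr \<theta>"
      using germ[of a b t] * less.prems by simp
    have "partition_sum \<Xi> D = partition_sum \<Xi> (ys @ [a]) + \<Xi> a b + partition_sum \<Xi> (b # B)"
      using partition_sum_append[of \<Xi> ys a zs] D(1) zs by (simp add: add.assoc)
    then have "\<bar>partition_sum \<Xi> D - \<Xi> s t\<bar>
        \<le> 2 * (sewing_const * (1 / 2) powr \<theta> * \<omega> s t powr \<theta>) + 2 * (c * \<omega> s t powr \<theta>)"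
      using 1 2 3 4 by linarith
    also have "\<dots> = (2 * (sewing_const * (1 / 2) powr \<theta>) + 2 * c) * \<omega> s t powr \<theta>"
      by (simp add: algebra_simps)
    finally show ?thesis by (simp only: sewing_const_eq)
  qed
qed

text \<open>\<open>R\<close> restricts to a partition of each interval of \<open>D\<close>, where
  \<open>partition_sum_minus_germ\<close> applies.\<close>

lemma partition_sum_refinement:
  assumes "D \<in> partitions s t" "R \<in> partitions s t" "set D \<subseteq> set R" "0 \<le> s" "t \<le> T"
  shows "\<bar>partition_sum \<Xi> R - partition_sum \<Xi> D\<bar>
    \<le> sewing_const * partition_sum (\<lambda>x y. \<omega> x y powr \<theta>) D"
  using assms
proof (induction D arbitrary: s R rule: induct_list012)
  case (3 x y zs)
  have x: "x = s" "s < y" "y # zs \<in> partitions y t"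
    using "3.prems"(1) by (auto simp: partitions_Cons_Cons_iff)
  have "y \<in> set R" using "3.prems"(3) by auto
  then obtain R\<^sub>1 R\<^sub>2 where R: "R = R\<^sub>1 @ y # R\<^sub>2" by (meson split_list)
  have R': "R\<^sub>1 @ [y] \<in> partitions s y" "y # R\<^sub>2 \<in> partitions y t"
    using "3.prems"(2) R partitions_append_iff by blast+
  have "z \<in> set (y # R\<^sub>2)" if "z \<in> set (y # zs)" for z
  proof -
    have "y \<le> z" using that partitions_bounds[OF x(3)] by blast
    moreover have "z < y" if "z \<in> set R\<^sub>1"
      using R'(1) that by (auto simp: partitions_def sorted_wrt_append)
    ultimately show ?thesis using that "3.prems"(3) R by fastforce
  qed
  then have "\<bar>partition_sum \<Xi> (y # R\<^sub>2) - partition_sum \<Xi> (y # zs)\<bar>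
    \<le> sewing_const * partition_sum (\<lambda>x y. \<omega> x y powr \<theta>) (y # zs)"
    using "3.IH"(2)[of y "y # R\<^sub>2"] x R' "3.prems" by auto
  moreover have "\<bar>partition_sum \<Xi> (R\<^sub>1 @ [y]) - \<Xi> x y\<bar> \<le> sewing_const * \<omega> x y powr \<theta>"
    using partition_sum_minus_germ[OF R'(1)] x partitions_le[OF x(3)] "3.prems" by simp
  ultimately show ?case
    using partition_sum_append[of \<Xi> R\<^sub>1 y R\<^sub>2] R by (simp add: distrib_left)
qed (auto simp: partitions_same_iff dest: partitions_nonempty)

text \<open>One factor \<omega> is summed by superadditivity; the remaining power, of exponent
  \<theta> - 1 > 0, is small with the mesh.\<close>

lemma partition_sum_control_powr:
  assumes "D \<in> partitions s t" "0 \<le> s" "t \<le> T" "successively (\<lambda>x y. y - x < \<delta>) D"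
    and \<delta>: "\<And>x y. 0 \<le> x \<Longrightarrow> x \<le> y \<Longrightarrow> y \<le> T \<Longrightarrow> y - x < \<delta> \<Longrightarrow> \<omega> x y \<le> \<epsilon>"
  shows "partition_sum (\<lambda>x y. \<omega> x y powr \<theta>) D \<le> \<epsilon> powr (\<theta> - 1) * \<omega> s t"
  using assms(1-4)
proof (induction D arbitrary: s rule: induct_list012)
  case (2 x)
  then show ?case using nonneg[of s t] by simp
next
  case (3 x y zs)
  then have x: "x = s" "s < y" "y # zs \<in> partitions y t" "y \<le> t"
    using partitions_le by (auto simp: partitions_Cons_Cons_iff)
  have w: "0 \<le> \<omega> s y" "\<omega> s y \<le> \<epsilon>" using nonneg[of s y] \<delta>[of s y] x "3.prems" by auto
  have "\<omega> s y powr \<theta> = \<omega> s y powr (\<theta> - 1) * \<omega> s y"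
    using w(1) by (cases "\<omega> s y = 0") (simp_all add: powr_diff)
  also have "\<dots> \<le> \<epsilon> powr (\<theta> - 1) * \<omega> s y"
    using w exponent by (intro mult_right_mono powr_mono2) auto
  finally have "\<omega> s y powr \<theta> \<le> \<epsilon> powr (\<theta> - 1) * \<omega> s y" .
  moreover have "partition_sum (\<lambda>x y. \<omega> x y powr \<theta>) (y # zs) \<le> \<epsilon> powr (\<theta> - 1) * \<omega> y t"
    using "3.IH"(2)[of y] x "3.prems" by auto
  moreover have "\<epsilon> powr (\<theta> - 1) * (\<omega> s y + \<omega> y t) \<le> \<epsilon> powr (\<theta> - 1) * \<omega> s t"
    using superadditive[of s y t] x "3.prems" by (intro mult_left_mono) auto
  ultimately show ?case using x(1) by (simp add: distrib_left)
qed (auto dest: partitions_nonempty)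

text \<open>Both sums are compared with the sum over a common refinement.\<close>

lemma partition_sums_close:
  assumes "\<eta> > 0"
  obtains \<delta> where "\<delta> > 0" "\<And>s t D E. 0 \<le> s \<Longrightarrow> t \<le> T \<Longrightarrow> D \<in> partitions s t \<Longrightarrow> E \<in> partitions s t \<Longrightarrow>
    successively (\<lambda>x y. y - x < \<delta>) D \<Longrightarrow> successively (\<lambda>x y. y - x < \<delta>) E \<Longrightarrow>
    \<bar>partition_sum \<Xi> D - partition_sum \<Xi> E\<bar> \<le> \<eta>"
proof -
  \<comment> \<open>The factor 2 leaves \<open>\<eta> / 2\<close> for each of the two comparisons,
    the added 1 keeps \<open>M\<close> positive, and \<open>\<epsilon>\<close> solves
    \<open>\<epsilon> powr (\<theta> - 1) = \<eta> / M\<close>.\<close>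
  define M where "M = 2 * (sewing_const * \<bar>\<omega> 0 T\<bar> + 1)"
  have M: "M > 0" using sewing_const_nonneg by (simp add: M_def add_nonneg_pos)
  define \<epsilon> where "\<epsilon> = (\<eta> / M) powr (1 / (\<theta> - 1))"
  have \<epsilon>: "\<epsilon> powr (\<theta> - 1) = \<eta> / M" and "\<epsilon> > 0"
    using assms M exponent by (simp_all add: \<epsilon>_def powr_powr)
  obtain \<delta> where "\<delta> > 0" and \<delta>: "\<And>s t. 0 \<le> s \<Longrightarrow> s \<le> t \<Longrightarrow> t \<le> T \<Longrightarrow> t - s < \<delta> \<Longrightarrow> \<omega> s t \<le> \<epsilon>"
    using small[OF \<open>\<epsilon> > 0\<close>] less_imp_le by metis
  have "\<bar>partition_sum \<Xi> D - partition_sum \<Xi> E\<bar> \<le> \<eta>"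
    if st: "0 \<le> s" "t \<le> T" and D: "D \<in> partitions s t" "successively (\<lambda>x y. y - x < \<delta>) D"
      and E: "E \<in> partitions s t" "successively (\<lambda>x y. y - x < \<delta>) E" for s t D E
  proof -
    obtain R where R: "R \<in> partitions s t" "set D \<subseteq> set R" "set E \<subseteq> set R"
      using partitions_common_refinement D(1) E(1) by blast
    have *: "\<bar>partition_sum \<Xi> R - partition_sum \<Xi> A\<bar> \<le> \<eta> / 2"
      if A: "A \<in> partitions s t" "successively (\<lambda>x y. y - x < \<delta>) A" "set A \<subseteq> set R" for A
    proof -
      have "\<bar>partition_sum \<Xi> R - partition_sum \<Xi> A\<bar>
          \<le> sewing_const * partition_sum (\<lambda>x y. \<omega> x y powr \<theta>) A"
        using partition_sum_refinement A R(1) st by blast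
      also have "\<dots> \<le> sewing_const * (\<eta> / M * \<omega> s t)"
        using partition_sum_control_powr[OF A(1) st A(2) \<delta>] sewing_const_nonneg
        by (intro mult_left_mono) (simp_all add: \<epsilon>)
      also have "\<dots> \<le> sewing_const * (\<eta> / M * \<bar>\<omega> 0 T\<bar>)"
        using control_mono[of 0 s t T] partitions_le[OF A(1)] st sewing_const_nonneg assms M
        by (intro mult_left_mono) auto
      also have "\<dots> = \<eta> * ((sewing_const * \<bar>\<omega> 0 T\<bar>) / M)" by simp
      also have "\<dots> \<le> \<eta> * (1 / 2)"
        using assms M by (intro mult_left_mono) (simp_all add: M_def field_simps)
      finally show ?thesis by simp
    qed
    show ?thesis using *[OF D R(2)] *[OF E R(3)] by linarith
  qed
  with \<open>\<delta> > 0\<close> show ?thesis using that by blast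
qed

text \<open>The limit is found along one sequence of partitions with mesh tending to 0, whose sums
  are Cauchy; closeness of all fine partitions carries it over to the filter.\<close>

lemma partition_sum_convergent:
  assumes "0 \<le> t" "t \<le> T"
  shows "\<exists>I. (partition_sum \<Xi> \<longlongrightarrow> I) (mesh_filter 0 t)"
proof -
  have "\<forall>n. \<exists>D\<in>partitions 0 t. successively (\<lambda>x y. y - x < 1 / real (Suc n)) D"
    using ex_partition_small_mesh[OF assms(1)] by simp
  then obtain D where D: "\<And>n. D n \<in> partitions 0 t"
      "\<And>n. successively (\<lambda>x y. y - x < 1 / real (Suc n)) (D n)"
    by metis
  have mesh: "\<exists>N. \<forall>n\<ge>N. successively (\<lambda>x y. y - x < \<delta>) (D n)" if "\<delta> > 0" for \<delta>
  proof -
    obtain N where "1 / real (Suc N) < \<delta>" using \<open>\<delta> > 0\<close> nat_approx_posE by blast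
    moreover have "1 / real (Suc n) \<le> 1 / real (Suc N)" if "n \<ge> N" for n
      using that by (simp add: field_simps)
    ultimately have "successively (\<lambda>x y. y - x < \<delta>) (D n)" if "n \<ge> N" for n
      using that by (intro successively_mono[OF D(2)[of n]]) (meson less_le_trans less_trans order_le_less_trans)
    then show ?thesis by blast
  qed
  have "Cauchy (\<lambda>n. partition_sum \<Xi> (D n))"
  proof (rule metric_CauchyI)
    fix e :: real assume "e > 0"
    then obtain \<delta> where \<delta>: "\<delta> > 0" "\<And>s t D E. 0 \<le> s \<Longrightarrow> t \<le> T \<Longrightarrow> D \<in> partitions s t \<Longrightarrow> E \<in> partitions s t \<Longrightarrow>
      successively (\<lambda>x y. y - x < \<delta>) D \<Longrightarrow> successively (\<lambda>x y. y - x < \<delta>) E \<Longrightarrow>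
      \<bar>partition_sum \<Xi> D - partition_sum \<Xi> E\<bar> \<le> e / 2"
      using partition_sums_close[of "e / 2"] by (metis half_gt_zero)
    obtain N where N: "\<forall>n\<ge>N. successively (\<lambda>x y. y - x < \<delta>) (D n)" using mesh[OF \<delta>(1)] by blast
    have "dist (partition_sum \<Xi> (D m)) (partition_sum \<Xi> (D n)) < e" if "m \<ge> N" "n \<ge> N" for m n
      using \<delta>(2)[OF _ assms(2) D(1)[of m] D(1)[of n]] N that \<open>e > 0\<close> by (simp add: dist_real_def)
    then show "\<exists>N. \<forall>m\<ge>N. \<forall>n\<ge>N. dist (partition_sum \<Xi> (D m)) (partition_sum \<Xi> (D n)) < e" by blast
  qed
  then obtain I where I: "(\<lambda>n. partition_sum \<Xi> (D n)) \<longlonglongrightarrow> I"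
    using Cauchy_convergent convergent_def by blast
  have "(partition_sum \<Xi> \<longlongrightarrow> I) (mesh_filter 0 t)"
  proof (rule tendstoI)
    fix e :: real assume "e > 0"
    then obtain \<delta> where \<delta>: "\<delta> > 0" "\<And>s t D E. 0 \<le> s \<Longrightarrow> t \<le> T \<Longrightarrow> D \<in> partitions s t \<Longrightarrow> E \<in> partitions s t \<Longrightarrow>
      successively (\<lambda>x y. y - x < \<delta>) D \<Longrightarrow> successively (\<lambda>x y. y - x < \<delta>) E \<Longrightarrow>
      \<bar>partition_sum \<Xi> D - partition_sum \<Xi> E\<bar> \<le> e / 2"
      using partition_sums_close[of "e / 2"] by (metis half_gt_zero)
    obtain N where N: "\<forall>n\<ge>N. successively (\<lambda>x y. y - x < \<delta>) (D n)" using mesh[OF \<delta>(1)] by blast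
    obtain N' where N': "\<forall>n\<ge>N'. dist (partition_sum \<Xi> (D n)) I < e / 2"
      using I \<open>e > 0\<close> metric_LIMSEQ_D half_gt_zero by blast
    let ?n = "max N N'"
    have "dist (partition_sum \<Xi> E) I < e"
      if "E \<in> partitions 0 t" "successively (\<lambda>x y. y - x < \<delta>) E" for E
    proof -
      have "successively (\<lambda>x y. y - x < \<delta>) (D ?n)" using N by simp
      then have "\<bar>partition_sum \<Xi> E - partition_sum \<Xi> (D ?n)\<bar> \<le> e / 2"
        using \<delta>(2)[OF _ assms(2) that(1) D(1)[of ?n] that(2)] by simp
      moreover have "\<bar>partition_sum \<Xi> (D ?n) - I\<bar> < e / 2"
        using N'[rule_format, of ?n] by (simp add: dist_real_def)
      ultimately show ?thesis unfolding dist_real_def by linarith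
    qed
    then show "\<forall>\<^sub>F E in mesh_filter 0 t. dist (partition_sum \<Xi> E) I < e"
      using \<delta>(1) unfolding eventually_mesh_filter by blast
  qed
  then show ?thesis by blast
qed

definition sewn :: "real \<Rightarrow> real" where
  "sewn t = Lim (mesh_filter 0 t) (partition_sum \<Xi>)"

lemma partition_sum_tendsto_sewn:
  assumes "0 \<le> t" "t \<le> T"
  shows "(partition_sum \<Xi> \<longlongrightarrow> sewn t) (mesh_filter 0 t)"
  using partition_sum_convergent[OF assms] tendsto_Lim[OF mesh_filter_neq_bot[OF assms(1)]]
  unfolding sewn_def by metis

text \<open>Fine partitions of \<open>[0, s]\<close> and \<open>[s, t]\<close> concatenate to a fine
  one of \<open>[0, t]\<close>. The increment of the limit is thus approximated by sums over
  \<open>[s, t]\<close>, which satisfy the bound whatever their mesh.\<close>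

lemma sewn_minus_germ:
  assumes "0 \<le> s" "s \<le> t" "t \<le> T"
  shows "\<bar>sewn t - sewn s - \<Xi> s t\<bar> \<le> sewing_const * \<omega> s t powr \<theta>"
proof (rule field_le_epsilon)
  fix e :: real assume "e > 0"
  then have e: "e / 2 > 0" by simp
  obtain \<delta>\<^sub>1 where \<delta>\<^sub>1: "\<delta>\<^sub>1 > 0" "\<And>D. D \<in> partitions 0 s \<Longrightarrow> successively (\<lambda>x y. y - x < \<delta>\<^sub>1) D
      \<Longrightarrow> dist (partition_sum \<Xi> D) (sewn s) < e / 2"
    using tendstoD[OF partition_sum_tendsto_sewn e, of s] assms
    by (auto simp: eventually_mesh_filter)
  obtain \<delta>\<^sub>2 where \<delta>\<^sub>2: "\<delta>\<^sub>2 > 0" "\<And>D. D \<in> partitions 0 t \<Longrightarrow> successively (\<lambda>x y. y - x < \<delta>\<^sub>2) D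
      \<Longrightarrow> dist (partition_sum \<Xi> D) (sewn t) < e / 2"
    using tendstoD[OF partition_sum_tendsto_sewn e, of t] assms
    by (auto simp: eventually_mesh_filter)
  define \<delta> where "\<delta> = min \<delta>\<^sub>1 \<delta>\<^sub>2"
  have "\<delta> > 0" using \<delta>\<^sub>1 \<delta>\<^sub>2 by (simp add: \<delta>_def)
  obtain D E where D: "D \<in> partitions 0 s" "successively (\<lambda>x y. y - x < \<delta>) D"
    and E: "E \<in> partitions s t" "successively (\<lambda>x y. y - x < \<delta>) E"
    using ex_partition_small_mesh \<open>\<delta> > 0\<close> assms by meson
  obtain xs ys where xs: "D = xs @ [s]" "E = s # ys" "xs @ s # ys \<in> partitions 0 t"
    using partitions_concat[OF D(1) E(1)] by blast
  have "successively (\<lambda>x y. y - x < \<delta>) (xs @ s # ys)"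
    using D(2) E(2) xs(1,2) by (auto simp: successively_append_iff successively_Cons)
  then have "dist (partition_sum \<Xi> (xs @ s # ys)) (sewn t) < e / 2"
    by (intro \<delta>\<^sub>2(2) xs) (rule successively_mono, assumption, simp add: \<delta>_def)
  moreover have "dist (partition_sum \<Xi> D) (sewn s) < e / 2"
    by (intro \<delta>\<^sub>1(2) D(1) successively_mono[OF D(2)]) (simp add: \<delta>_def)
  moreover have "partition_sum \<Xi> (xs @ s # ys) = partition_sum \<Xi> D + partition_sum \<Xi> E"
    using partition_sum_append[of \<Xi> xs s ys] xs by simp
  moreover have "\<bar>partition_sum \<Xi> E - \<Xi> s t\<bar> \<le> sewing_const * \<omega> s t powr \<theta>"
    using partition_sum_minus_germ E(1) assms by blast
  ultimately show "\<bar>sewn t - sewn s - \<Xi> s t\<bar> \<le> sewing_const * \<omega> s t powr \<theta> + e"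
    unfolding dist_real_def by linarith
qed

lemma sewn_0: "0 \<le> T \<Longrightarrow> sewn 0 = 0"
proof -
  assume "0 \<le> T"
  have "\<forall>\<^sub>F D in mesh_filter 0 0. partition_sum \<Xi> D = 0"
    unfolding eventually_mesh_filter by (auto simp: partitions_same_iff intro: zero_less_one)
  then have "(partition_sum \<Xi> \<longlongrightarrow> 0) (mesh_filter 0 0)" by (rule tendsto_eventually)
  then show ?thesis
    using tendsto_unique[OF mesh_filter_neq_bot partition_sum_tendsto_sewn] \<open>0 \<le> T\<close> by blast
qed

end


section \<open>The control of a branched rough path\<close>

lemma continuous_on_MAX:
  fixes f :: "'i \<Rightarrow> 'a::topological_space \<Rightarrow> real"
  assumes "finite I" "I \<noteq> {}" "\<And>i. i \<in> I \<Longrightarrow> continuous_on S (f i)"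
  shows "continuous_on S (\<lambda>x. MAX i\<in>I. f i x)"
  using assms
proof (induction I rule: finite_ne_induct)
  case (insert i I)
  then have "(\<lambda>x. MAX i\<in>insert i I. f i x) = (\<lambda>x. max (f i x) (MAX i\<in>I. f i x))"
    by auto
  then show ?case using insert by (auto intro!: continuous_on_max)
qed simp

lemma character_norm_nonneg:
  assumes "d \<ge> 1" "n \<ge> 1"
  shows "0 \<le> character_norm d n a"
proof -
  obtain \<rho> where "\<rho> \<in> forests_upto d n" using forests_upto_nonempty[OF assms] by blast
  then have "\<bar>a \<rho>\<bar> powr (1 / forest_degree \<rho>) \<le> character_norm d n a"
    unfolding character_norm_def by (intro Max_ge) auto
  moreover have "0 \<le> \<bar>a \<rho>\<bar> powr (1 / forest_degree \<rho>)" by simp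
  ultimately show ?thesis by linarith
qed

lemma abs_le_character_norm_power:
  assumes "\<rho> \<in> forests_upto d n"
  shows "\<bar>a \<rho>\<bar> \<le> character_norm d n a ^ forest_degree \<rho>"
proof -
  have deg: "forest_degree \<rho> \<ge> 1" using assms by (simp add: forests_upto_def)
  have "\<bar>a \<rho>\<bar> powr (1 / forest_degree \<rho>) \<le> character_norm d n a"
    unfolding character_norm_def using assms by (intro Max_ge) auto
  then have "(\<bar>a \<rho>\<bar> powr (1 / forest_degree \<rho>)) ^ forest_degree \<rho> \<le> character_norm d n a ^ forest_degree \<rho>"
    by (intro power_mono) auto
  moreover have "(\<bar>a \<rho>\<bar> powr (1 / forest_degree \<rho>)) ^ forest_degree \<rho> = \<bar>a \<rho>\<bar>"
    using deg by (cases "a \<rho> = 0") (auto simp: powr_powr simp flip: powr_realpow)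
  ultimately show ?thesis by simp
qed

lemma character_norm_one:
  assumes "d \<ge> 1" "n \<ge> 1"
  shows "character_norm d n \<one>\<^bsub>character_group d n\<^esub> = 0"
proof -
  have "\<bar>\<one>\<^bsub>character_group d n\<^esub> \<rho>\<bar> powr (1 / forest_degree \<rho>) = 0" if "\<rho> \<in> forests_upto d n" for \<rho>
  proof -
    have "\<rho> \<noteq> {#}" using that by auto
    then show ?thesis by (simp add: character_one_eq)
  qed
  then have "(\<lambda>\<rho>. \<bar>\<one>\<^bsub>character_group d n\<^esub> \<rho>\<bar> powr (1 / forest_degree \<rho>)) ` forests_upto d n
      = (\<lambda>\<rho>. 0) ` forests_upto d n" by (intro image_cong) auto
  then show ?thesis
    using forests_upto_nonempty[OF assms] by (simp add: character_norm_def)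
qed

locale rough_path =
  fixes d :: nat and p T :: real and X :: "real \<Rightarrow> forest \<Rightarrow> real"
  assumes p_ge_1: "p \<ge> 1" and d_ge_1: "d \<ge> 1" and T_pos: "T > 0"
    and rough_path: "branched_rough_path d p T X"
begin

abbreviation G where "G \<equiv> character_group d (trunc p)"
abbreviation inc where "inc \<equiv> increment d (trunc p) X"
abbreviation \<omega> where "\<omega> \<equiv> control d p X"

lemma trunc_ge_1: "trunc p \<ge> 1"
  using p_ge_1 by (simp add: le_nat_floor)

lemma trunc_le: "real (trunc p) \<le> p"
  using p_ge_1 by (simp add: of_nat_nat)

sublocale group G
  by (rule group_character_group)

lemma X_closed: "0 \<le> s \<Longrightarrow> s \<le> T \<Longrightarrow> X s \<in> carrier G"
  using rough_path by (auto simp: branched_rough_path_def)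

lemma inc_closed: "0 \<le> s \<Longrightarrow> s \<le> T \<Longrightarrow> 0 \<le> t \<Longrightarrow> t \<le> T \<Longrightarrow> inc s t \<in> carrier G"
  by (simp add: increment_def X_closed)

lemma inc_same: "0 \<le> s \<Longrightarrow> s \<le> T \<Longrightarrow> inc s s = \<one>\<^bsub>G\<^esub>"
  by (simp add: increment_def X_closed)

lemma inc_mult:
  assumes "0 \<le> s" "s \<le> T" "0 \<le> u" "u \<le> T" "0 \<le> t" "t \<le> T"
  shows "inc s u \<otimes>\<^bsub>G\<^esub> inc u t = inc s t"
proof -
  have "X u \<otimes>\<^bsub>G\<^esub> (inv\<^bsub>G\<^esub> X u \<otimes>\<^bsub>G\<^esub> X t) = X t"
    using assms by (simp add: X_closed flip: m_assoc)
  then show ?thesis using assms by (simp add: increment_def X_closed m_assoc)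
qed

section \<open>The variation of increments and its supremum over partitions\<close>

definition variation where "variation s t = character_norm d (trunc p) (inc s t) powr p"

lemma variation_nonneg: "0 \<le> variation s t"
  by (simp add: variation_def)

lemma variation_same: "0 \<le> s \<Longrightarrow> s \<le> T \<Longrightarrow> variation s s = 0"
  using character_norm_one[OF d_ge_1 trunc_ge_1] by (simp add: variation_def inc_same)

text \<open>Coordinates of increments are sums of products of continuous coordinates of
  \<open>inv X\<close> and \<open>X\<close>; the exponents are positive, so roots and powers stay
  continuous at 0.\<close>

lemma continuous_on_variation:
  "continuous_on ({0..T} \<times> {0..T}) (\<lambda>z. variation (fst z) (snd z))"
proof -
  have X: "continuous_on {0..T} (\<lambda>s. X s \<rho>)" for \<rho>
    using rough_path continuous_on_product_then_coordinatewise
    by (auto simp: branched_rough_path_def)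
  have inv: "continuous_on {0..T} (\<lambda>s. (inv\<^bsub>G\<^esub> X s) \<rho>)" for \<rho>
    using X_closed X by (intro continuous_on_character_inverse) auto
  have prod: "continuous_on ({0..T} \<times> {0..T}) (\<lambda>z. inc (fst z) (snd z) \<rho>)" for \<rho>
    unfolding increment_def character_mult_eq case_prod_unfold
    by (cases "\<rho> \<in> forests d \<and> forest_degree \<rho> \<le> trunc p")
      (simp_all, auto intro!: continuous_intros continuous_on_compose2[OF X] continuous_on_compose2[OF inv])
  have "continuous_on ({0..T} \<times> {0..T})
      (\<lambda>z. \<bar>inc (fst z) (snd z) \<rho>\<bar> powr (1 / forest_degree \<rho>))"
    if "\<rho> \<in> forests_upto d (trunc p)" for \<rho>
  proof -
    have "forest_degree \<rho> \<ge> 1" using that by (simp add: forests_upto_def)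
    then show ?thesis by (intro continuous_on_powr' continuous_intros prod) auto
  qed
  then have "continuous_on ({0..T} \<times> {0..T}) (\<lambda>z. character_norm d (trunc p) (inc (fst z) (snd z)))"
    unfolding character_norm_def
    by (intro continuous_on_MAX finite_forests_upto forests_upto_nonempty d_ge_1 trunc_ge_1)
  then show ?thesis
    unfolding variation_def using p_ge_1 character_norm_nonneg[OF d_ge_1 trunc_ge_1]
    by (intro continuous_on_powr' continuous_intros) auto
qed

lemma p_variation_eq:
  "p_variation d p X s t = (SUP D\<in>partitions s t. ennreal (partition_sum variation D powr (1 / p)))"
  unfolding p_variation_def variation_def[symmetric]
    sum_consecutive_eq_partition_sum[of variation] ..

lemma partition_sum_le_p_variation:
  assumes "p_variation d p X s t < \<infinity>" "D \<in> partitions s t"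
  shows "partition_sum variation D \<le> \<omega> s t"
proof -
  have "ennreal (partition_sum variation D powr (1 / p)) \<le> p_variation d p X s t"
    unfolding p_variation_eq using assms(2) by (rule SUP_upper)
  also have "\<dots> = ennreal (enn2real (p_variation d p X s t))"
    using assms(1) by (simp add: infinity_ennreal_def)
  finally have "partition_sum variation D powr (1 / p) \<le> enn2real (p_variation d p X s t)"
    by (simp add: ennreal_le_iff)
  then have "(partition_sum variation D powr (1 / p)) powr p \<le> \<omega> s t"
    unfolding control_def using p_ge_1 by (intro powr_mono2) auto
  moreover have "0 \<le> partition_sum variation D"
    by (intro partition_sum_nonneg variation_nonneg)
  ultimately show ?thesis using p_ge_1 by (simp add: powr_powr powr_one')
qed

lemma p_variation_le:
  assumes "\<And>D. D \<in> partitions s t \<Longrightarrow> partition_sum variation D \<le> C"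
  shows "p_variation d p X s t \<le> ennreal (C powr (1 / p))"
  unfolding p_variation_eq using assms p_ge_1 partition_sum_nonneg[of variation] variation_nonneg
  by (intro SUP_least ennreal_leI powr_mono2) auto

lemma control_leI:
  assumes "\<And>D. D \<in> partitions s t \<Longrightarrow> partition_sum variation D \<le> C" "0 \<le> C"
  shows "\<omega> s t \<le> C"
proof -
  have "enn2real (p_variation d p X s t) \<le> C powr (1 / p)"
    using p_variation_le[OF assms(1)] by (intro enn2real_leI) auto
  then have "\<omega> s t \<le> (C powr (1 / p)) powr p"
    unfolding control_def using p_ge_1 by (intro powr_mono2) auto
  then show ?thesis using assms(2) p_ge_1 by (simp add: powr_powr powr_one')
qed

lemma ex_partition: "s \<le> t \<Longrightarrow> \<exists>D. D \<in> partitions (s::real) t"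
  using ex_partition_small_mesh[of s t 1] by auto

text \<open>A partition of \<open>[s, t]\<close> extends to one of \<open>[0, T]\<close>, and the
  added terms are nonnegative. Finiteness matters because \<open>enn2real\<close> sends infinity to
  0, which would make \<omega> meaningless.\<close>

lemma p_variation_finite:
  assumes "0 \<le> s" "s \<le> t" "t \<le> T"
  shows "p_variation d p X s t < \<infinity>"
proof -
  have fin: "p_variation d p X 0 T < \<infinity>" using rough_path by (simp add: branched_rough_path_def)
  have "partition_sum variation D \<le> \<omega> 0 T" if D: "D \<in> partitions s t" for D
  proof -
    obtain A B where A: "A \<in> partitions 0 s" and B: "B \<in> partitions t T"
      using ex_partition assms by meson
    obtain as ds where 1: "A = as @ [s]" "D = s # ds" "as @ s # ds \<in> partitions 0 t"
      using partitions_concat[OF A D] by blast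
    obtain ads bs where 2: "as @ s # ds = ads @ [t]" "B = t # bs" "ads @ t # bs \<in> partitions 0 T"
      using partitions_concat[OF 1(3) B] by blast
    have "partition_sum variation (ads @ t # bs)
        = partition_sum variation A + partition_sum variation D + partition_sum variation B"
      using partition_sum_append[of variation ads t bs] partition_sum_append[of variation as s ds] 1 2
      by simp
    moreover have "partition_sum variation (ads @ t # bs) \<le> \<omega> 0 T"
      using partition_sum_le_p_variation[OF fin 2(3)] .
    ultimately show ?thesis
      using partition_sum_nonneg[of variation A] partition_sum_nonneg[of variation B] variation_nonneg
      by fastforce
  qed
  then have "p_variation d p X s t \<le> ennreal (\<omega> 0 T powr (1 / p))" by (rule p_variation_le)
  then show ?thesis by (simp add: order_le_less_trans)
qed

lemma partition_sum_le_control: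
  "0 \<le> s \<Longrightarrow> t \<le> T \<Longrightarrow> D \<in> partitions s t \<Longrightarrow> partition_sum variation D \<le> \<omega> s t"
  using partition_sum_le_p_variation p_variation_finite partitions_le by blast

lemma control_nonneg: "0 \<le> \<omega> s t"
  by (simp add: control_def)

text \<open>Partitions of the two intervals concatenate; the suprema are then taken one after the
  other.\<close>

lemma control_superadditive:
  assumes "0 \<le> s" "s \<le> u" "u \<le> t" "t \<le> T"
  shows "\<omega> s u + \<omega> u t \<le> \<omega> s t"
proof -
  have *: "partition_sum variation D + partition_sum variation E \<le> \<omega> s t"
    if D: "D \<in> partitions s u" and E: "E \<in> partitions u t" for D E
  proof -
    obtain xs ys where 1: "D = xs @ [u]" "E = u # ys" "xs @ u # ys \<in> partitions s t"
      using partitions_concat[OF D E] by blast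
    then show ?thesis
      using partition_sum_le_control[OF assms(1,4) 1(3)] partition_sum_append[of variation xs u ys] by simp
  qed
  have nonneg: "0 \<le> partition_sum variation D" for D
    by (intro partition_sum_nonneg variation_nonneg)
  obtain D\<^sub>0 where D\<^sub>0: "D\<^sub>0 \<in> partitions s u" using ex_partition assms by blast
  \<comment> \<open>\<open>D\<^sub>0\<close> shows that the bound is nonnegative, the side condition
    of \<open>control_leI\<close>.\<close>
  have "\<omega> s u \<le> \<omega> s t - partition_sum variation E" if "E \<in> partitions u t" for E
    using *[OF _ that] *[OF D\<^sub>0 that] nonneg[of D\<^sub>0] by (intro control_leI) (auto simp: algebra_simps)
  then have "partition_sum variation E \<le> \<omega> s t - \<omega> s u" if "E \<in> partitions u t" for E
    using that by (simp add: algebra_simps)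
  moreover obtain E\<^sub>0 where "E\<^sub>0 \<in> partitions u t" using ex_partition assms by blast
  ultimately have "\<omega> u t \<le> \<omega> s t - \<omega> s u"
    using nonneg[of E\<^sub>0] by (intro control_leI) (blast, meson order_trans)
  then show ?thesis by simp
qed

lemma control_mono:
  assumes "0 \<le> s" "s \<le> u" "u \<le> v" "v \<le> t" "t \<le> T"
  shows "\<omega> u v \<le> \<omega> s t"
  using control_superadditive[of s u t] control_superadditive[of u v t]
    control_nonneg[of s u] control_nonneg[of v t] assms by linarith

lemma control_same: "0 \<le> s \<Longrightarrow> s \<le> T \<Longrightarrow> \<omega> s s = 0"
  using control_superadditive[of s s s] control_nonneg[of s s] by simp

lemma variation_le_control:
  assumes "0 \<le> s" "s \<le> t" "t \<le> T"
  shows "variation s t \<le> \<omega> s t"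
proof (cases "s = t")
  case True
  then show ?thesis using assms variation_same control_nonneg by simp
next
  case False
  then show ?thesis
    using partition_sum_le_control[of s t "[s, t]"] assms by (simp add: partitions_Cons_Cons_iff)
qed

text \<open>Valid for every forest: for the empty one both sides are 1, and outside the truncation
  the left side is 0. Contractions can therefore be estimated term by term.\<close>

lemma abs_inc_le:
  assumes "0 \<le> s" "s \<le> t" "t \<le> T"
  shows "\<bar>inc s t \<rho>\<bar> \<le> (\<omega> s t powr (1 / p)) ^ forest_degree \<rho>"
proof (cases "\<rho> \<in> forests_upto d (trunc p)")
  case True
  have 0: "0 \<le> character_norm d (trunc p) (inc s t)"
    by (intro character_norm_nonneg d_ge_1 trunc_ge_1)
  have "(character_norm d (trunc p) (inc s t) powr p) powr (1 / p) \<le> \<omega> s t powr (1 / p)"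
    using variation_le_control[OF assms] p_ge_1 unfolding variation_def by (intro powr_mono2) auto
  then have "character_norm d (trunc p) (inc s t) \<le> \<omega> s t powr (1 / p)"
    using 0 p_ge_1 by (simp add: powr_powr powr_one')
  then show ?thesis
    using abs_le_character_norm_power[OF True, of "inc s t"] 0 power_mono
    by (meson order_trans)
next
  case False
  have inc: "inc s t \<in> carrier G" using assms by (intro inc_closed) auto
  show ?thesis
  proof (cases "\<rho> = {#}")
    case True
    then show ?thesis using character_empty[OF inc] by simp
  next
    case ne: False
    then have "\<not> (\<rho> \<in> forests d \<and> forest_degree \<rho> \<le> trunc p)"
      using False forests_degree_le_eq[of d "trunc p"] by blast
    then show ?thesis using character_eq_0[OF inc] by simp
  qed
qed

text \<open>Moving the first (last) point of a nearly optimal partition of \<open>[u, T]\<close> (of \<open>[0, u]\<close>)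
  slightly inwards loses little variation; by superadditivity little is left near \<open>u\<close>.\<close>

lemma control_small_right:
  assumes "0 \<le> u" "u < T" "\<epsilon> > 0"
  shows "\<exists>v>u. v \<le> T \<and> \<omega> u v < \<epsilon>"
proof (cases "\<omega> u T < \<epsilon>")
  case True
  then show ?thesis using assms by blast
next
  case False
  have "\<exists>D\<in>partitions u T. partition_sum variation D > \<omega> u T - \<epsilon> / 2"
  proof (rule ccontr)
    assume "\<not> ?thesis"
    \<comment> \<open>The case assumption \<omega> u T \<ge> \<epsilon> makes this bound
      nonnegative, as \<open>control_leI\<close> requires.\<close>
    then have "\<omega> u T \<le> \<omega> u T - \<epsilon> / 2" using False assms by (intro control_leI) auto
    then show False using assms by simp
  qed
  then obtain D where D: "D \<in> partitions u T" "partition_sum variation D > \<omega> u T - \<epsilon> / 2" by blast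
  then obtain y zs where Dy: "D = u # y # zs" "u < y" "y # zs \<in> partitions y T"
    using assms by (cases D; cases "tl D") (auto simp: partitions_Cons_Cons_iff partitions_def)
  have y: "y \<le> T" using partitions_le[OF Dy(3)] .
  have "continuous_on {0..T} (\<lambda>s. variation s y)"
    using continuous_on_compose2[OF continuous_on_variation, of "{0..T}" "\<lambda>s. (s, y)"] assms Dy(2) y
    by (simp add: continuous_on_Pair image_subset_iff)
  then obtain \<delta> where \<delta>: "\<delta> > 0" "\<And>s. s \<in> {0..T} \<Longrightarrow> dist s u < \<delta> \<Longrightarrow> dist (variation s y) (variation u y) < \<epsilon> / 2"
    using assms unfolding continuous_on_iff by (metis atLeastAtMost_iff half_gt_zero less_imp_le)
  define v where "v = min ((u + y) / 2) (u + \<delta> / 2)"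
  have v: "u < v" "v < y" "v < u + \<delta>" using \<delta>(1) Dy(2) by (auto simp: v_def min_def field_simps)
  then have "dist (variation v y) (variation u y) < \<epsilon> / 2"
    using assms y by (intro \<delta>(2)) (auto simp: dist_real_def)
  moreover have "v # y # zs \<in> partitions v T" using v Dy(3) by (simp add: partitions_Cons_Cons_iff)
  then have "partition_sum variation (v # y # zs) \<le> \<omega> v T"
    using assms v by (intro partition_sum_le_control) auto
  \<comment> \<open>One half of \<epsilon> is lost to the near-optimality of \<open>D\<close>, the
    other to moving \<open>u\<close> to \<open>v\<close>.\<close>
  ultimately have "\<omega> v T > \<omega> u T - \<epsilon>"
    using D(2) unfolding Dy(1) dist_real_def partition_sum.simps by linarith
  then have "\<omega> u v < \<epsilon>" using control_superadditive[of u v T] assms v y by auto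
  then show ?thesis using v y by (intro exI[of _ v]) auto
qed

lemma control_small_left:
  assumes "0 < u" "u \<le> T" "\<epsilon> > 0"
  shows "\<exists>v<u. 0 \<le> v \<and> \<omega> v u < \<epsilon>"
proof (cases "\<omega> 0 u < \<epsilon>")
  case True
  then show ?thesis using assms by blast
next
  case False
  have "\<exists>D\<in>partitions 0 u. partition_sum variation D > \<omega> 0 u - \<epsilon> / 2"
  proof (rule ccontr)
    assume "\<not> ?thesis"
    then have "\<omega> 0 u \<le> \<omega> 0 u - \<epsilon> / 2" using False assms by (intro control_leI) auto
    then show False using assms by simp
  qed
  then obtain D where D: "D \<in> partitions 0 u" "partition_sum variation D > \<omega> 0 u - \<epsilon> / 2" by blast
  then obtain zs y where "D = zs @ [y] @ [u]"
    using assms by (cases D rule: rev_cases; cases "butlast D" rule: rev_cases) (auto simp: partitions_def)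
  then have Dy: "D = zs @ y # [u]" "zs @ [y] \<in> partitions 0 y" "y < u"
    using D(1) partitions_append_iff[of zs y "[u]"] by (auto simp: partitions_Cons_Cons_iff)
  have y: "0 \<le> y" using partitions_le[OF Dy(2)] .
  have "continuous_on {0..T} (\<lambda>s. variation y s)"
    using continuous_on_compose2[OF continuous_on_variation, of "{0..T}" "\<lambda>s. (y, s)"] assms Dy(3) y
    by (simp add: continuous_on_Pair image_subset_iff)
  then obtain \<delta> where \<delta>: "\<delta> > 0" "\<And>s. s \<in> {0..T} \<Longrightarrow> dist s u < \<delta> \<Longrightarrow> dist (variation y s) (variation y u) < \<epsilon> / 2"
    using assms unfolding continuous_on_iff by (metis atLeastAtMost_iff half_gt_zero less_imp_le)
  define v where "v = max ((u + y) / 2) (u - \<delta> / 2)"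
  have v: "v < u" "y < v" "u - \<delta> < v" using \<delta>(1) Dy(3) by (auto simp: v_def max_def field_simps)
  then have "dist (variation y v) (variation y u) < \<epsilon> / 2"
    using assms y by (intro \<delta>(2)) (auto simp: dist_real_def)
  moreover have "zs @ y # [v] \<in> partitions 0 v" 
    using v Dy(2) partitions_append_iff[of zs y "[v]"] by (simp add: partitions_Cons_Cons_iff)
  then have "partition_sum variation (zs @ y # [v]) \<le> \<omega> 0 v"
    using assms v by (intro partition_sum_le_control) auto
  ultimately have "\<omega> 0 v > \<omega> 0 u - \<epsilon>"
    using D(2) Dy(1) partition_sum_append[of variation zs y "[v]"] partition_sum_append[of variation zs y "[u]"]
    unfolding Dy(1) dist_real_def partition_sum.simps by linarith
  then have "\<omega> v u < \<epsilon>" using control_superadditive[of 0 v u] assms v y by auto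
  then show ?thesis using v y by (intro exI[of _ v]) auto
qed

text \<open>Exactly one interval of a partition starts at or before \<open>u\<close> and ends after
  it. Its variation is at most \<open>M\<close>; the others are counted by the controls on either
  side of \<open>u\<close>.\<close>

lemma control_straddle:
  assumes "0 \<le> s" "s \<le> u" "u < t" "t \<le> T" "0 \<le> M"
    and M: "\<And>a b. s \<le> a \<Longrightarrow> a \<le> u \<Longrightarrow> u \<le> b \<Longrightarrow> b \<le> t \<Longrightarrow> variation a b \<le> M"
  shows "\<omega> s t \<le> \<omega> s u + \<omega> u t + M"
proof (rule control_leI)
  fix D assume D: "D \<in> partitions s t"
  have "s \<in> set D" using partitions_endpoints D by blast
  then obtain ys a zs where Da: "D = ys @ a # zs" "a \<le> u" "\<forall>z\<in>set zs. \<not> z \<le> u"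
    using split_list_last_prop[of D "\<lambda>x. x \<le> u"] assms(2) by blast
  have "zs \<noteq> []" using D Da(1,2) assms(3) by (auto simp: partitions_def)
  then obtain b B where zs: "zs = b # B" by (cases zs) auto
  have L: "ys @ [a] \<in> partitions s a" and R: "a # b # B \<in> partitions a t"
    using D Da(1) zs partitions_append_iff by blast+
  then have R': "b # B \<in> partitions b t" by (simp add: partitions_Cons_Cons_iff)
  have b: "u < b" using Da(3) zs by auto
  have ab: "s \<le> a" "b \<le> t" using partitions_le[OF L] partitions_le[OF R'] by auto
  have "partition_sum variation D
      = partition_sum variation (ys @ [a]) + variation a b + partition_sum variation (b # B)"
    using partition_sum_append[of variation ys a zs] Da(1) zs by (simp add: add.assoc)
  moreover have "partition_sum variation (ys @ [a]) \<le> \<omega> s u"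
    using partition_sum_le_control[OF _ _ L] control_mono[of s s a u] Da(2) ab assms by force
  moreover have "partition_sum variation (b # B) \<le> \<omega> u t"
    using partition_sum_le_control[OF _ _ R'] control_mono[of u b t t] b ab assms by force
  moreover have "variation a b \<le> M" using M Da(2) ab b by simp
  ultimately show "partition_sum variation D \<le> \<omega> s u + \<omega> u t + M" by linarith
qed (use assms control_nonneg in auto)

text \<open>One-sided smallness at \<open>u\<close> says nothing about increments across
  \<open>u\<close>; these are small by joint continuity of the variation at \<open>(u, u)\<close>,
  where it vanishes. Each contribution takes a third of \<epsilon>.\<close>

lemma control_small_near:
  assumes u: "0 \<le> u" "u \<le> T" and "\<epsilon> > 0"
  shows "\<exists>\<delta>>0. \<forall>s t. 0 \<le> s \<and> s \<le> t \<and> t \<le> T \<and> dist u s < \<delta> \<and> dist u t < \<delta> \<longrightarrow> \<omega> s t < \<epsilon>"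
proof -
  have "\<exists>\<delta>>0. \<forall>t. u \<le> t \<and> t \<le> T \<and> t < u + \<delta> \<longrightarrow> \<omega> u t < \<epsilon> / 3"
  proof (cases "u = T")
    case True
    then show ?thesis using assms control_same by (intro exI[of _ 1]) auto
  next
    case False
    then obtain v where v: "v > u" "v \<le> T" "\<omega> u v < \<epsilon> / 3"
      using control_small_right[of u "\<epsilon> / 3"] assms by auto
    have "\<omega> u t < \<epsilon> / 3" if "u \<le> t" "t \<le> T" "t < u + (v - u)" for t
      using control_mono[of u u t v] that v assms by auto
    then show ?thesis using v(1) by (intro exI[of _ "v - u"]) auto
  qed
  then obtain \<delta>\<^sub>1 where \<delta>\<^sub>1: "\<delta>\<^sub>1 > 0" "\<And>t. u \<le> t \<Longrightarrow> t \<le> T \<Longrightarrow> t < u + \<delta>\<^sub>1 \<Longrightarrow> \<omega> u t < \<epsilon> / 3" by blast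
  have "\<exists>\<delta>>0. \<forall>s. 0 \<le> s \<and> s \<le> u \<and> u - \<delta> < s \<longrightarrow> \<omega> s u < \<epsilon> / 3"
  proof (cases "u = 0")
    case True
    then show ?thesis using assms control_same by (intro exI[of _ 1]) auto
  next
    case False
    then obtain v where v: "v < u" "0 \<le> v" "\<omega> v u < \<epsilon> / 3"
      using control_small_left[of u "\<epsilon> / 3"] assms by auto
    have "\<omega> s u < \<epsilon> / 3" if "0 \<le> s" "s \<le> u" "u - (u - v) < s" for s
      using control_mono[of v s u u] that v assms by auto
    then show ?thesis using v(1) by (intro exI[of _ "u - v"]) auto
  qed
  then obtain \<delta>\<^sub>2 where \<delta>\<^sub>2: "\<delta>\<^sub>2 > 0" "\<And>s. 0 \<le> s \<Longrightarrow> s \<le> u \<Longrightarrow> u - \<delta>\<^sub>2 < s \<Longrightarrow> \<omega> s u < \<epsilon> / 3" by blast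
  have "(u, u) \<in> {0..T} \<times> {0..T}" "\<epsilon> / 3 > 0" using assms by auto
  then obtain \<delta>\<^sub>3 where \<delta>\<^sub>3: "\<delta>\<^sub>3 > 0" "\<And>z. z \<in> {0..T} \<times> {0..T} \<Longrightarrow> dist z (u, u) < \<delta>\<^sub>3 \<Longrightarrow>
      dist (variation (fst z) (snd z)) (variation u u) < \<epsilon> / 3"
    using continuous_on_variation unfolding continuous_on_iff by fastforce
  \<comment> \<open>Half of \<open>\<delta>\<^sub>3\<close>, because the distance of two pairs is at
    most the sum of the coordinate distances.\<close>
  define \<delta> where "\<delta> = min (min \<delta>\<^sub>1 \<delta>\<^sub>2) (\<delta>\<^sub>3 / 2)"
  have "\<omega> s t < \<epsilon>" if st: "0 \<le> s" "s \<le> t" "t \<le> T" and dist: "dist u s < \<delta>" "dist u t < \<delta>" for s t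
  proof -
    have dist': "\<bar>u - s\<bar> < \<delta>\<^sub>1" "\<bar>u - t\<bar> < \<delta>\<^sub>1" "\<bar>u - s\<bar> < \<delta>\<^sub>2" "\<bar>u - t\<bar> < \<delta>\<^sub>2"
        "\<bar>u - s\<bar> < \<delta>\<^sub>3 / 2" "\<bar>u - t\<bar> < \<delta>\<^sub>3 / 2"
      using dist by (auto simp: \<delta>_def dist_real_def)
    consider "u \<le> s" | "t \<le> u" | "s \<le> u" "u < t" by linarith
    then show ?thesis
    proof cases
      case 1
      then show ?thesis using control_mono[of u s t t] \<delta>\<^sub>1(2)[of t] st u dist' \<open>\<epsilon> > 0\<close> by auto
    next
      case 2
      then show ?thesis using control_mono[of s s t u] \<delta>\<^sub>2(2)[of s] st u dist' \<open>\<epsilon> > 0\<close> by auto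
    next
      case 3
      have "variation a b \<le> \<epsilon> / 3" if ab: "s \<le> a" "a \<le> u" "u \<le> b" "b \<le> t" for a b
      proof -
        have "dist (a, b) (u, u) \<le> \<bar>a - u\<bar> + \<bar>b - u\<bar>"
          unfolding dist_Pair_Pair dist_real_def using sqrt_sum_squares_le_sum_abs[of "a - u" "b - u"] by simp
        then have "dist (a, b) (u, u) < \<delta>\<^sub>3" using ab dist' by linarith
        then show ?thesis using \<delta>\<^sub>3(2)[of "(a, b)"] ab st u
          by (auto simp: dist_real_def variation_same)
      qed
      then have "\<omega> s t \<le> \<omega> s u + \<omega> u t + \<epsilon> / 3"
        using control_straddle[of s u t "\<epsilon> / 3"] 3 st \<open>\<epsilon> > 0\<close> by auto
      then show ?thesis using \<delta>\<^sub>1(2)[of t] \<delta>\<^sub>2(2)[of s] 3 st dist' by auto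
    qed
  qed
  then show ?thesis using \<delta>\<^sub>1(1) \<delta>\<^sub>2(1) \<delta>\<^sub>3(1) by (intro exI[of _ \<delta>]) (auto simp: \<delta>_def)
qed

text \<open>Compactness: a Lebesgue number of the cover of \<open>[0, T]\<close> by the balls from
  \<open>control_small_near\<close>.\<close>

lemma control_small:
  assumes "\<epsilon> > 0"
  shows "\<exists>\<delta>>0. \<forall>s t. 0 \<le> s \<and> s \<le> t \<and> t \<le> T \<and> t - s < \<delta> \<longrightarrow> \<omega> s t < \<epsilon>"
proof -
  obtain r where r: "\<And>u. u \<in> {0..T} \<Longrightarrow> r u > 0"
    "\<And>u s t. u \<in> {0..T} \<Longrightarrow> 0 \<le> s \<Longrightarrow> s \<le> t \<Longrightarrow> t \<le> T \<Longrightarrow> dist u s < r u \<Longrightarrow> dist u t < r u \<Longrightarrow> \<omega> s t < \<epsilon>"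
    using control_small_near[OF _ _ assms] by (metis atLeastAtMost_iff)
  have "{0..T} \<subseteq> \<Union> ((\<lambda>u. ball u (r u)) ` {0..T})" using r(1) by force
  then obtain e where e: "e > 0" "\<And>s. s \<in> {0..T} \<Longrightarrow> \<exists>B\<in>(\<lambda>u. ball u (r u)) ` {0..T}. ball s e \<subseteq> B"
    by (rule Heine_Borel_lemma[rotated]) auto
  have "\<omega> s t < \<epsilon>" if st: "0 \<le> s" "s \<le> t" "t \<le> T" "t - s < e" for s t
  proof -
    obtain u where u: "u \<in> {0..T}" "ball s e \<subseteq> ball u (r u)" using e(2)[of s] st by auto
    have "s \<in> ball s e" "t \<in> ball s e" using e(1) st by (auto simp: dist_real_def)
    then have "dist u s < r u" "dist u t < r u" using u(2) by (auto simp: subset_iff)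
    then show ?thesis using r(2)[OF u(1) st(1-3)] by blast
  qed
  then show ?thesis using e(1) by blast
qed

end


section \<open>Translation and product in coordinates\<close>

lemma sum_sum_mset_swap:
  fixes f :: "'i \<Rightarrow> 'j \<Rightarrow> 'a::comm_monoid_add"
  shows "(\<Sum>j\<in>A. \<Sum>i\<in>#M. f i j) = (\<Sum>i\<in>#M. \<Sum>j\<in>A. f i j)"
  by (induction M) (simp_all add: sum.distrib)

lemma abs_sum_mset_le:
  fixes f :: "'i \<Rightarrow> real" and C :: real
  shows "(\<And>i. i \<in># M \<Longrightarrow> \<bar>f i\<bar> \<le> C) \<Longrightarrow> \<bar>\<Sum>i\<in>#M. f i\<bar> \<le> real (size M) * C"
proof (induction M)
  case (add i M)
  have "\<bar>f i\<bar> \<le> C" "\<bar>\<Sum>i\<in>#M. f i\<bar> \<le> real (size M) * C" using add by auto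
  then show ?case by (simp add: distrib_right)
qed simp

text \<open>The coefficient of \<sigma> in (x \<otimes> id) applied to the coproduct of \<rho>;
  these numbers form the matrix of left multiplication by \<open>x\<close> in the coordinates given
  by forests.\<close>

definition contract :: "(forest \<Rightarrow> real) \<Rightarrow> forest \<Rightarrow> forest \<Rightarrow> real" where
  "contract x \<rho> \<sigma> = (\<Sum>(u, v)\<in>#coproduct \<rho>. if v = \<sigma> then x u else 0)"

lemma contract_empty: "contract x \<rho> {#} = x \<rho>"
  unfolding contract_def by (rule coproduct_sum_counit_right)

lemma character_mult_contract:
  assumes "\<rho> \<in> forests d" "forest_degree \<rho> \<le> n"
  shows "(a \<otimes>\<^bsub>character_group d n\<^esub> b) \<rho> = (\<Sum>\<sigma>\<in>insert {#} (forests_upto d n). contract a \<rho> \<sigma> * b \<sigma>)"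
proof -
  let ?F = "insert {#} (forests_upto d n)"
  have "(\<Sum>\<sigma>\<in>?F. contract a \<rho> \<sigma> * b \<sigma>)
      = (\<Sum>(u, v)\<in>#coproduct \<rho>. \<Sum>\<sigma>\<in>?F. if v = \<sigma> then a u * b \<sigma> else 0)"
    unfolding contract_def sum_mset_distrib_right case_prod_unfold
    by (subst sum_sum_mset_swap) (simp add: if_distrib[of "\<lambda>z. z * _"] cong: if_cong)
  also have "\<dots> = (\<Sum>(u, v)\<in>#coproduct \<rho>. a u * b v)"
  proof (intro arg_cong[of _ _ sum_mset] image_mset_cong, clarify)
    fix u v assume uv: "(u, v) \<in># coproduct \<rho>"
    have "v \<in> {\<rho> \<in> forests d. forest_degree \<rho> \<le> n}"
      using coproduct_forests[OF uv assms(1)] coproduct_degree[OF uv] assms(2) by simp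
    then have "v \<in> ?F" by (simp only: forests_degree_le_eq)
    then show "(\<Sum>\<sigma>\<in>?F. if v = \<sigma> then a u * b \<sigma> else 0) = a u * b v"
      by (simp add: sum.delta del: sum.insert)
  qed
  finally show ?thesis using assms by (simp add: character_mult_eq del: sum.insert)
qed

text \<open>Multiplicativity of the coproduct and of \<open>x\<close>. A cut may leave nothing of
  one factor, so empty parts of \<sigma> must be allowed. The degree bound confines the identity to
  pairs kept by the truncated product; the other pairs make up
  \<open>truncation_remainder\<close>.\<close>

lemma contract_plus:
  assumes x: "x \<in> carrier (character_group d n)" and \<rho>: "\<rho>\<^sub>1 \<in> forests d" "\<rho>\<^sub>2 \<in> forests d"
    and deg: "forest_degree \<rho>\<^sub>1 + forest_degree \<rho>\<^sub>2 \<le> n"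
  defines "F \<equiv> insert {#} (forests_upto d n)"
  shows "contract x (\<rho>\<^sub>1 + \<rho>\<^sub>2) \<sigma>
    = (\<Sum>(\<sigma>\<^sub>1, \<sigma>\<^sub>2)\<in>{z \<in> F \<times> F. fst z + snd z = \<sigma>}. contract x \<rho>\<^sub>1 \<sigma>\<^sub>1 * contract x \<rho>\<^sub>2 \<sigma>\<^sub>2)"
proof -
  let ?P = "{z \<in> F \<times> F. fst z + snd z = \<sigma>}"
  have fin: "finite ?P" unfolding F_def by (intro finite_Collect_conjI disjI1) simp
  have "(\<Sum>z\<in>?P. contract x \<rho>\<^sub>1 (fst z) * contract x \<rho>\<^sub>2 (snd z))
    = (\<Sum>z\<in>?P. \<Sum>a\<in>#coproduct \<rho>\<^sub>1. \<Sum>b\<in>#coproduct \<rho>\<^sub>2.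
         if (snd a, snd b) = z then x (fst a) * x (fst b) else 0)"
    unfolding contract_def case_prod_unfold sum_mset_times_sum_mset
    by (intro sum.cong refl arg_cong[of _ _ sum_mset] image_mset_cong) auto
  also have "\<dots> = (\<Sum>a\<in>#coproduct \<rho>\<^sub>1. \<Sum>b\<in>#coproduct \<rho>\<^sub>2. \<Sum>z\<in>?P.
         if (snd a, snd b) = z then x (fst a) * x (fst b) else 0)"
    by (simp only: sum_sum_mset_swap)
  also have "\<dots> = (\<Sum>a\<in>#coproduct \<rho>\<^sub>1. \<Sum>b\<in>#coproduct \<rho>\<^sub>2.
         if snd a + snd b = \<sigma> then x (fst a + fst b) else 0)"
  proof (intro arg_cong[of _ _ sum_mset] image_mset_cong)
    fix a b assume ab: "a \<in># coproduct \<rho>\<^sub>1" "b \<in># coproduct \<rho>\<^sub>2"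
    have a: "fst a \<in> forests d" "snd a \<in> forests d" "forest_degree (fst a) + forest_degree (snd a) = forest_degree \<rho>\<^sub>1"
      using coproduct_forests[of "fst a" "snd a"] coproduct_degree[of "fst a" "snd a"] ab \<rho> by auto
    have b: "fst b \<in> forests d" "snd b \<in> forests d" "forest_degree (fst b) + forest_degree (snd b) = forest_degree \<rho>\<^sub>2"
      using coproduct_forests[of "fst b" "snd b"] coproduct_degree[of "fst b" "snd b"] ab \<rho> by auto
    have "x (fst a + fst b) = x (fst a) * x (fst b)"
      using a b deg by (intro character_plus[OF x]) auto
    moreover have "(snd a, snd b) \<in> ?P \<longleftrightarrow> snd a + snd b = \<sigma>"
      using a b deg unfolding F_def by (simp flip: forests_degree_le_eq)
    ultimately show "(\<Sum>z\<in>?P. if (snd a, snd b) = z then x (fst a) * x (fst b) else 0)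
        = (if snd a + snd b = \<sigma> then x (fst a + fst b) else 0)"
      by (simp only: sum.delta'[OF fin] if_True if_False split: if_splits)
  qed
  also have "\<dots> = contract x (\<rho>\<^sub>1 + \<rho>\<^sub>2) \<sigma>"
    unfolding contract_def coproduct_plus sum_tensor_mult by (simp add: case_prod_unfold)
  finally show ?thesis by (simp add: case_prod_unfold)
qed

lemma contract_eq_0: "forest_degree \<rho> < forest_degree \<sigma> \<Longrightarrow> contract x \<rho> \<sigma> = 0"
  unfolding contract_def by (intro sum_mset.neutral) (force dest: coproduct_degree)

text \<open>In a term with right factor \<sigma> the left factor has degree |\<rho>| -
  |\<sigma>|.\<close>

lemma abs_contract_le:
  fixes h :: real
  assumes "\<And>\<rho>. \<bar>x \<rho>\<bar> \<le> h ^ forest_degree \<rho>" "0 \<le> h"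
  shows "\<bar>contract x \<rho> \<sigma>\<bar> \<le> real (size (coproduct \<rho>)) * h ^ (forest_degree \<rho> - forest_degree \<sigma>)"
  unfolding contract_def
proof (intro abs_sum_mset_le)
  fix z assume "z \<in># coproduct \<rho>"
  then have "forest_degree (fst z) + forest_degree (snd z) = forest_degree \<rho>"
    by (intro coproduct_degree) simp
  then have "forest_degree (fst z) = forest_degree \<rho> - forest_degree (snd z)" by simp
  then show "\<bar>case z of (u, v) \<Rightarrow> if v = \<sigma> then x u else 0\<bar>
      \<le> h ^ (forest_degree \<rho> - forest_degree \<sigma>)"
    using assms(1)[of "fst z"] assms(2) by (auto simp: case_prod_unfold)
qed

definition translate_coeff ::
  "nat \<Rightarrow> nat \<Rightarrow> (forest \<Rightarrow> real) \<Rightarrow> (forest \<Rightarrow> real) \<Rightarrow> forest \<Rightarrow> real" where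
  "translate_coeff d n x w \<sigma> =
     (if \<sigma> \<in> forests_upto d n then \<Sum>\<rho>\<in>forests_upto d n. w \<rho> * contract x \<rho> \<sigma> else 0)"

definition mult_coeff ::
  "nat \<Rightarrow> nat \<Rightarrow> (forest \<Rightarrow> real) \<Rightarrow> (forest \<Rightarrow> real) \<Rightarrow> forest \<Rightarrow> real" where
  "mult_coeff d n w v \<sigma> =
     (if \<sigma> \<in> forests_upto d n
      then \<Sum>(\<rho>\<^sub>1, \<rho>\<^sub>2)\<in>{z \<in> forests_upto d n \<times> forests_upto d n. fst z + snd z = \<sigma>}. w \<rho>\<^sub>1 * v \<rho>\<^sub>2
      else 0)"

lemma translate_coeff_lincomb:
  "translate_coeff d n x (\<lambda>\<rho>. a * u \<rho> + b * v \<rho> + w \<rho>) \<sigma>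
     = a * translate_coeff d n x u \<sigma> + b * translate_coeff d n x v \<sigma> + translate_coeff d n x w \<sigma>"
  by (simp add: translate_coeff_def sum.distrib distrib_right sum_distrib_left mult.assoc)

text \<open>The column of \<open>contract\<close> at \<open>{#}\<close> contributes
  \<open>\<phi> b\<close>, which is what \<open>translate\<close> subtracts; only nonempty \<sigma>
  remain.\<close>

lemma represents_translate:
  assumes "represents d n w \<phi>" "b \<in> carrier (character_group d n)"
  shows "represents d n (translate_coeff d n b w) (translate d n \<phi> b)"
  unfolding represents_def
proof (intro conjI ballI allI impI)
  let ?F = "forests_upto d n"
  fix c assume c: "c \<in> carrier (character_group d n)"
  have "(b \<otimes>\<^bsub>character_group d n\<^esub> c) \<rho> = b \<rho> + (\<Sum>\<sigma>\<in>?F. contract b \<rho> \<sigma> * c \<sigma>)" if "\<rho> \<in> ?F" for \<rho>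
    using that character_empty[OF c] by (simp add: character_mult_contract in_forests_upto_iff contract_empty)
  then have "translate d n \<phi> b c = (\<Sum>\<rho>\<in>?F. \<Sum>\<sigma>\<in>?F. w \<rho> * contract b \<rho> \<sigma> * c \<sigma>)"
    using assms c character_mult_closed[OF assms(2) c]
    by (simp add: translate_def represents_def distrib_left sum.distrib sum_distrib_left mult.assoc)
  also have "\<dots> = (\<Sum>\<sigma>\<in>?F. translate_coeff d n b w \<sigma> * c \<sigma>)"
    by (subst sum.swap) (simp add: translate_coeff_def sum_distrib_right)
  finally show "translate d n \<phi> b c = (\<Sum>\<sigma>\<in>?F. translate_coeff d n b w \<sigma> * c \<sigma>)" .
qed (simp add: translate_coeff_def)

lemma sum_pairs_degree_le:
  fixes f :: "forest \<times> forest \<Rightarrow> real"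
  shows "(\<Sum>z\<in>{z \<in> forests_upto d n \<times> forests_upto d n. forest_degree (fst z) + forest_degree (snd z) \<le> n}. f z)
    = (\<Sum>\<rho>\<in>forests_upto d n. \<Sum>z\<in>{z \<in> forests_upto d n \<times> forests_upto d n. fst z + snd z = \<rho>}. f z)"
proof -
  let ?F = "forests_upto d n"
  let ?S = "{z \<in> ?F \<times> ?F. forest_degree (fst z) + forest_degree (snd z) \<le> n}"
  have "(\<Sum>\<rho>\<in>?F. sum f {z \<in> ?S. fst z + snd z = \<rho>}) = sum f ?S"
    by (intro sum.group) (auto simp: in_forests_upto_iff)
  moreover have "{z \<in> ?S. fst z + snd z = \<rho>} = {z \<in> ?F \<times> ?F. fst z + snd z = \<rho>}" if "\<rho> \<in> ?F" for \<rho>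
    using that by (auto simp: forests_upto_def)
  ultimately show ?thesis by simp
qed

lemma represents_mult:
  assumes "represents d n w \<phi>" "represents d n v \<psi>"
  shows "represents d n (mult_coeff d n w v) (one_form_mult d n \<phi> \<psi>)"
  unfolding represents_def
proof (intro conjI ballI allI impI)
  let ?F = "forests_upto d n"
  fix c assume c: "c \<in> carrier (character_group d n)"
  have "one_form_mult d n \<phi> \<psi> c = (\<Sum>z\<in>{z \<in> ?F \<times> ?F. forest_degree (fst z) + forest_degree (snd z) \<le> n}.
      w (fst z) * v (snd z) * c (fst z + snd z))"
    unfolding one_form_mult_def coefficient_eqI[OF assms(1)] coefficient_eqI[OF assms(2)]
    by (intro sum.cong) auto
  also have "\<dots> = (\<Sum>\<rho>\<in>?F. \<Sum>z\<in>{z \<in> ?F \<times> ?F. fst z + snd z = \<rho>}.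
      w (fst z) * v (snd z) * c (fst z + snd z))"
    by (rule sum_pairs_degree_le)
  also have "\<dots> = (\<Sum>\<rho>\<in>?F. mult_coeff d n w v \<rho> * c \<rho>)"
    by (intro sum.cong) (simp_all add: mult_coeff_def case_prod_unfold sum_distrib_right)
  finally show "one_form_mult d n \<phi> \<psi> c = (\<Sum>\<rho>\<in>?F. mult_coeff d n w v \<rho> * c \<rho>)" .
qed (simp add: mult_coeff_def)

text \<open>The terms by which the product of two linear maps fails to be the pointwise product: they
  are discarded by the truncation and contribute only at order \<open>n + 1\<close>.\<close>

definition truncation_remainder ::
  "nat \<Rightarrow> nat \<Rightarrow> (forest \<Rightarrow> real) \<Rightarrow> (forest \<Rightarrow> real) \<Rightarrow> (forest \<Rightarrow> real) \<Rightarrow> forest \<Rightarrow> real" where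
  "truncation_remainder d n x w v \<sigma> =
     (\<Sum>(\<rho>\<^sub>1, \<rho>\<^sub>2)\<in>{z \<in> forests_upto d n \<times> forests_upto d n. n < forest_degree (fst z) + forest_degree (snd z)}.
        w \<rho>\<^sub>1 * v \<rho>\<^sub>2 *
        (\<Sum>(\<sigma>\<^sub>1, \<sigma>\<^sub>2)\<in>{z \<in> insert {#} (forests_upto d n) \<times> insert {#} (forests_upto d n). fst z + snd z = \<sigma>}.
           contract x \<rho>\<^sub>1 \<sigma>\<^sub>1 * contract x \<rho>\<^sub>2 \<sigma>\<^sub>2))"

text \<open>\<open>contract_plus\<close> turns each kept pair into a sum over splittings of
  \<sigma>. Completed to all pairs, this sum factorises for every splitting; the pairs added for
  this purpose form the remainder.\<close>

lemma translate_coeff_mult: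
  assumes x: "x \<in> carrier (character_group d n)" and \<sigma>: "\<sigma> \<in> forests_upto d n"
  defines "F \<equiv> forests_upto d n"
  shows "translate_coeff d n x (mult_coeff d n w v) \<sigma> =
    (\<Sum>\<rho>\<in>F. w \<rho> * x \<rho>) * translate_coeff d n x v \<sigma> + translate_coeff d n x w \<sigma> * (\<Sum>\<rho>\<in>F. v \<rho> * x \<rho>)
    + mult_coeff d n (translate_coeff d n x w) (translate_coeff d n x v) \<sigma>
    - truncation_remainder d n x w v \<sigma>"
proof -
  let ?F0 = "insert {#} F"
  let ?P = "{z \<in> ?F0 \<times> ?F0. fst z + snd z = \<sigma>}"
  let ?f = "\<lambda>z. w (fst z) * v (snd z) * (\<Sum>y\<in>?P. contract x (fst z) (fst y) * contract x (snd z) (snd y))"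
  let ?S = "{z \<in> F \<times> F. forest_degree (fst z) + forest_degree (snd z) \<le> n}"
  let ?S' = "{z \<in> F \<times> F. n < forest_degree (fst z) + forest_degree (snd z)}"
  have fin: "finite F" by (simp add: F_def)
  \<comment> \<open>At nonempty \<open>\<tau>\<close> in \<open>F\<close> this is the translated
    coefficient, at \<open>{#}\<close> the value of the form at \<open>x\<close>.\<close>
  define A where "A = (\<lambda>w \<tau>. \<Sum>\<rho>\<in>F. w \<rho> * contract x \<rho> \<tau>)"
  have "translate_coeff d n x (mult_coeff d n w v) \<sigma>
      = (\<Sum>\<rho>\<in>F. \<Sum>z\<in>{z \<in> F \<times> F. fst z + snd z = \<rho>}. w (fst z) * v (snd z) * contract x (fst z + snd z) \<sigma>)"
    using \<sigma> unfolding F_def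
    by (simp add: translate_coeff_def mult_coeff_def case_prod_unfold sum_distrib_right)
  also have "\<dots> = (\<Sum>z\<in>?S. w (fst z) * v (snd z) * contract x (fst z + snd z) \<sigma>)"
    unfolding F_def by (rule sum_pairs_degree_le[symmetric])
  also have "\<dots> = (\<Sum>z\<in>?S. ?f z)"
  proof (intro sum.cong refl)
    fix z assume "z \<in> ?S"
    then have "contract x (fst z + snd z) \<sigma> = (\<Sum>y\<in>?P. contract x (fst z) (fst y) * contract x (snd z) (snd y))"
      unfolding F_def by (subst contract_plus[OF x]) (auto simp: forests_upto_def case_prod_unfold)
    then show "w (fst z) * v (snd z) * contract x (fst z + snd z) \<sigma> = ?f z" by simp
  qed
  also have "\<dots> = (\<Sum>z\<in>F \<times> F. ?f z) - (\<Sum>z\<in>?S'. ?f z)"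
  proof -
    have "F \<times> F = ?S \<union> ?S'" by auto
    moreover have "sum ?f (?S \<union> ?S') = sum ?f ?S + sum ?f ?S'"
      using fin by (intro sum.union_disjoint) auto
    ultimately show ?thesis by simp
  qed
  also have "(\<Sum>z\<in>?S'. ?f z) = truncation_remainder d n x w v \<sigma>"
    unfolding truncation_remainder_def F_def case_prod_unfold ..
  also have "(\<Sum>z\<in>F \<times> F. ?f z) = (\<Sum>y\<in>?P. A w (fst y) * A v (snd y))"
  proof -
    have "A w a * A v b
        = (\<Sum>z\<in>F \<times> F. w (fst z) * v (snd z) * (contract x (fst z) a * contract x (snd z) b))" for a b
      unfolding A_def sum_product sum.cartesian_product
      by (intro sum.cong) (auto simp: case_prod_unfold mult_ac)
    then have "(\<Sum>y\<in>?P. A w (fst y) * A v (snd y)) = (\<Sum>y\<in>?P. \<Sum>z\<in>F \<times> F.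
        w (fst z) * v (snd z) * (contract x (fst z) (fst y) * contract x (snd z) (snd y)))"
      by (simp only:)
    also have "\<dots> = (\<Sum>z\<in>F \<times> F. ?f z)"
      unfolding sum_distrib_left by (rule sum.swap)
    finally show ?thesis ..
  qed
  \<comment> \<open>The two trivial splittings, distinct because \<sigma> is nonempty, give the
    products of a value at \<open>x\<close> with a translate.\<close>
  also have "?P = insert ({#}, \<sigma>) (insert (\<sigma>, {#}) {z \<in> F \<times> F. fst z + snd z = \<sigma>})"
    using \<sigma> by (auto simp: F_def)
  also have "(\<Sum>y\<in>\<dots>. A w (fst y) * A v (snd y))
      = A w {#} * A v \<sigma> + A w \<sigma> * A v {#} + (\<Sum>y\<in>{z \<in> F \<times> F. fst z + snd z = \<sigma>}. A w (fst y) * A v (snd y))"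
    using \<sigma> fin by (subst sum.insert; (subst sum.insert)?) (auto simp: F_def)
  also have "(\<Sum>y\<in>{z \<in> F \<times> F. fst z + snd z = \<sigma>}. A w (fst y) * A v (snd y))
      = mult_coeff d n (translate_coeff d n x w) (translate_coeff d n x v) \<sigma>"
    using \<sigma> unfolding mult_coeff_def case_prod_unfold F_def
    by (simp, intro sum.cong) (auto simp: translate_coeff_def A_def F_def)
  finally show ?thesis
    using \<sigma> by (simp add: A_def translate_coeff_def F_def contract_empty)
qed

lemma represents_cong:
  "represents d n w \<phi> \<Longrightarrow> (\<And>c. c \<in> carrier (character_group d n) \<Longrightarrow> \<psi> c = \<phi> c) \<Longrightarrow> represents d n w \<psi>"
  by (simp add: represents_def)

lemma represents_lincomb:
  assumes "represents d n u \<phi>" "represents d n v \<psi>" "represents d n w \<xi>"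
  shows "represents d n (\<lambda>\<rho>. a * u \<rho> + b * v \<rho> + w \<rho>) (\<lambda>c. a * \<phi> c + b * \<psi> c + \<xi> c)"
  using assms by (simp add: represents_def sum.distrib distrib_right sum_distrib_left mult.assoc)

lemma represents_diff:
  assumes "represents d n u \<phi>" "represents d n v \<psi>"
  shows "represents d n (\<lambda>\<rho>. u \<rho> - v \<rho>) (\<lambda>c. \<phi> c - \<psi> c)"
  using assms by (simp add: represents_def sum_subtractf left_diff_distrib)


section \<open>Slowly-varying one-forms in coordinates\<close>

text \<open>\<open>sewing_const\<close> for the germ constant
  \<open>card (forests_upto d n) * M\<close>, with \<open>M\<close> taken out.\<close>

definition sewing_bound :: "nat \<Rightarrow> nat \<Rightarrow> real \<Rightarrow> real" where
  "sewing_bound d n \<theta> = 2 * real (card (forests_upto d n)) / (1 - 2 powr (1 - \<theta>))"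

text \<open>The sewing error plus a crude bound for the germ started at time 0, again with
  \<open>M\<close> taken out.\<close>

definition integral_bound :: "nat \<Rightarrow> nat \<Rightarrow> real \<Rightarrow> real \<Rightarrow> real" where
  "integral_bound d n \<theta> W = sewing_bound d n \<theta> * W powr \<theta> + real (card (forests_upto d n)) * W"

definition coproduct_bound :: "nat \<Rightarrow> nat \<Rightarrow> real" where
  "coproduct_bound d n = (\<Sum>\<rho>\<in>forests_upto d n. real (size (coproduct \<rho>)))"

lemma sewing_bound_nonneg: "1 < \<theta> \<Longrightarrow> 0 \<le> sewing_bound d n \<theta>"
  using powr_less_mono[of "1 - \<theta>" 0 2] by (simp add: sewing_bound_def)

lemma integral_bound_nonneg: "1 < \<theta> \<Longrightarrow> 0 \<le> W \<Longrightarrow> 0 \<le> integral_bound d n \<theta> W"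
  by (simp add: integral_bound_def sewing_bound_nonneg)

text \<open>Removes the quotients from the slow norm. At \<open>y = 0\<close> both sides say
  \<open>x = 0\<close>, since the quotient is infinite otherwise.\<close>

lemma ennreal_divide_le_iff:
  assumes "0 \<le> x" "0 \<le> y" "0 \<le> M"
  shows "ennreal x / ennreal y \<le> ennreal M \<longleftrightarrow> x \<le> M * y"
proof (cases "y = 0")
  case True
  then show ?thesis using assms by (cases "x = 0") (auto simp: ennreal_divide_zero top_unique)
next
  case False
  then have "ennreal x / ennreal y = ennreal (x / y)" using assms by (intro divide_ennreal) auto
  then show ?thesis using False assms by (simp add: ennreal_le_iff field_simps)
qed

section \<open>Powers of the control, and the slow norm as inequalities between coefficients\<close>

context rough_path
begin

abbreviation F where "F \<equiv> forests_upto d (trunc p)"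
text \<open>The summand 1 makes powers of \<open>W\<close> increase with the exponent, so different
  surplus exponents can be bounded by one power.\<close>

abbreviation W where "W \<equiv> 1 + \<omega> 0 T"

lemma W_ge_1: "1 \<le> W"
  using control_nonneg by simp

lemma control_le_W: "0 \<le> s \<Longrightarrow> s \<le> t \<Longrightarrow> t \<le> T \<Longrightarrow> \<omega> s t \<le> W"
  using control_mono[of 0 s t T] by simp

text \<open>A surplus exponent \<open>e\<close> is paid for with a constant; this brings errors of
  different orders to the common order \<theta> - |\<sigma>| / p.\<close>

lemma control_powr_add_le:
  assumes "0 \<le> s" "s \<le> t" "t \<le> T" "0 \<le> e" "e \<le> e'"
  shows "\<omega> s t powr (a + e) \<le> \<omega> s t powr a * W powr e'"
proof -
  have "\<omega> s t powr e \<le> W powr e"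
    using control_le_W assms control_nonneg by (intro powr_mono2) auto
  also have "\<dots> \<le> W powr e'" using W_ge_1 assms by (intro powr_mono) auto
  finally show ?thesis by (simp add: powr_add mult_left_mono)
qed

text \<open>\<open>k = 0\<close> is excluded because \<open>0 ^ 0 = 1\<close> while
  \<open>0 powr 0 = 0\<close>.\<close>

lemma root_control_power:
  assumes "k \<ge> 1"
  shows "(\<omega> s t powr (1 / p)) ^ k = \<omega> s t powr (k / p)"
  using assms by (cases "\<omega> s t = 0") (auto simp: powr_powr simp flip: powr_realpow)

lemma degree_div_p_le_1: "\<rho> \<in> F \<Longrightarrow> forest_degree \<rho> / p \<le> 1"
  using trunc_le p_ge_1 by (auto simp: in_forests_upto_iff divide_le_eq_1 intro: order_trans[OF of_nat_mono])

lemma abs_inc_le_W: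
  assumes "0 \<le> s" "s \<le> t" "t \<le> T" "\<rho> \<in> F"
  shows "\<bar>inc s t \<rho>\<bar> \<le> W"
proof -
  have "\<bar>inc s t \<rho>\<bar> \<le> \<omega> s t powr (forest_degree \<rho> / p)"
    using abs_inc_le[of s t \<rho>] root_control_power[of "forest_degree \<rho>" s t] assms
    by (simp add: in_forests_upto_iff)
  also have "\<dots> \<le> W powr (forest_degree \<rho> / p)"
    using control_le_W assms control_nonneg p_ge_1 by (intro powr_mono2) auto
  also have "\<dots> \<le> W powr 1"
    using W_ge_1 degree_div_p_le_1[OF assms(4)] by (intro powr_mono) auto
  finally show ?thesis using W_ge_1 by simp
qed

lemma coefficient_increment:
  assumes "\<And>t. 0 \<le> t \<Longrightarrow> t \<le> T \<Longrightarrow> represents d (trunc p) (w t) (\<beta> t)" "0 \<le> s" "s < t" "t \<le> T"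
  shows "coefficient d (trunc p) (\<lambda>c. \<beta> t c - translate d (trunc p) (\<beta> s) (inc s t) c)
    = (\<lambda>\<rho>. w t \<rho> - translate_coeff d (trunc p) (inc s t) (w s) \<rho>)"
  using assms by (intro coefficient_eqI represents_diff represents_translate inc_closed) auto

text \<open>The estimates use the slow norm through these two inequalities with a common constant;
  \<open>slow_norm_leI\<close> leads back to the norm.\<close>

lemma slow_normD:
  assumes rep: "\<And>t. 0 \<le> t \<Longrightarrow> t \<le> T \<Longrightarrow> represents d (trunc p) (w t) (\<beta> t)"
    and M: "slow_norm d p T X \<theta> \<beta> \<le> ennreal M" "0 \<le> M"
  shows "0 \<le> t \<Longrightarrow> t \<le> T \<Longrightarrow> \<rho> \<in> F \<Longrightarrow> \<bar>w t \<rho>\<bar> \<le> M"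
    and "0 \<le> s \<Longrightarrow> s < t \<Longrightarrow> t \<le> T \<Longrightarrow> \<rho> \<in> F \<Longrightarrow>
      \<bar>w t \<rho> - translate_coeff d (trunc p) (inc s t) (w s) \<rho>\<bar> \<le> M * \<omega> s t powr (\<theta> - forest_degree \<rho> / p)"
proof -
  define A where "A = (SUP t\<in>{0..T}. ennreal (one_form_norm d (trunc p) (\<beta> t)))"
  define B where "B = (\<lambda>\<rho>. SUP (s, t)\<in>{(s, t). 0 \<le> s \<and> s < t \<and> t \<le> T}.
          ennreal \<bar>coefficient d (trunc p)
             (\<lambda>c. \<beta> t c - translate d (trunc p) (\<beta> s) (increment d (trunc p) X s t) c) \<rho>\<bar>
          / ennreal (control d p X s t powr (\<theta> - forest_degree \<rho> / p)))"
  have eq: "slow_norm d p T X \<theta> \<beta> = A + (MAX \<rho>\<in>F. B \<rho>)"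
    by (simp add: slow_norm_def A_def B_def)
  have A: "A \<le> ennreal M" using M(1) unfolding eq by (meson le_iff_add order_trans)
  have B: "B \<rho> \<le> ennreal M" if "\<rho> \<in> F" for \<rho>
  proof -
    have "B \<rho> \<le> (MAX \<rho>\<in>F. B \<rho>)" using that by (intro Max_ge) auto
    also have "\<dots> \<le> A + (MAX \<rho>\<in>F. B \<rho>)" by simp
    finally show ?thesis using M(1) unfolding eq by (rule order_trans)
  qed
  show "\<bar>w t \<rho>\<bar> \<le> M" if "0 \<le> t" "t \<le> T" "\<rho> \<in> F"
  proof -
    have "ennreal (one_form_norm d (trunc p) (\<beta> t)) \<le> A"
      unfolding A_def using that by (intro SUP_upper) auto
    then have "one_form_norm d (trunc p) (\<beta> t) \<le> M"
      using A M(2) by (meson ennreal_le_iff order_trans)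
    moreover have "\<bar>w t \<rho>\<bar> \<le> one_form_norm d (trunc p) (\<beta> t)"
      unfolding one_form_norm_eq[OF rep[OF that(1,2)]] using that by (intro Max_ge) auto
    ultimately show ?thesis by simp
  qed
  show "\<bar>w t \<rho> - translate_coeff d (trunc p) (inc s t) (w s) \<rho>\<bar> \<le> M * \<omega> s t powr (\<theta> - forest_degree \<rho> / p)"
    if "0 \<le> s" "s < t" "t \<le> T" "\<rho> \<in> F"
  proof -
    have "ennreal \<bar>w t \<rho> - translate_coeff d (trunc p) (inc s t) (w s) \<rho>\<bar>
        / ennreal (\<omega> s t powr (\<theta> - forest_degree \<rho> / p)) \<le> B \<rho>"
      unfolding B_def using coefficient_increment[where w = w and \<beta> = \<beta>, OF rep that(1-3)] that(1-3)
      by (intro SUP_upper2[of "(s, t)"]) auto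
    then have "ennreal \<bar>w t \<rho> - translate_coeff d (trunc p) (inc s t) (w s) \<rho>\<bar>
        / ennreal (\<omega> s t powr (\<theta> - forest_degree \<rho> / p)) \<le> ennreal M"
      using B[OF that(4)] by (rule order_trans)
    then show ?thesis using M(2) by (subst (asm) ennreal_divide_le_iff) auto
  qed
qed

lemma slow_norm_leI:
  assumes rep: "\<And>t. 0 \<le> t \<Longrightarrow> t \<le> T \<Longrightarrow> represents d (trunc p) (w t) (\<beta> t)"
    and "0 \<le> A" "0 \<le> B"
    and A: "\<And>t \<rho>. 0 \<le> t \<Longrightarrow> t \<le> T \<Longrightarrow> \<rho> \<in> F \<Longrightarrow> \<bar>w t \<rho>\<bar> \<le> A"
    and B: "\<And>s t \<rho>. 0 \<le> s \<Longrightarrow> s < t \<Longrightarrow> t \<le> T \<Longrightarrow> \<rho> \<in> F \<Longrightarrow>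
      \<bar>w t \<rho> - translate_coeff d (trunc p) (inc s t) (w s) \<rho>\<bar> \<le> B * \<omega> s t powr (\<theta> - forest_degree \<rho> / p)"
  shows "slow_norm d p T X \<theta> \<beta> \<le> ennreal (A + B)"
proof -
  have F: "F \<noteq> {}" by (intro forests_upto_nonempty d_ge_1 trunc_ge_1)
  have "(SUP t\<in>{0..T}. ennreal (one_form_norm d (trunc p) (\<beta> t))) \<le> ennreal A"
  proof (intro SUP_least ennreal_leI)
    fix t assume "t \<in> {0..T}"
    then show "one_form_norm d (trunc p) (\<beta> t) \<le> A"
      using F A by (subst one_form_norm_eq[OF rep]) (auto intro!: Max.boundedI)
  qed
  moreover have "(MAX \<rho>\<in>F. SUP (s, t)\<in>{(s, t). 0 \<le> s \<and> s < t \<and> t \<le> T}.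
          ennreal \<bar>coefficient d (trunc p)
             (\<lambda>c. \<beta> t c - translate d (trunc p) (\<beta> s) (increment d (trunc p) X s t) c) \<rho>\<bar>
          / ennreal (control d p X s t powr (\<theta> - forest_degree \<rho> / p))) \<le> ennreal B"
  proof (intro Max.boundedI; (elim imageE)?)
    fix b \<rho> assume \<rho>: "\<rho> \<in> F" and b: "b = (SUP (s, t)\<in>{(s, t). 0 \<le> s \<and> s < t \<and> t \<le> T}.
          ennreal \<bar>coefficient d (trunc p)
             (\<lambda>c. \<beta> t c - translate d (trunc p) (\<beta> s) (increment d (trunc p) X s t) c) \<rho>\<bar>
          / ennreal (control d p X s t powr (\<theta> - forest_degree \<rho> / p)))"
    show "b \<le> ennreal B"
      unfolding b
    proof (intro SUP_least, clarify)
      fix s t :: real assume st: "0 \<le> s" "s < t" "t \<le> T"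
      show "ennreal \<bar>coefficient d (trunc p) (\<lambda>c. \<beta> t c - translate d (trunc p) (\<beta> s) (inc s t) c) \<rho>\<bar>
          / ennreal (\<omega> s t powr (\<theta> - forest_degree \<rho> / p)) \<le> ennreal B"
        using coefficient_increment[where w = w and \<beta> = \<beta>, OF rep st] B[OF st \<rho>] \<open>0 \<le> B\<close>
        by (subst ennreal_divide_le_iff) auto
    qed
  qed (use F in auto)
  ultimately show ?thesis
    unfolding slow_norm_def using assms(2,3) by (simp add: ennreal_plus add_mono)
qed

end

section \<open>A single slowly-varying form: germ estimate and integral\<close>

locale slow_form = rough_path d p T X for d p T X +
  fixes \<theta> M :: real and \<beta> :: "real \<Rightarrow> (forest \<Rightarrow> real) \<Rightarrow> real" and w :: "real \<Rightarrow> forest \<Rightarrow> real"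
  assumes theta_gt_1: "1 < \<theta>" and M_nonneg: "0 \<le> M"
    and rep: "0 \<le> t \<Longrightarrow> t \<le> T \<Longrightarrow> represents d (trunc p) (w t) (\<beta> t)"
    and coeff_le: "0 \<le> t \<Longrightarrow> t \<le> T \<Longrightarrow> \<rho> \<in> F \<Longrightarrow> \<bar>w t \<rho>\<bar> \<le> M"
    and increment_le: "0 \<le> s \<Longrightarrow> s < t \<Longrightarrow> t \<le> T \<Longrightarrow> \<rho> \<in> F \<Longrightarrow>
      \<bar>w t \<rho> - translate_coeff d (trunc p) (inc s t) (w s) \<rho>\<bar> \<le> M * \<omega> s t powr (\<theta> - forest_degree \<rho> / p)"
begin

lemma eval_eq:
  "0 \<le> t \<Longrightarrow> t \<le> T \<Longrightarrow> c \<in> carrier G \<Longrightarrow> \<beta> t c = (\<Sum>\<rho>\<in>F. w t \<rho> * c \<rho>)"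
  using rep by (simp add: represents_def)

text \<open>The defect is, up to sign, \<open>\<beta> u\<close> minus the translate of
  \<open>\<beta> s\<close>, evaluated at the increment from \<open>u\<close> to \<open>t\<close>.
  The coefficient at \<rho> has order \<theta> - |\<rho>| / p and the increment order |\<rho>| / p,
  so every term has order \<theta>.\<close>

lemma eval_germ:
  assumes "0 \<le> s" "s \<le> u" "u \<le> t" "t \<le> T"
  shows "\<bar>\<beta> s (inc s t) - \<beta> s (inc s u) - \<beta> u (inc u t)\<bar> \<le> real (card F) * M * \<omega> s t powr \<theta>"
proof (cases "s = u")
  case True
  \<comment> \<open>Slow variation compares distinct times. For \<open>s = u\<close> the defect is
    the value at the unit, which is 0 because one-forms have no constant term.\<close>
  have "\<beta> s \<one>\<^bsub>G\<^esub> = (\<Sum>\<rho>\<in>F. w s \<rho> * \<one>\<^bsub>G\<^esub> \<rho>)" using assms by (intro eval_eq) auto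
  also have "\<dots> = 0" by (intro sum.neutral) (auto simp: character_one_eq)
  finally show ?thesis using True assms M_nonneg by (simp add: inc_same)
next
  case False
  let ?tc = "translate_coeff d (trunc p) (inc s u) (w s)"
  have G: "inc s u \<in> carrier G" "inc u t \<in> carrier G" using assms by (auto intro!: inc_closed)
  have "\<beta> s (inc s t) - \<beta> s (inc s u) = translate d (trunc p) (\<beta> s) (inc s u) (inc u t)"
    using assms by (simp add: translate_def inc_mult)
  also have "\<dots> = (\<Sum>\<rho>\<in>F. ?tc \<rho> * inc u t \<rho>)"
    using represents_translate[OF rep[of s] G(1)] G(2) assms by (simp add: represents_def)
  finally have eq: "\<beta> s (inc s t) - \<beta> s (inc s u) - \<beta> u (inc u t)
      = (\<Sum>\<rho>\<in>F. (?tc \<rho> - w u \<rho>) * inc u t \<rho>)"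
    using eval_eq[of u "inc u t"] G assms by (simp add: sum_subtractf left_diff_distrib)
  have "\<bar>\<Sum>\<rho>\<in>F. (?tc \<rho> - w u \<rho>) * inc u t \<rho>\<bar> \<le> (\<Sum>\<rho>\<in>F. M * \<omega> s t powr \<theta>)"
  proof (rule order_trans[OF sum_abs sum_mono])
    fix \<rho> assume \<rho>: "\<rho> \<in> F"
    let ?e = "forest_degree \<rho> / p"
    have e: "0 \<le> ?e" "?e \<le> 1" using degree_div_p_le_1[OF \<rho>] p_ge_1 by auto
    have "\<bar>?tc \<rho> - w u \<rho>\<bar> \<le> M * \<omega> s u powr (\<theta> - ?e)"
      using increment_le[of s u \<rho>] False \<rho> assms by simp
    also have "\<dots> \<le> M * \<omega> s t powr (\<theta> - ?e)"
      using control_mono[of s s u t] assms M_nonneg control_nonneg theta_gt_1 e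
      by (intro mult_left_mono powr_mono2) auto
    finally have 1: "\<bar>?tc \<rho> - w u \<rho>\<bar> \<le> M * \<omega> s t powr (\<theta> - ?e)" .
    have "\<bar>inc u t \<rho>\<bar> \<le> \<omega> u t powr ?e"
      using abs_inc_le[of u t \<rho>] root_control_power[of "forest_degree \<rho>" u t] assms \<rho>
      by (simp add: in_forests_upto_iff)
    also have "\<dots> \<le> \<omega> s t powr ?e"
      using control_mono[of s u t t] assms control_nonneg e by (intro powr_mono2) auto
    finally have "\<bar>(?tc \<rho> - w u \<rho>) * inc u t \<rho>\<bar> \<le> M * \<omega> s t powr (\<theta> - ?e) * \<omega> s t powr ?e"
      unfolding abs_mult using 1 M_nonneg by (intro mult_mono) auto
    also have "\<dots> = M * \<omega> s t powr \<theta>"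
      by (simp add: mult.assoc flip: powr_add)
    finally show "\<bar>(?tc \<rho> - w u \<rho>) * inc u t \<rho>\<bar> \<le> M * \<omega> s t powr \<theta>" .
  qed
  then show ?thesis unfolding eq by simp
qed

text \<open>Provides existence of the rough integral and its first-order expansion.\<close>

sublocale sewing: sewing \<omega> "\<lambda>s t. \<beta> s (inc s t)" T \<theta> "real (card F) * M"
  using theta_gt_1 M_nonneg control_superadditive control_nonneg control_small eval_germ
  by unfold_locales auto

abbreviation integral where "integral \<equiv> rough_integral d p X \<beta>"

lemma integral_eq_sewn: "integral t = sewing.sewn t"
  unfolding rough_integral_def sewing.sewn_def
    sum_consecutive_eq_partition_sum[of "\<lambda>s t. \<beta> s (inc s t)"] ..

lemma integral_increment:
  assumes "0 \<le> s" "s \<le> t" "t \<le> T"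
  shows "\<bar>integral t - integral s - \<beta> s (inc s t)\<bar> \<le> sewing_bound d (trunc p) \<theta> * M * \<omega> s t powr \<theta>"
  using sewing.sewn_minus_germ[OF assms]
  by (simp add: integral_eq_sewn sewing.sewing_const_def sewing_bound_def mult.assoc)

lemma integral_le:
  assumes "0 \<le> t" "t \<le> T"
  shows "\<bar>integral t\<bar> \<le> integral_bound d (trunc p) \<theta> W * M"
proof -
  have "\<bar>\<beta> 0 (inc 0 t)\<bar> \<le> (\<Sum>\<rho>\<in>F. M * W)"
    unfolding eval_eq[OF order_refl less_imp_le[OF T_pos] inc_closed[OF order_refl less_imp_le[OF T_pos] assms]]
  proof (rule order_trans[OF sum_abs sum_mono])
    fix \<rho> assume "\<rho> \<in> F"
    then show "\<bar>w 0 \<rho> * inc 0 t \<rho>\<bar> \<le> M * W"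
      unfolding abs_mult using coeff_le[of 0 \<rho>] abs_inc_le_W[of 0 t \<rho>] assms T_pos M_nonneg
      by (intro mult_mono) auto
  qed
  moreover have "sewing_bound d (trunc p) \<theta> * M * \<omega> 0 t powr \<theta> \<le> sewing_bound d (trunc p) \<theta> * M * W powr \<theta>"
    using control_le_W assms control_nonneg theta_gt_1 M_nonneg sewing_bound_nonneg
    by (intro mult_left_mono powr_mono2) auto
  moreover have "integral 0 = 0" using sewing.sewn_0 T_pos by (simp add: integral_eq_sewn)
  ultimately have "\<bar>integral t\<bar> \<le> sewing_bound d (trunc p) \<theta> * M * W powr \<theta> + (\<Sum>\<rho>\<in>F. M * W)"
    using integral_increment[of 0 t] assms by linarith
  then show ?thesis by (simp add: integral_bound_def algebra_simps)
qed

text \<open>The translate differs from \<open>w t\<close> by the slow-variation error, whose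
  exponent lies between 0 and \<theta> because |\<rho>| / p \<le> 1 < \<theta>.\<close>

lemma translate_coeff_le:
  assumes "0 \<le> s" "s < t" "t \<le> T" "\<rho> \<in> F"
  shows "\<bar>translate_coeff d (trunc p) (inc s t) (w s) \<rho>\<bar> \<le> M * (1 + W powr \<theta>)"
proof -
  have "\<omega> s t powr (\<theta> - forest_degree \<rho> / p) \<le> W powr (\<theta> - forest_degree \<rho> / p)"
    using control_le_W[of s t] control_nonneg degree_div_p_le_1[OF assms(4)] theta_gt_1 assms
    by (intro powr_mono2) auto
  also have "\<dots> \<le> W powr \<theta>" using W_ge_1 p_ge_1 by (intro powr_mono) auto
  finally have "M * \<omega> s t powr (\<theta> - forest_degree \<rho> / p) \<le> M * W powr \<theta>"
    using M_nonneg by (rule mult_left_mono)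
  then show ?thesis
    using increment_le[OF assms] coeff_le[of t \<rho>] assms by (simp add: distrib_left)
qed

end


section \<open>The product one-form\<close>

text \<open>Factors in order: pairs of forests, splittings with empty parts allowed, one coproduct
  size for each of the two contractions, and a surplus exponent of at most 2.\<close>

definition remainder_bound :: "nat \<Rightarrow> nat \<Rightarrow> real \<Rightarrow> real" where
  "remainder_bound d n W =
     (real (card (forests_upto d n)))\<^sup>2 * (1 + real (card (forests_upto d n)))\<^sup>2 * (coproduct_bound d n)\<^sup>2 * W\<^sup>2"

text \<open>The errors of \<open>product_form\<close> in order: slow variation times integrals,
  sewing errors times translates, difference of products, truncation remainder.\<close>

definition product_bound :: "nat \<Rightarrow> nat \<Rightarrow> real \<Rightarrow> real \<Rightarrow> real" where
  "product_bound d n \<theta> W =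
     2 * integral_bound d n \<theta> W + 2 * (sewing_bound d n \<theta> * (1 + W powr \<theta>) * W)
     + (real (card (forests_upto d n)))\<^sup>2 * (2 + W powr \<theta>) * W + remainder_bound d n W"

lemma coproduct_bound_nonneg: "0 \<le> coproduct_bound d n"
  by (simp add: coproduct_bound_def sum_nonneg)

lemma size_coproduct_le: "\<rho> \<in> forests_upto d n \<Longrightarrow> size (coproduct \<rho>) \<le> coproduct_bound d n"
  unfolding coproduct_bound_def by (intro member_le_sum) auto

lemma card_fibre_le: "card {z \<in> F \<times> F. P z} \<le> (card F)\<^sup>2" if "finite F"
  using card_mono[of "F \<times> F" "{z \<in> F \<times> F. P z}"] that by (auto simp: power2_eq_square)

lemma sum_pairs_le:
  fixes f :: "'i \<times> 'i \<Rightarrow> real"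
  assumes "finite F" "\<And>z. z \<in> F \<times> F \<Longrightarrow> P z \<Longrightarrow> \<bar>f z\<bar> \<le> C" "0 \<le> C"
  shows "\<bar>\<Sum>z\<in>{z \<in> F \<times> F. P z}. f z\<bar> \<le> (real (card F))\<^sup>2 * C"
proof -
  have "\<bar>\<Sum>z\<in>{z \<in> F \<times> F. P z}. f z\<bar> \<le> (\<Sum>z\<in>{z \<in> F \<times> F. P z}. C)"
    using assms(2) by (intro order_trans[OF sum_abs] sum_mono) auto
  also have "\<dots> = real (card {z \<in> F \<times> F. P z}) * C" by simp
  also have "\<dots> \<le> real ((card F)\<^sup>2) * C"
    using assms(1,3) by (intro mult_right_mono of_nat_mono card_fibre_le) auto
  finally show ?thesis by simp
qed

section \<open>Estimates for the truncation remainder and the product form\<close>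

context rough_path
begin

lemma abs_contract_mult_le:
  assumes st: "0 \<le> s" "s \<le> t" "t \<le> T" and F: "\<rho>\<^sub>1 \<in> F" "\<rho>\<^sub>2 \<in> F"
  shows "\<bar>contract (inc s t) \<rho>\<^sub>1 \<sigma>\<^sub>1 * contract (inc s t) \<rho>\<^sub>2 \<sigma>\<^sub>2\<bar>
    \<le> (coproduct_bound d (trunc p))\<^sup>2 *
      (\<omega> s t powr (1 / p)) ^ (forest_degree \<rho>\<^sub>1 + forest_degree \<rho>\<^sub>2 - forest_degree (\<sigma>\<^sub>1 + \<sigma>\<^sub>2))"
\<comment> \<open>With natural subtraction the exponents add up if each \<sigma> has degree at most
  that of its \<rho>; otherwise a contraction vanishes.\<close>
proof (cases "forest_degree \<rho>\<^sub>1 < forest_degree \<sigma>\<^sub>1 \<or> forest_degree \<rho>\<^sub>2 < forest_degree \<sigma>\<^sub>2")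
  case True
  then show ?thesis using contract_eq_0 by (auto simp: contract_eq_0)
next
  case False
  let ?h = "\<omega> s t powr (1 / p)"
  have *: "\<bar>contract (inc s t) \<rho> \<sigma>\<bar> \<le> coproduct_bound d (trunc p) * ?h ^ (forest_degree \<rho> - forest_degree \<sigma>)"
    if "\<rho> \<in> F" for \<rho> \<sigma>
  proof -
    have "\<bar>contract (inc s t) \<rho> \<sigma>\<bar> \<le> real (size (coproduct \<rho>)) * ?h ^ (forest_degree \<rho> - forest_degree \<sigma>)"
      by (rule abs_contract_le[OF abs_inc_le[OF st]]) simp
    also have "\<dots> \<le> coproduct_bound d (trunc p) * ?h ^ (forest_degree \<rho> - forest_degree \<sigma>)"
      using size_coproduct_le[OF that] by (intro mult_right_mono) auto
    finally show ?thesis .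
  qed
  have "\<bar>contract (inc s t) \<rho>\<^sub>1 \<sigma>\<^sub>1 * contract (inc s t) \<rho>\<^sub>2 \<sigma>\<^sub>2\<bar>
    \<le> (coproduct_bound d (trunc p) * ?h ^ (forest_degree \<rho>\<^sub>1 - forest_degree \<sigma>\<^sub>1))
      * (coproduct_bound d (trunc p) * ?h ^ (forest_degree \<rho>\<^sub>2 - forest_degree \<sigma>\<^sub>2))"
    unfolding abs_mult using *[OF F(1)] *[OF F(2)] coproduct_bound_nonneg by (intro mult_mono) auto
  also have "\<dots> = (coproduct_bound d (trunc p))\<^sup>2 *
      ?h ^ ((forest_degree \<rho>\<^sub>1 - forest_degree \<sigma>\<^sub>1) + (forest_degree \<rho>\<^sub>2 - forest_degree \<sigma>\<^sub>2))"
    by (simp add: power_add power2_eq_square)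
  also have "(forest_degree \<rho>\<^sub>1 - forest_degree \<sigma>\<^sub>1) + (forest_degree \<rho>\<^sub>2 - forest_degree \<sigma>\<^sub>2)
      = forest_degree \<rho>\<^sub>1 + forest_degree \<rho>\<^sub>2 - forest_degree (\<sigma>\<^sub>1 + \<sigma>\<^sub>2)"
    using False by simp
  finally show ?thesis .
qed

text \<open>The two contractions together have order
  \<open>(|\<rho>\<^sub>1| + |\<rho>\<^sub>2| - |\<sigma>|) / p\<close>, and the total degree of a
  discarded pair is at least [p] + 1, hence at least \<theta> p.\<close>

lemma abs_truncation_remainder_le:
  assumes st: "0 \<le> s" "s \<le> t" "t \<le> T" and \<sigma>: "\<sigma> \<in> F" and \<theta>: "0 \<le> \<theta>" "\<theta> \<le> (trunc p + 1) / p"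
    and w: "\<And>\<rho>. \<rho> \<in> F \<Longrightarrow> \<bar>w \<rho>\<bar> \<le> M\<^sub>1" "0 \<le> M\<^sub>1"
    and v: "\<And>\<rho>. \<rho> \<in> F \<Longrightarrow> \<bar>v \<rho>\<bar> \<le> M\<^sub>2" "0 \<le> M\<^sub>2"
  shows "\<bar>truncation_remainder d (trunc p) (inc s t) w v \<sigma>\<bar>
    \<le> remainder_bound d (trunc p) W * (M\<^sub>1 * M\<^sub>2) * \<omega> s t powr (\<theta> - forest_degree \<sigma> / p)"
proof -
  let ?D = "\<omega> s t powr (\<theta> - forest_degree \<sigma> / p)"
  let ?\<kappa> = "coproduct_bound d (trunc p)"
  let ?F0 = "insert {#} F"
  let ?C = "\<lambda>z y. contract (inc s t) (fst z) (fst y) * contract (inc s t) (snd z) (snd y)"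
  have inner: "\<bar>\<Sum>y\<in>{y \<in> ?F0 \<times> ?F0. fst y + snd y = \<sigma>}. ?C z y\<bar>
      \<le> (1 + real (card F))\<^sup>2 * (?\<kappa>\<^sup>2 * (?D * W\<^sup>2))"
    if z: "z \<in> F \<times> F" "trunc p < forest_degree (fst z) + forest_degree (snd z)" for z
  proof -
    let ?k = "forest_degree (fst z) + forest_degree (snd z) - forest_degree \<sigma>"
    \<comment> \<open>The surplus over the required order: nonnegative by the bound on \<theta>, and
      at most 2 since both degrees are at most \<open>p\<close>.\<close>
    let ?e = "(real (forest_degree (fst z)) + real (forest_degree (snd z))) / p - \<theta>"
    have deg: "forest_degree \<sigma> \<le> trunc p" "forest_degree (fst z) \<le> trunc p" "forest_degree (snd z) \<le> trunc p"
      using \<sigma> z by (auto simp: in_forests_upto_iff)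
    have e: "0 \<le> ?e"
    proof -
      have "real (trunc p) + 1 \<le> real (forest_degree (fst z)) + real (forest_degree (snd z))"
        using z(2) by linarith
      then have "(real (trunc p) + 1) / p \<le> (real (forest_degree (fst z)) + real (forest_degree (snd z))) / p"
        using p_ge_1 by (intro divide_right_mono) auto
      then show ?thesis using \<theta>(2) by (simp add: add.commute)
    qed
    have e2: "?e \<le> 2"
    proof -
      have "real (forest_degree (fst z)) \<le> p" "real (forest_degree (snd z)) \<le> p"
        using deg trunc_le by linarith+
      then have "(real (forest_degree (fst z)) + real (forest_degree (snd z))) / p \<le> 2"
        using p_ge_1 by (simp add: divide_le_eq)
      then show ?thesis using \<theta>(1) by simp
    qed
    \<comment> \<open>\<open>?k\<close> is at least 1 because |\<sigma>| \<le> [p] lies below the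
      total degree of the pair.\<close>
    have "(\<omega> s t powr (1 / p)) ^ ?k = \<omega> s t powr (?k / p)"
      using deg z(2) by (intro root_control_power) auto
    also have "?k / p = (\<theta> - forest_degree \<sigma> / p) + ?e"
      using deg z(2) by (simp add: of_nat_diff diff_divide_distrib)
    also have "\<omega> s t powr \<dots> \<le> ?D * W powr 2"
      using control_powr_add_le st e e2 by blast
    finally have pow: "(\<omega> s t powr (1 / p)) ^ ?k \<le> ?D * W\<^sup>2"
      using W_ge_1 by simp
    have "\<bar>?C z y\<bar> \<le> ?\<kappa>\<^sup>2 * (?D * W\<^sup>2)" if "fst y + snd y = \<sigma>" for y
    proof -
      have "\<bar>?C z y\<bar> \<le> ?\<kappa>\<^sup>2 * (\<omega> s t powr (1 / p)) ^ ?k"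
        using abs_contract_mult_le[OF st, of "fst z" "snd z" "fst y" "snd y"] z(1) that by auto
      also have "\<dots> \<le> ?\<kappa>\<^sup>2 * (?D * W\<^sup>2)"
        using pow by (rule mult_left_mono) simp
      finally show ?thesis .
    qed
    then have "\<bar>\<Sum>y\<in>{y \<in> ?F0 \<times> ?F0. fst y + snd y = \<sigma>}. ?C z y\<bar>
        \<le> (real (card ?F0))\<^sup>2 * (?\<kappa>\<^sup>2 * (?D * W\<^sup>2))"
      by (intro sum_pairs_le) auto
    then show ?thesis by simp
  qed
  have "\<bar>truncation_remainder d (trunc p) (inc s t) w v \<sigma>\<bar>
    \<le> (real (card F))\<^sup>2 * ((M\<^sub>1 * M\<^sub>2) * ((1 + real (card F))\<^sup>2 * (?\<kappa>\<^sup>2 * (?D * W\<^sup>2))))"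
    unfolding truncation_remainder_def case_prod_unfold
  proof (intro sum_pairs_le)
    fix z assume z: "z \<in> F \<times> F" "trunc p < forest_degree (fst z) + forest_degree (snd z)"
    have "\<bar>w (fst z) * v (snd z)\<bar> \<le> M\<^sub>1 * M\<^sub>2"
      unfolding abs_mult using w v z by (intro mult_mono) auto
    then show "\<bar>w (fst z) * v (snd z) * (\<Sum>y\<in>{y \<in> ?F0 \<times> ?F0. fst y + snd y = \<sigma>}. ?C z y)\<bar>
        \<le> (M\<^sub>1 * M\<^sub>2) * ((1 + real (card F))\<^sup>2 * (?\<kappa>\<^sup>2 * (?D * W\<^sup>2)))"
      unfolding abs_mult[of "w (fst z) * v (snd z)"] using inner[OF z] w(2) v(2)
      by (intro mult_mono) auto
  qed (use w(2) v(2) in auto)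
  then show ?thesis by (simp add: remainder_bound_def mult_ac)
qed

lemma mult_coeff_le:
  assumes "\<And>\<rho>. \<rho> \<in> F \<Longrightarrow> \<bar>w \<rho>\<bar> \<le> M\<^sub>1" "0 \<le> M\<^sub>1" "\<And>\<rho>. \<rho> \<in> F \<Longrightarrow> \<bar>v \<rho>\<bar> \<le> M\<^sub>2" "0 \<le> M\<^sub>2" "\<sigma> \<in> F"
  shows "\<bar>mult_coeff d (trunc p) w v \<sigma>\<bar> \<le> (real (card F))\<^sup>2 * (M\<^sub>1 * M\<^sub>2)"
proof -
  have "\<bar>\<Sum>z\<in>{z \<in> F \<times> F. fst z + snd z = \<sigma>}. w (fst z) * v (snd z)\<bar> \<le> (real (card F))\<^sup>2 * (M\<^sub>1 * M\<^sub>2)"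
    using assms by (intro sum_pairs_le) (auto simp: abs_mult intro!: mult_mono)
  then show ?thesis using assms(5) by (simp add: mult_coeff_def case_prod_unfold)
qed

text \<open>Telescoping of a difference of products. The error at one factor of \<sigma> has a
  surplus exponent |\<rho>'| / p \<le> 1, with \<rho>' the other factor, and \<open>W\<close>
  absorbs it. In the application \<open>K\<close> is \<open>1 + W powr \<theta>\<close>, from
  \<open>translate_coeff_le\<close>.\<close>

lemma mult_coeff_diff_le:
  assumes st: "0 \<le> s" "s \<le> t" "t \<le> T" and \<sigma>: "\<sigma> \<in> F"
    and K: "1 \<le> K" and M: "0 \<le> M\<^sub>1" "0 \<le> M\<^sub>2"
    and w': "\<And>\<rho>. \<rho> \<in> F \<Longrightarrow> \<bar>w' \<rho>\<bar> \<le> M\<^sub>1 * K"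
    and v: "\<And>\<rho>. \<rho> \<in> F \<Longrightarrow> \<bar>v \<rho>\<bar> \<le> M\<^sub>2"
    and ww': "\<And>\<rho>. \<rho> \<in> F \<Longrightarrow> \<bar>w \<rho> - w' \<rho>\<bar> \<le> M\<^sub>1 * \<omega> s t powr (\<theta> - forest_degree \<rho> / p)"
    and vv': "\<And>\<rho>. \<rho> \<in> F \<Longrightarrow> \<bar>v \<rho> - v' \<rho>\<bar> \<le> M\<^sub>2 * \<omega> s t powr (\<theta> - forest_degree \<rho> / p)"
  shows "\<bar>mult_coeff d (trunc p) w v \<sigma> - mult_coeff d (trunc p) w' v' \<sigma>\<bar>
    \<le> (real (card F))\<^sup>2 * (1 + K) * W * (M\<^sub>1 * M\<^sub>2) * \<omega> s t powr (\<theta> - forest_degree \<sigma> / p)"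
proof -
  let ?D = "\<omega> s t powr (\<theta> - forest_degree \<sigma> / p)"
  have shift: "\<omega> s t powr (\<theta> - forest_degree \<rho> / p) \<le> ?D * W"
    if "\<rho> + \<rho>' = \<sigma>" "\<rho>' \<in> F" for \<rho> \<rho>'
  proof -
    have "forest_degree \<sigma> = forest_degree \<rho> + forest_degree \<rho>'" using that(1) by auto
    then have eq: "\<theta> - forest_degree \<rho> / p = (\<theta> - forest_degree \<sigma> / p) + forest_degree \<rho>' / p"
      by (simp add: add_divide_distrib)
    show ?thesis
      unfolding eq using control_powr_add_le[OF st, of "forest_degree \<rho>' / p" 1 "\<theta> - forest_degree \<sigma> / p"]
        degree_div_p_le_1[OF that(2)] p_ge_1 W_ge_1 by simp
  qed
  have "\<bar>\<Sum>z\<in>{z \<in> F \<times> F. fst z + snd z = \<sigma>}. w (fst z) * v (snd z) - w' (fst z) * v' (snd z)\<bar>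
      \<le> (real (card F))\<^sup>2 * (M\<^sub>1 * (?D * W) * M\<^sub>2 + M\<^sub>1 * K * (M\<^sub>2 * (?D * W)))"
  proof (rule sum_pairs_le)
    fix z assume z: "z \<in> F \<times> F" "fst z + snd z = \<sigma>"
    have z': "fst z \<in> F" "snd z \<in> F" "snd z + fst z = \<sigma>" using z by (auto simp: add.commute)
    have "\<bar>w (fst z) - w' (fst z)\<bar> \<le> M\<^sub>1 * (?D * W)"
      using ww'[OF z'(1)] mult_left_mono[OF shift[OF z(2) z'(2)] M(1)] by simp
    then have 1: "\<bar>(w (fst z) - w' (fst z)) * v (snd z)\<bar> \<le> M\<^sub>1 * (?D * W) * M\<^sub>2"
      unfolding abs_mult using v[OF z'(2)] M by (intro mult_mono) auto
    have "\<bar>v (snd z) - v' (snd z)\<bar> \<le> M\<^sub>2 * (?D * W)"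
      using vv'[OF z'(2)] mult_left_mono[OF shift[OF z'(3,1)] M(2)] by simp
    then have 2: "\<bar>w' (fst z) * (v (snd z) - v' (snd z))\<bar> \<le> M\<^sub>1 * K * (M\<^sub>2 * (?D * W))"
      unfolding abs_mult using w'[OF z'(1)] M K by (intro mult_mono) auto
    have "w (fst z) * v (snd z) - w' (fst z) * v' (snd z)
        = (w (fst z) - w' (fst z)) * v (snd z) + w' (fst z) * (v (snd z) - v' (snd z))"
      by (simp add: algebra_simps)
    then show "\<bar>w (fst z) * v (snd z) - w' (fst z) * v' (snd z)\<bar>
        \<le> M\<^sub>1 * (?D * W) * M\<^sub>2 + M\<^sub>1 * K * (M\<^sub>2 * (?D * W))"
      using 1 2 by linarith
  qed (use M K W_ge_1 in auto)
  also have "\<dots> = (real (card F))\<^sup>2 * (1 + K) * W * (M\<^sub>1 * M\<^sub>2) * ?D"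
    by (simp add: algebra_simps)
  finally show ?thesis
    using \<sigma> by (simp add: mult_coeff_def case_prod_unfold sum_subtractf)
qed

lemma product_form:
  assumes "slow_form d p T X \<theta> M\<^sub>1 \<beta>\<^sub>1 w\<^sub>1" "slow_form d p T X \<theta> M\<^sub>2 \<beta>\<^sub>2 w\<^sub>2"
    and \<theta>: "\<theta> \<le> (trunc p + 1) / p"
    and \<beta>: "\<And>t a. 0 \<le> t \<Longrightarrow> t \<le> T \<Longrightarrow> a \<in> carrier G \<Longrightarrow>
      \<beta> t a = rough_integral d p X \<beta>\<^sub>1 t * \<beta>\<^sub>2 t a + \<beta>\<^sub>1 t a * rough_integral d p X \<beta>\<^sub>2 t
        + one_form_mult d (trunc p) (\<beta>\<^sub>1 t) (\<beta>\<^sub>2 t) a"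
  defines "w \<equiv> \<lambda>t \<rho>. rough_integral d p X \<beta>\<^sub>1 t * w\<^sub>2 t \<rho> + rough_integral d p X \<beta>\<^sub>2 t * w\<^sub>1 t \<rho>
      + mult_coeff d (trunc p) (w\<^sub>1 t) (w\<^sub>2 t) \<rho>"
  shows "0 \<le> t \<Longrightarrow> t \<le> T \<Longrightarrow> represents d (trunc p) (w t) (\<beta> t)"
    and "0 \<le> t \<Longrightarrow> t \<le> T \<Longrightarrow> \<sigma> \<in> F \<Longrightarrow>
      \<bar>w t \<sigma>\<bar> \<le> (2 * integral_bound d (trunc p) \<theta> W + (real (card F))\<^sup>2) * (M\<^sub>1 * M\<^sub>2)"
    and "0 \<le> s \<Longrightarrow> s < t \<Longrightarrow> t \<le> T \<Longrightarrow> \<sigma> \<in> F \<Longrightarrow>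
      \<bar>w t \<sigma> - translate_coeff d (trunc p) (inc s t) (w s) \<sigma>\<bar>
        \<le> product_bound d (trunc p) \<theta> W * (M\<^sub>1 * M\<^sub>2) * \<omega> s t powr (\<theta> - forest_degree \<sigma> / p)"
proof -
  interpret A: slow_form d p T X \<theta> M\<^sub>1 \<beta>\<^sub>1 w\<^sub>1 by fact
  interpret B: slow_form d p T X \<theta> M\<^sub>2 \<beta>\<^sub>2 w\<^sub>2 by fact
  let ?I = "integral_bound d (trunc p) \<theta> W" and ?K = "sewing_bound d (trunc p) \<theta>"
  have I: "0 \<le> ?I" using A.theta_gt_1 W_ge_1 by (intro integral_bound_nonneg) auto
  have K: "0 \<le> ?K" using A.theta_gt_1 by (intro sewing_bound_nonneg)
  show "represents d (trunc p) (w t) (\<beta> t)" if t: "0 \<le> t" "t \<le> T" for t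
    unfolding w_def
    by (rule represents_cong[OF represents_lincomb[OF B.rep[OF t] A.rep[OF t] represents_mult[OF A.rep[OF t] B.rep[OF t]]]])
      (simp add: \<beta>[OF t] mult.commute)
  show "\<bar>w t \<sigma>\<bar> \<le> (2 * ?I + (real (card F))\<^sup>2) * (M\<^sub>1 * M\<^sub>2)"
    if t: "0 \<le> t" "t \<le> T" and \<sigma>: "\<sigma> \<in> F" for t \<sigma>
  proof -
    have "\<bar>A.integral t * w\<^sub>2 t \<sigma>\<bar> \<le> ?I * M\<^sub>1 * M\<^sub>2"
      unfolding abs_mult using A.integral_le[OF t] B.coeff_le[OF t \<sigma>] I A.M_nonneg by (intro mult_mono) auto
    moreover have "\<bar>B.integral t * w\<^sub>1 t \<sigma>\<bar> \<le> ?I * M\<^sub>2 * M\<^sub>1"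
      unfolding abs_mult using B.integral_le[OF t] A.coeff_le[OF t \<sigma>] I B.M_nonneg by (intro mult_mono) auto
    moreover have "\<bar>mult_coeff d (trunc p) (w\<^sub>1 t) (w\<^sub>2 t) \<sigma>\<bar> \<le> (real (card F))\<^sup>2 * (M\<^sub>1 * M\<^sub>2)"
      using A.coeff_le[OF t] B.coeff_le[OF t] A.M_nonneg B.M_nonneg \<sigma> by (intro mult_coeff_le) auto
    ultimately have "\<bar>w t \<sigma>\<bar> \<le> ?I * M\<^sub>1 * M\<^sub>2 + ?I * M\<^sub>2 * M\<^sub>1 + (real (card F))\<^sup>2 * (M\<^sub>1 * M\<^sub>2)"
      unfolding w_def by linarith
    then show ?thesis by (simp add: algebra_simps)
  qed
  show "\<bar>w t \<sigma> - translate_coeff d (trunc p) (inc s t) (w s) \<sigma>\<bar>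
      \<le> product_bound d (trunc p) \<theta> W * (M\<^sub>1 * M\<^sub>2) * \<omega> s t powr (\<theta> - forest_degree \<sigma> / p)"
    if st: "0 \<le> s" "s < t" "t \<le> T" and \<sigma>: "\<sigma> \<in> F" for s t \<sigma>
  proof -
    have st': "0 \<le> t" "s \<le> t" "s \<le> T" using st by auto
    have x: "inc s t \<in> carrier G" using st by (intro inc_closed) auto
    let ?D = "\<omega> s t powr (\<theta> - forest_degree \<sigma> / p)"
    let ?R = "truncation_remainder d (trunc p) (inc s t) (w\<^sub>1 s) (w\<^sub>2 s) \<sigma>"
    define T1 where "T1 = translate_coeff d (trunc p) (inc s t) (w\<^sub>1 s)"
    define T2 where "T2 = translate_coeff d (trunc p) (inc s t) (w\<^sub>2 s)"
    \<comment> \<open>Sewing errors: in the translated product the value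
      \<open>\<beta>\<^sub>1 s (inc s t)\<close> takes the place of the increment of the
      integral.\<close>
    define E1 where "E1 = A.integral t - A.integral s - \<beta>\<^sub>1 s (inc s t)"
    define E2 where "E2 = B.integral t - B.integral s - \<beta>\<^sub>2 s (inc s t)"
    have d1: "\<bar>w\<^sub>1 t \<rho> - T1 \<rho>\<bar> \<le> M\<^sub>1 * \<omega> s t powr (\<theta> - forest_degree \<rho> / p)" if "\<rho> \<in> F" for \<rho>
      unfolding T1_def using A.increment_le[OF st that] .
    have d2: "\<bar>w\<^sub>2 t \<rho> - T2 \<rho>\<bar> \<le> M\<^sub>2 * \<omega> s t powr (\<theta> - forest_degree \<rho> / p)" if "\<rho> \<in> F" for \<rho>
      unfolding T2_def using B.increment_le[OF st that] .
    have T1: "\<bar>T1 \<rho>\<bar> \<le> M\<^sub>1 * (1 + W powr \<theta>)" if "\<rho> \<in> F" for \<rho>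
      unfolding T1_def using A.translate_coeff_le[OF st that] .
    have T2: "\<bar>T2 \<rho>\<bar> \<le> M\<^sub>2 * (1 + W powr \<theta>)" if "\<rho> \<in> F" for \<rho>
      unfolding T2_def using B.translate_coeff_le[OF st that] .
    have wD: "\<omega> s t powr \<theta> \<le> ?D * W"
      using control_powr_add_le[OF st(1) st'(2) st(3), of "forest_degree \<sigma> / p" 1 "\<theta> - forest_degree \<sigma> / p"]
        degree_div_p_le_1[OF \<sigma>] p_ge_1 W_ge_1 by simp
    have "\<bar>E1\<bar> \<le> ?K * M\<^sub>1 * \<omega> s t powr \<theta>"
      unfolding E1_def by (rule A.integral_increment[OF st(1) st'(2) st(3)])
    also have "\<dots> \<le> ?K * M\<^sub>1 * (?D * W)"
      using wD K A.M_nonneg by (intro mult_left_mono) auto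
    finally have E1: "\<bar>E1\<bar> \<le> ?K * M\<^sub>1 * (?D * W)" .
    have "\<bar>E2\<bar> \<le> ?K * M\<^sub>2 * \<omega> s t powr \<theta>"
      unfolding E2_def by (rule B.integral_increment[OF st(1) st'(2) st(3)])
    also have "\<dots> \<le> ?K * M\<^sub>2 * (?D * W)"
      using wD K B.M_nonneg by (intro mult_left_mono) auto
    finally have E2: "\<bar>E2\<bar> \<le> ?K * M\<^sub>2 * (?D * W)" .
    have "translate_coeff d (trunc p) (inc s t) (w s) \<sigma>
        = A.integral s * T2 \<sigma> + B.integral s * T1 \<sigma>
          + (\<beta>\<^sub>1 s (inc s t) * T2 \<sigma> + T1 \<sigma> * \<beta>\<^sub>2 s (inc s t) + mult_coeff d (trunc p) T1 T2 \<sigma> - ?R)"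
      unfolding w_def translate_coeff_lincomb translate_coeff_mult[OF x \<sigma>] T1_def T2_def
        A.eval_eq[OF st(1) st'(3) x] B.eval_eq[OF st(1) st'(3) x] ..
    \<comment> \<open>Substituting \<open>A.integral s + \<beta>\<^sub>1 s (inc s t) = A.integral t
      - E1\<close>, and likewise for \<open>B\<close>, leaves differences of coefficients with
      integrals at time \<open>t\<close> as factors. The remainder, subtracted in the translate,
      reappears with a plus sign.\<close>
    then have decomposition: "w t \<sigma> - translate_coeff d (trunc p) (inc s t) (w s) \<sigma>
        = A.integral t * (w\<^sub>2 t \<sigma> - T2 \<sigma>) + B.integral t * (w\<^sub>1 t \<sigma> - T1 \<sigma>) + E1 * T2 \<sigma> + E2 * T1 \<sigma>
          + (mult_coeff d (trunc p) (w\<^sub>1 t) (w\<^sub>2 t) \<sigma> - mult_coeff d (trunc p) T1 T2 \<sigma>) + ?R"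
      unfolding E1_def E2_def by (simp add: w_def algebra_simps)
    have 1: "\<bar>A.integral t * (w\<^sub>2 t \<sigma> - T2 \<sigma>)\<bar> \<le> ?I * M\<^sub>1 * (M\<^sub>2 * ?D)"
      unfolding abs_mult using A.integral_le[OF st'(1) st(3)] d2[OF \<sigma>] I A.M_nonneg
      by (intro mult_mono) auto
    have 2: "\<bar>B.integral t * (w\<^sub>1 t \<sigma> - T1 \<sigma>)\<bar> \<le> ?I * M\<^sub>2 * (M\<^sub>1 * ?D)"
      unfolding abs_mult using B.integral_le[OF st'(1) st(3)] d1[OF \<sigma>] I B.M_nonneg
      by (intro mult_mono) auto
    have 3: "\<bar>E1 * T2 \<sigma>\<bar> \<le> ?K * M\<^sub>1 * (?D * W) * (M\<^sub>2 * (1 + W powr \<theta>))"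
      unfolding abs_mult using E1 T2[OF \<sigma>] K A.M_nonneg W_ge_1 by (intro mult_mono) auto
    have 4: "\<bar>E2 * T1 \<sigma>\<bar> \<le> ?K * M\<^sub>2 * (?D * W) * (M\<^sub>1 * (1 + W powr \<theta>))"
      unfolding abs_mult using E2 T1[OF \<sigma>] K B.M_nonneg W_ge_1 by (intro mult_mono) auto
    have 5: "\<bar>mult_coeff d (trunc p) (w\<^sub>1 t) (w\<^sub>2 t) \<sigma> - mult_coeff d (trunc p) T1 T2 \<sigma>\<bar>
        \<le> (real (card F))\<^sup>2 * (1 + (1 + W powr \<theta>)) * W * (M\<^sub>1 * M\<^sub>2) * ?D"
      using T1 B.coeff_le[OF st'(1) st(3)] d1 d2 A.M_nonneg B.M_nonneg st st' \<sigma>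
      by (intro mult_coeff_diff_le) auto
    have 6: "\<bar>?R\<bar> \<le> remainder_bound d (trunc p) W * (M\<^sub>1 * M\<^sub>2) * ?D"
      using A.coeff_le[OF st(1) st'(3)] B.coeff_le[OF st(1) st'(3)] A.M_nonneg B.M_nonneg st st' \<sigma> \<theta> A.theta_gt_1
      by (intro abs_truncation_remainder_le) auto
    have "\<bar>w t \<sigma> - translate_coeff d (trunc p) (inc s t) (w s) \<sigma>\<bar>
        \<le> ?I * M\<^sub>1 * (M\<^sub>2 * ?D) + ?I * M\<^sub>2 * (M\<^sub>1 * ?D)
          + ?K * M\<^sub>1 * (?D * W) * (M\<^sub>2 * (1 + W powr \<theta>)) + ?K * M\<^sub>2 * (?D * W) * (M\<^sub>1 * (1 + W powr \<theta>))
          + (real (card F))\<^sup>2 * (1 + (1 + W powr \<theta>)) * W * (M\<^sub>1 * M\<^sub>2) * ?D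
          + remainder_bound d (trunc p) W * (M\<^sub>1 * M\<^sub>2) * ?D"
      unfolding decomposition by (intro order_trans[OF abs_triangle_ineq] add_mono 1 2 3 4 5 6)
    also have "\<dots> = product_bound d (trunc p) \<theta> W * (M\<^sub>1 * M\<^sub>2) * ?D"
    proof -
      \<comment> \<open>Free real variables in place of the constants leave a plain polynomial
        identity.\<close>
      have "i * M\<^sub>1 * (M\<^sub>2 * D) + i * M\<^sub>2 * (M\<^sub>1 * D)
          + k * M\<^sub>1 * (D * W') * (M\<^sub>2 * (1 + P)) + k * M\<^sub>2 * (D * W') * (M\<^sub>1 * (1 + P))
          + N * (1 + (1 + P)) * W' * (M\<^sub>1 * M\<^sub>2) * D + r * (M\<^sub>1 * M\<^sub>2) * D
        = (2 * i + 2 * (k * (1 + P) * W') + N * (2 + P) * W' + r) * (M\<^sub>1 * M\<^sub>2) * D"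
        for i k P N r D W' :: real
        by algebra
      then show ?thesis unfolding product_bound_def .
    qed
    finally show ?thesis .
  qed
qed

end

section \<open>From coefficient bounds to the norm inequality\<close>

lemma product_bound_nonneg:
  assumes "1 < \<theta>" "1 \<le> W"
  shows "0 \<le> product_bound d n \<theta> W"
  using assms by (simp add: product_bound_def remainder_bound_def integral_bound_nonneg sewing_bound_nonneg)

text \<open>Taking the norm itself as the constant makes the final bound a product of norms.
  \<open>slowly_varying\<close> provides the coefficients, the finite norm at \<theta> the
  inequalities.\<close>

lemma rough_path_slow_form:
  assumes "rough_path d p T X" "1 < \<theta>" "slowly_varying d p T X \<beta>" "slow_norm d p T X \<theta> \<beta> < \<infinity>"
  shows "slow_form d p T X \<theta> (enn2real (slow_norm d p T X \<theta> \<beta>)) \<beta> (\<lambda>t. coefficient d (trunc p) (\<beta> t))"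
proof -
  interpret rough_path d p T X by fact
  have rep: "represents d (trunc p) (coefficient d (trunc p) (\<beta> t)) (\<beta> t)" if "0 \<le> t" "t \<le> T" for t
    using assms(3) that by (intro represents_coefficient) (auto simp: slowly_varying_def)
  have le: "slow_norm d p T X \<theta> \<beta> \<le> ennreal (enn2real (slow_norm d p T X \<theta> \<beta>))"
    using assms(4) by (simp add: infinity_ennreal_def)
  show ?thesis
    using slow_normD[OF rep le] rep assms(2) by unfold_locales auto
qed

theorem lemma20:
  "\<exists>C :: real \<Rightarrow> nat \<Rightarrow> real \<Rightarrow> real \<Rightarrow> real.
     \<forall>(p::real) (d::nat) (\<theta>::real) (T::real)
        (X :: real \<Rightarrow> forest \<Rightarrow> real)
        (\<beta>\<^sub>1 :: real \<Rightarrow> (forest \<Rightarrow> real) \<Rightarrow> real)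
        (\<beta>\<^sub>2 :: real \<Rightarrow> (forest \<Rightarrow> real) \<Rightarrow> real)
        (\<beta> :: real \<Rightarrow> (forest \<Rightarrow> real) \<Rightarrow> real).
       p \<ge> 1 \<and> d \<ge> 1 \<and> T > 0 \<and>
       branched_rough_path d p T X \<and>
       slowly_varying d p T X \<beta>\<^sub>1 \<and>
       slowly_varying d p T X \<beta>\<^sub>2 \<and>
       1 < \<theta> \<and> \<theta> \<le> (trunc p + 1) / p \<and>
       slow_norm d p T X \<theta> \<beta>\<^sub>1 < \<infinity> \<and>
       slow_norm d p T X \<theta> \<beta>\<^sub>2 < \<infinity> \<and>
       (\<forall>t\<in>{0..T}. \<forall>a\<in>carrier (character_group d (trunc p)).
          \<beta> t a = rough_integral d p X \<beta>\<^sub>1 t * \<beta>\<^sub>2 t a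
                + \<beta>\<^sub>1 t a * rough_integral d p X \<beta>\<^sub>2 t
                + one_form_mult d (trunc p) (\<beta>\<^sub>1 t) (\<beta>\<^sub>2 t) a)
       \<longrightarrow>
       slowly_varying d p T X \<beta> \<and>
       slow_norm d p T X \<theta> \<beta>
         \<le> ennreal (C p d \<theta> (control d p X 0 T))
           * slow_norm d p T X \<theta> \<beta>\<^sub>1 * slow_norm d p T X \<theta> \<beta>\<^sub>2"
proof (intro exI allI impI; elim conjE)
  fix p d \<theta> T X \<beta>\<^sub>1 \<beta>\<^sub>2 \<beta>
  assume p: "(p::real) \<ge> 1" and d: "(d::nat) \<ge> 1" and T: "(T::real) > 0"
    and X: "branched_rough_path d p T X"
    and \<beta>\<^sub>1: "slowly_varying d p T X \<beta>\<^sub>1" "slow_norm d p T X \<theta> \<beta>\<^sub>1 < \<infinity>"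
    and \<beta>\<^sub>2: "slowly_varying d p T X \<beta>\<^sub>2" "slow_norm d p T X \<theta> \<beta>\<^sub>2 < \<infinity>"
    and \<theta>: "1 < \<theta>" "\<theta> \<le> (trunc p + 1) / p"
    and \<beta>: "\<forall>t\<in>{0..T}. \<forall>a\<in>carrier (character_group d (trunc p)).
          \<beta> t a = rough_integral d p X \<beta>\<^sub>1 t * \<beta>\<^sub>2 t a
                + \<beta>\<^sub>1 t a * rough_integral d p X \<beta>\<^sub>2 t
                + one_form_mult d (trunc p) (\<beta>\<^sub>1 t) (\<beta>\<^sub>2 t) a"
  interpret rough_path d p T X using p d T X by unfold_locales
  define M\<^sub>1 where "M\<^sub>1 = enn2real (slow_norm d p T X \<theta> \<beta>\<^sub>1)"
  define M\<^sub>2 where "M\<^sub>2 = enn2real (slow_norm d p T X \<theta> \<beta>\<^sub>2)"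
  have M: "0 \<le> M\<^sub>1" "0 \<le> M\<^sub>2" "ennreal M\<^sub>1 = slow_norm d p T X \<theta> \<beta>\<^sub>1" "ennreal M\<^sub>2 = slow_norm d p T X \<theta> \<beta>\<^sub>2"
    using \<beta>\<^sub>1(2) \<beta>\<^sub>2(2) by (auto simp: M\<^sub>1_def M\<^sub>2_def infinity_ennreal_def)
  have s1: "slow_form d p T X \<theta> M\<^sub>1 \<beta>\<^sub>1 (\<lambda>t. coefficient d (trunc p) (\<beta>\<^sub>1 t))"
    unfolding M\<^sub>1_def by (rule rough_path_slow_form[OF rough_path_axioms \<theta>(1) \<beta>\<^sub>1])
  have s2: "slow_form d p T X \<theta> M\<^sub>2 \<beta>\<^sub>2 (\<lambda>t. coefficient d (trunc p) (\<beta>\<^sub>2 t))"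
    unfolding M\<^sub>2_def by (rule rough_path_slow_form[OF rough_path_axioms \<theta>(1) \<beta>\<^sub>2])
  \<comment> \<open>\<open>?A\<close> bounds the coefficients and \<open>?B\<close> their slow
    variation, both per unit of \<open>M\<^sub>1 * M\<^sub>2\<close>.\<close>
  let ?A = "2 * integral_bound d (trunc p) \<theta> W + (real (card F))\<^sup>2"
  let ?B = "product_bound d (trunc p) \<theta> W"
  have A: "0 \<le> ?A" using W_ge_1 \<theta>(1) by (simp add: integral_bound_nonneg)
  have B: "0 \<le> ?B" using W_ge_1 \<theta>(1) by (simp add: product_bound_nonneg)
  note product = product_form[OF s1 s2 \<theta>(2), of \<beta>, OF \<beta>[rule_format]]
  have "slow_norm d p T X \<theta> \<beta> \<le> ennreal (?A * (M\<^sub>1 * M\<^sub>2) + ?B * (M\<^sub>1 * M\<^sub>2))"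
    using product M(1,2) A B by (intro slow_norm_leI) auto
  also have "?A * (M\<^sub>1 * M\<^sub>2) + ?B * (M\<^sub>1 * M\<^sub>2) = (?A + ?B) * M\<^sub>1 * M\<^sub>2"
    by (simp add: distrib_right mult.assoc)
  also have "ennreal \<dots> = ennreal (?A + ?B) * slow_norm d p T X \<theta> \<beta>\<^sub>1 * slow_norm d p T X \<theta> \<beta>\<^sub>2"
    using M(1,2) A B by (simp add: ennreal_mult flip: M(3,4))
  finally have le: "slow_norm d p T X \<theta> \<beta> \<le> ennreal (?A + ?B) * slow_norm d p T X \<theta> \<beta>\<^sub>1 * slow_norm d p T X \<theta> \<beta>\<^sub>2" .
  also have "\<dots> < \<infinity>"
    using \<beta>\<^sub>1(2) \<beta>\<^sub>2(2) by (simp add: ennreal_mult_less_top infinity_ennreal_def)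
  finally have "slow_norm d p T X \<theta> \<beta> < \<infinity>" .
  moreover have "\<forall>t\<in>{0..T}. \<beta> t \<in> one_forms d (trunc p)"
    unfolding one_forms_def using product(1) by (metis (mono_tags) atLeastAtMost_iff mem_Collect_eq)
  \<comment> \<open>The existential witness is fixed here by unification, as a closed function of
    \<open>p\<close>, \<open>d\<close>, \<open>\<theta>\<close> and \<open>\<Omega>\<close>, the
    last standing for \<omega>(0, T). It therefore cannot depend on \<open>T\<close>,
    \<open>X\<close> or the forms.\<close>
  ultimately show "slowly_varying d p T X \<beta> \<and> slow_norm d p T X \<theta> \<beta>
         \<le> ennreal ((\<lambda>p d \<theta> \<Omega>. 2 * integral_bound d (trunc p) \<theta> (1 + \<Omega>)
             + (real (card (forests_upto d (trunc p))))\<^sup>2 + product_bound d (trunc p) \<theta> (1 + \<Omega>))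
           p d \<theta> (control d p X 0 T))
           * slow_norm d p T X \<theta> \<beta>\<^sub>1 * slow_norm d p T X \<theta> \<beta>\<^sub>2"
    using le \<theta>(1) by (auto simp: slowly_varying_def)
qed

end
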